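(* Let $-\infty<\gamma<\beta<\alpha<\infty$ and let $\nu$ be an infinitely divisible probability measure on a real separable Banach space $E$ such that all the random integrals appearing in the identity below are well defined. Then $$I^{t,\,r_{\beta,\alpha}(t)}_{(0,1)}\big(I^{s,\,r_{\gamma,\beta}(s)}_{(0,1)}(\nu)\big)=I^{s,\,r_{\gamma,\beta}(s)}_{(0,1)}\big(I^{t,\,r_{\beta,\alpha}(t)}_{(0,1)}(\nu)\big)=I^{u,\,r_{\gamma,\alpha}(u)}_{(0,1)}(\nu).$$
   Context: For reals $\beta<\alpha$ define the time change clock $$r_{\beta,\alpha}(t):=\frac{1}{\Gamma(\alpha-\beta)}\int_t^1(1-u)^{\alpha-\beta-1}u^{-\alpha-1}\,du,\qquad 0<t<1,$$ where $\Gamma$ is the Euler gamma function; $r_{\gamma,\beta}$ and $r_{\gamma,\alpha}$ are given by the same formula with the corresponding pairs of parameters. Let $E$ be a real separable Banach space. For an infinitely divisible probability measure $\nu$ on $E$, let $Y_\nu(t)$, $t\ge 0$, be a càdlàg Lévy process in $E$ (stationary independent increments, $Y_\nu(0)=0$) such that $Y_\nu(1)$ has law $\nu$. For an interval $(a,b]$ in the positive half-line, a deterministic function $h$ (the space change) and a monotone nonnegative function $r$ (the inner clock time change), the random integral mapping is $$I^{h,r}_{(a,b]}(\nu):=\mathcal L\Big(\int_{(a,b]}h(t)\,dY_\nu(r(t))\Big),$$ where $\mathcal L$ denotes probability distribution. The integral is defined by formal integration by parts, $$\int_{(a,b]}h(t)\,dY_\nu(r(t)):=h(b)Y_\nu(r(b))-h(a)Y_\nu(r(a))-\int_{(a,b]}Y_\nu(r(t)-)\,dh(t)$$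 when $r$ is nondecreasing. When $r$ is nonincreasing (as are all the clocks here), increments are oriented positively, i.e. the integral is minus the right-hand side above. With this convention, if $\Phi=\log\hat\nu$ denotes the Lévy exponent of $\nu$ on the dual space $E'$, then $I^{h,r}_{(a,b]}(\nu)$ has Lévy exponent $y\mapsto\int_{(a,b]}\Phi(h(t)y)\,|dr(t)|$. The improper mapping $I^{h,r}_{(0,1)}$ is the law of the limit of the integrals over $(a,b]$ as $a\downarrow 0$ and $b\uparrow 1$; the integral is well defined for $\nu$ when this limit exists. In a superscript such as $I^{t,\,r(t)}$, the first entry is the space change function (here $h(t)=t$) and the second is the clock $r(t)$; the names $s,t,u$ of the variable are immaterial. *)

theory Defs
  imports "HOL-Probability.Probability"
begin

(* The image of the product measure under summation is the n-fold convolution power; the library's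
   binary convolution is restricted to ordered Euclidean spaces. *)
definition infinitely_divisible ::
    "'a::{banach, second_countable_topology} measure \<Rightarrow> bool" where
  "infinitely_divisible \<nu> \<longleftrightarrow>
     prob_space \<nu> \<and> sets \<nu> = sets borel \<and>
     (\<forall>n>0. \<exists>\<mu>. prob_space \<mu> \<and> sets \<mu> = sets borel \<and>
        \<nu> = distr (\<Pi>\<^sub>M i\<in>{..<n::nat}. \<mu>) borel (\<lambda>x. \<Sum>i<n. x i))"

definition cadlag :: "(real \<Rightarrow> 'a::topological_space) \<Rightarrow> bool" where
  "cadlag y \<longleftrightarrow>
     (\<forall>t\<ge>0. continuous (at_right t) y) \<and> (\<forall>t>0. \<exists>l. (y \<longlongrightarrow> l) (at_left t))"

(* Only the values of Y at times t >= 0 are relevant. *)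
definition levy_process ::
    "'w measure \<Rightarrow> (real \<Rightarrow> 'w \<Rightarrow> 'a::{banach, second_countable_topology}) \<Rightarrow> 'a measure \<Rightarrow> bool"
  where
  "levy_process M Y \<nu> \<longleftrightarrow>
     prob_space M \<and>
     (\<forall>t\<ge>0. Y t \<in> borel_measurable M) \<and>
     (\<forall>\<omega>\<in>space M. Y 0 \<omega> = 0) \<and>
     (\<forall>\<omega>\<in>space M. cadlag (\<lambda>t. Y t \<omega>)) \<and>
     (\<forall>s\<ge>0. \<forall>t\<ge>0. distr M borel (\<lambda>\<omega>. Y (s + t) \<omega> - Y s \<omega>) = distr M borel (Y t)) \<and>
     (\<forall>n (\<tau> :: nat \<Rightarrow> real). 0 \<le> \<tau> 0 \<longrightarrow> mono \<tau> \<longrightarrow>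
        prob_space.indep_vars M (\<lambda>_. borel) (\<lambda>i \<omega>. Y (\<tau> (Suc i)) \<omega> - Y (\<tau> i) \<omega>) {..<n}) \<and>
     distr M borel (Y 1) = \<nu>"

(* Integral of f over (a,b] against dh for h right-continuous of bounded variation on [a,b]: write h
   as a difference of two nondecreasing right-continuous functions. The value does not depend on
   the decomposition. *)
definition has_stieltjes_integral ::
    "(real \<Rightarrow> 'a::{banach, second_countable_topology}) \<Rightarrow> (real \<Rightarrow> real) \<Rightarrow> real \<Rightarrow> real \<Rightarrow> 'a \<Rightarrow> bool"
  where
  "has_stieltjes_integral f h a b I \<longleftrightarrow>
     (\<exists>h1 h2. mono h1 \<and> mono h2 \<and>
        (\<forall>t. continuous (at_right t) h1) \<and> (\<forall>t. continuous (at_right t) h2) \<and>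
        (\<forall>t\<in>{a..b}. h t = h1 t - h2 t) \<and>
        set_integrable (interval_measure h1) {a<..b} f \<and>
        set_integrable (interval_measure h2) {a<..b} f \<and>
        I = set_lebesgue_integral (interval_measure h1) {a<..b} f
          - set_lebesgue_integral (interval_measure h2) {a<..b} f)"

definition stieltjes_integral ::
    "(real \<Rightarrow> 'a::{banach, second_countable_topology}) \<Rightarrow> (real \<Rightarrow> real) \<Rightarrow> real \<Rightarrow> real \<Rightarrow> 'a" where
  "stieltjes_integral f h a b = (THE I. has_stieltjes_integral f h a b I)"

(* y(s-), with the convention y(0-) = y(0). *)
definition left_limit :: "(real \<Rightarrow> 'a::t2_space) \<Rightarrow> real \<Rightarrow> 'a" where
  "left_limit y s = (if s \<le> 0 then y 0 else Lim (at_left s) y)"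

(* Integral over (a,b] of h(t) dy(r(t)) by formal integration by parts, for a monotone clock r;
   the sign is reversed for nonincreasing r. *)
definition path_integral ::
    "(real \<Rightarrow> real) \<Rightarrow> (real \<Rightarrow> real) \<Rightarrow> real \<Rightarrow> real \<Rightarrow>
     (real \<Rightarrow> 'a::{banach, second_countable_topology}) \<Rightarrow> 'a" where
  "path_integral h r a b y =
     (let J = h b *\<^sub>R y (r b) - h a *\<^sub>R y (r a)
              - stieltjes_integral (\<lambda>t. left_limit y (r t)) h a b
      in if antimono_on {a..b} r then - J else J)"

definition tendsto_in_prob ::
    "'w measure \<Rightarrow> ('i \<Rightarrow> 'w \<Rightarrow> 'a::{metric_space, second_countable_topology}) \<Rightarrow>
     ('w \<Rightarrow> 'a) \<Rightarrow> 'i filter \<Rightarrow> bool" where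
  "tendsto_in_prob M X Z F \<longleftrightarrow>
     (\<forall>\<^sub>F i in F. X i \<in> borel_measurable M) \<and> Z \<in> borel_measurable M \<and>
     (\<forall>e>0. ((\<lambda>i. measure M {\<omega> \<in> space M. e < dist (X i \<omega>) (Z \<omega>)}) \<longlongrightarrow> 0) F)"

(* mu is the law of the improper integral over (c,d) of h(t) dY(r(t)), where Y is a Levy process
   with Y(1) distributed as nu. Every Levy process has a version on a space of paths, and the law
   of the integral does not depend on the version. *)
definition has_random_integral_law ::
    "(real \<Rightarrow> real) \<Rightarrow> (real \<Rightarrow> real) \<Rightarrow> real \<Rightarrow> real \<Rightarrow>
     'a::{banach, second_countable_topology} measure \<Rightarrow> 'a measure \<Rightarrow> bool" where
  "has_random_integral_law h r c d \<nu> \<mu> \<longleftrightarrow>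
     (\<exists>(M :: (real \<Rightarrow> 'a) measure) Y Z.
        levy_process M Y \<nu> \<and>
        tendsto_in_prob M (\<lambda>(a, b) \<omega>. path_integral h r a b (\<lambda>t. Y t \<omega>)) Z
          (at_right c \<times>\<^sub>F at_left d) \<and>
        \<mu> = distr M borel Z)"

definition random_integral_defined ::
    "(real \<Rightarrow> real) \<Rightarrow> (real \<Rightarrow> real) \<Rightarrow> real \<Rightarrow> real \<Rightarrow>
     'a::{banach, second_countable_topology} measure \<Rightarrow> bool" where
  "random_integral_defined h r c d \<nu> \<longleftrightarrow> (\<exists>\<mu>. has_random_integral_law h r c d \<nu> \<mu>)"

definition random_integral_map ::
    "(real \<Rightarrow> real) \<Rightarrow> (real \<Rightarrow> real) \<Rightarrow> real \<Rightarrow> real \<Rightarrow>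
     'a::{banach, second_countable_topology} measure \<Rightarrow> 'a measure" where
  "random_integral_map h r c d \<nu> = (THE \<mu>. has_random_integral_law h r c d \<nu> \<mu>)"

definition beta_clock :: "real \<Rightarrow> real \<Rightarrow> real \<Rightarrow> real" where
  "beta_clock \<beta> \<alpha> t =
     1 / Gamma (\<alpha> - \<beta>) *
     (LBINT u:{t<..<1}. (1 - u) powr (\<alpha> - \<beta> - 1) * u powr (- \<alpha> - 1))"

end

theory Submission
  imports Defs
begin

text \<open>
  Fix a continuous linear functional \<open>f\<close> and let \<open>\<psi>\<close> be the continuous logarithm of the characteristic
  function of \<open>f\<close> under \<open>\<nu>\<close>. The exponent of the random integral with clock \<open>r\<^bsub>\<beta>,\<alpha>\<^esub>\<close> is the improper
  integral of \<open>\<psi> (t u)\<close> against \<open>w\<^bsub>\<beta>,\<alpha>\<^esub>(t) dt\<close>, where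
  \<open>w\<^bsub>\<beta>,\<alpha>\<^esub>(t) = (1 - t)\<^sup>\<alpha>\<^sup>-\<^sup>\<beta>\<^sup>-\<^sup>1 t\<^sup>-\<^sup>\<alpha>\<^sup>-\<^sup>1 / \<Gamma>(\<alpha> - \<beta>)\<close>. So the claim is that the multiplicative convolution of
  \<open>w\<^bsub>\<gamma>,\<beta>\<^esub>\<close> and \<open>w\<^bsub>\<beta>,\<alpha>\<^esub>\<close> is \<open>w\<^bsub>\<gamma>,\<alpha>\<^esub>\<close>, in a form that survives conditional convergence at \<open>0\<close> (which does
  occur, for instance for \<open>\<alpha> = 1\<close>), where Fubini's theorem is not available for the full integrals.

  The substitution \<open>s = 1 - x (1 - u)\<close>, \<open>t = u / s\<close> turns the product measure
  \<open>w\<^bsub>\<gamma>,\<beta>\<^esub>(s) w\<^bsub>\<beta>,\<alpha>\<^esub>(t) ds dt\<close> into \<open>w\<^bsub>\<gamma>,\<alpha>\<^esub>(u) du\<close> times a Beta distribution in \<open>x\<close>, and for fixed \<open>x\<close> the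
  truncation \<open>s > e, t > d\<close> becomes a truncation \<open>u > m\<close> with \<open>0 < m \<le> max e d\<close>. Hence the integral of
  \<open>\<psi> (s t)\<close> over the truncated square is a Beta average of truncations of the single improper integral,
  and converges as \<open>(e, d)\<close> tends to \<open>(0, 0)\<close> jointly. Both iterated limits therefore agree with it.
  A law on a separable Banach space is determined by its characteristic functional.
\<close>

section \<open>Characteristic functionals on separable normed spaces\<close>

text \<open>The substitution has a simple origin: for fixed u the variable s runs through (u, 1),
  and x = (1 - s) / (1 - u) rescales this interval to (0, 1). Then 1 - s = x (1 - u) and 1 - t = (1
  - x) (1 - u) / s, so the singular factors at 1 separate into powers of x, 1 - x and 1 - u. The end
  1 of the interval needs no care: \<alpha> - \<beta> - 1 exceeds -1, so the weights are integrable
  there and only 0 has to be truncated. The remaining obstacle is to pass to the limit under the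
  outer integral, where the inner exponent is evaluated at all points of (0, 1) at once. Pointwise
  convergence of exponents would not do. Convergence in probability makes characteristic functions
  converge uniformly on bounded intervals; since all exponents are continuous and vanish at 0, the
  logarithms inherit uniform convergence on \<open>{0..1}\<close>.\<close>

definition sublinear :: "('a::real_vector \<Rightarrow> real) \<Rightarrow> bool" where
  "sublinear q \<longleftrightarrow> (\<forall>x y. q (x + y) \<le> q x + q y) \<and> (\<forall>c\<ge>0. \<forall>x. q (c *\<^sub>R x) = c * q x)"

text \<open>Applied with 1/c to the vector c x, the inequality yields its own converse, so one
  direction is enough for positive homogeneity.\<close>

lemma sublinearI:
  assumes "\<And>x y. q (x + y) \<le> q x + q y" "\<And>c x. c > 0 \<Longrightarrow> q (c *\<^sub>R x) \<le> c * q x" "q 0 = 0"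
  shows "sublinear q"
  unfolding sublinear_def
proof (intro conjI allI impI)
  fix c :: real and x assume c: "0 \<le> c"
  show "q (c *\<^sub>R x) = c * q x"
  proof (cases "c = 0")
    case False
    with c have c: "c > 0" by simp
    have "q x = q ((1/c) *\<^sub>R (c *\<^sub>R x))" using c by simp
    also have "\<dots> \<le> (1/c) * q (c *\<^sub>R x)" using assms(2)[of "1/c" "c *\<^sub>R x"] c by simp
    finally have "c * q x \<le> q (c *\<^sub>R x)" using c by (simp add: field_simps)
    with assms(2)[OF c, of x] show ?thesis by simp
  qed (use assms(3) in simp)
qed (rule assms(1))

lemma sublinear_zero: "sublinear q \<Longrightarrow> q 0 = 0"
  unfolding sublinear_def by (auto dest!: spec[of _ "0::real"])

lemma sublinear_add: "sublinear q \<Longrightarrow> q (x + y) \<le> q x + q y"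
  by (simp add: sublinear_def)

lemma sublinear_scale: "sublinear q \<Longrightarrow> 0 \<le> c \<Longrightarrow> q (c *\<^sub>R x) = c * q x"
  by (simp add: sublinear_def)

lemma sublinear_minus: "sublinear q \<Longrightarrow> - q (- x) \<le> q x"
  using sublinear_add[of q x "- x"] sublinear_zero[of q] by simp

lemma sublinear_norm: "sublinear norm"
  by (simp add: sublinear_def norm_triangle_ineq)

text \<open>The witness is the regularization \<open>q v = inf {m (v + t x) - t m x | t \<ge> 0}\<close>.\<close>

lemma sublinear_directional:
  assumes m: "sublinear m"
  obtains q where "sublinear q" "\<And>v. q v \<le> m v" "\<And>v. q v \<le> m (v + x) - m x"
proof -
  define g where "g = (\<lambda>v t. m (v + t *\<^sub>R x) - t * m x)"
  define q where "q = (\<lambda>v. INF t\<in>{0..}. g v t)"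
  \<comment> \<open>A bound independent of t, from m (v + t x) + m (- v) >= m (t x) = t m x. It
    makes the infimum finite.\<close>
  have lower: "- m (- v) \<le> g v t" if "t \<ge> 0" for v t
    using sublinear_add[OF m, of "v + t *\<^sub>R x" "- v"] sublinear_scale[OF m that, of x]
    by (simp add: g_def)
  have bdd: "bdd_below (g v ` {0..})" for v
    using lower by (intro bdd_belowI2[of _ "- m (- v)"]) auto
  have upper: "q v \<le> g v t" if "t \<ge> 0" for v t
    unfolding q_def using that by (intro cINF_lower[OF bdd]) auto
  have 1: "q v \<le> m v" "q v \<le> m (v + x) - m x" for v
    using upper[of 0 v] upper[of 1 v] by (auto simp: g_def)
  have 2: "sublinear q"
  proof (rule sublinearI)
    fix v w
    have "q (v + w) - g v t \<le> q w" if t: "t \<ge> 0" for t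
      unfolding q_def[THEN fun_cong, of w]
    proof (rule cINF_greatest)
      fix r :: real assume r: "r \<in> {0..}"
      have "q (v + w) \<le> g (v + w) (t + r)" using t r by (intro upper) auto
      also have "\<dots> \<le> g v t + g w r"
        using sublinear_add[OF m, of "v + t *\<^sub>R x" "w + r *\<^sub>R x"] by (simp add: g_def algebra_simps)
      finally show "q (v + w) - g v t \<le> g w r" by simp
    qed auto
    then have "q (v + w) - q w \<le> q v"
      unfolding q_def[THEN fun_cong, of v] by (intro cINF_greatest) (auto simp: algebra_simps)
    then show "q (v + w) \<le> q v + q w" by simp
  next
    fix c :: real and v assume c: "c > 0"
    have "q (c *\<^sub>R v) / c \<le> q v"
      unfolding q_def[THEN fun_cong, of v]
    proof (rule cINF_greatest)
      fix t :: real assume t: "t \<in> {0..}"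
      have "q (c *\<^sub>R v) \<le> g (c *\<^sub>R v) (c * t)" using c t by (intro upper) auto
      also have "\<dots> = c * g v t"
        using sublinear_scale[OF m, of c "v + t *\<^sub>R x"] c
        by (simp add: g_def algebra_simps)
      finally show "q (c *\<^sub>R v) / c \<le> g v t" using c by (simp add: field_simps)
    qed auto
    then show "q (c *\<^sub>R v) \<le> c * q v" using c by (simp add: field_simps)
  next
    have "g 0 t = 0" if "t \<ge> 0" for t using sublinear_scale[OF m that, of x] by (simp add: g_def)
    then have "g 0 ` {0..} = {0}" by (auto simp: image_iff intro: exI[of _ 0])
    then show "q 0 = 0" by (simp add: q_def)
  qed
  show thesis by (rule that[OF 2 1])
qed

text \<open>By Zorn's lemma there is a minimal sublinear functional below \<open>p\<close>; it is linear, because it cannot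
  be decreased by the regularization above.\<close>

theorem sublinear_dominates_linear:
  fixes p :: "'a::real_vector \<Rightarrow> real"
  assumes p: "sublinear p"
  obtains f where "linear f" "\<And>x. f x \<le> p x"
proof -
  define S where "S = {q. sublinear q \<and> q \<le> p}"
  \<comment> \<open>The order is reversed, so that the maximal element of Zorn's lemma is a minimal
    functional.\<close>
  define R where "R = (\<lambda>q q' :: 'a \<Rightarrow> real. q' \<le> q)"
  have "\<exists>m\<in>S. \<forall>q\<in>S. R m q \<longrightarrow> q = m"
  proof (rule predicate_Zorn)
    show "partial_order_on S (relation_of R S)"
      unfolding R_def by (rule partial_order_on_relation_ofI) auto
    fix C assume C: "C \<in> Chains (relation_of R S)"
    have CS: "q \<in> S" if "q \<in> C" for q using C that by (auto simp: Chains_def relation_of_def)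
    have chain: "q \<le> q' \<or> q' \<le> q" if "q \<in> C" "q' \<in> C" for q q'
      using C that by (auto simp: Chains_def relation_of_def R_def)
    show "\<exists>u\<in>S. \<forall>q\<in>C. R q u"
    proof (cases "C = {}")
      case True
      then show ?thesis using p by (auto simp: S_def)
    next
      case ne: False
      define u where "u = (\<lambda>x. INF q\<in>C. q x)"
      have sub: "sublinear q" "q x \<le> p x" if "q \<in> C" for q x
        using CS[OF that] by (auto simp: S_def le_fun_def)
      \<comment> \<open>All members of the chain share a lower bound, since - p (- x) <= - q (- x)
        <= q x; the pointwise infimum is therefore finite.\<close>
      have "- p (- x) \<le> q x" if "q \<in> C" for q x
        using sub(2)[OF that, of "- x"] sublinear_minus[OF sub(1)[OF that], of x] by simp
      then have bdd: "bdd_below ((\<lambda>q. q x) ` C)" for x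
        by (intro bdd_belowI2[of _ "- p (- x)"]) auto
      have upper: "u x \<le> q x" if "q \<in> C" for q x
        unfolding u_def using that by (intro cINF_lower[OF bdd]) auto
      have "sublinear u"
      proof (rule sublinearI)
        fix v w
        have "u (v + w) - q v \<le> u w" if q: "q \<in> C" for q
          unfolding u_def[THEN fun_cong, of w]
        proof (rule cINF_greatest[OF ne])
          fix r assume r: "r \<in> C"
          \<comment> \<open>The infimum of unrelated sublinear functionals need not be subadditive;
            in a chain the smaller of \<open>q\<close> and \<open>r\<close> serves both
            arguments.\<close>
          obtain s where s: "s \<in> C" "s \<le> q" "s \<le> r" using chain[OF q r] q r by auto
          have "u (v + w) \<le> s (v + w)" by (rule upper[OF s(1)])
          also have "\<dots> \<le> s v + s w" by (rule sublinear_add[OF sub(1)[OF s(1)]])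
          also have "\<dots> \<le> q v + r w" using s(2,3) by (intro add_mono) (auto simp: le_fun_def)
          finally show "u (v + w) - q v \<le> r w" by simp
        qed
        then have "u (v + w) - u w \<le> u v"
          unfolding u_def[THEN fun_cong, of v] by (intro cINF_greatest[OF ne]) (auto simp: algebra_simps)
        then show "u (v + w) \<le> u v + u w" by simp
      next
        fix c :: real and v assume c: "c > 0"
        have "u (c *\<^sub>R v) / c \<le> u v"
          unfolding u_def[THEN fun_cong, of v]
        proof (rule cINF_greatest[OF ne])
          fix q assume q: "q \<in> C"
          have "u (c *\<^sub>R v) \<le> c * q v"
            using upper[OF q, of "c *\<^sub>R v"] sublinear_scale[OF sub(1)[OF q], of c v] c by simp
          then show "u (c *\<^sub>R v) / c \<le> q v" using c by (simp add: field_simps)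
        qed
        then show "u (c *\<^sub>R v) \<le> c * u v" using c by (simp add: field_simps)
      next
        have "q 0 = 0" if "q \<in> C" for q by (rule sublinear_zero[OF sub(1)[OF that]])
        then have "(\<lambda>q. q 0) ` C = {0}" using ne by (force simp: image_iff)
        then show "u 0 = 0" by (simp add: u_def)
      qed
      moreover have "u \<le> p"
      proof (rule le_funI)
        fix x
        obtain q where "q \<in> C" using ne by blast
        then show "u x \<le> p x" using upper sub(2) order_trans by blast
      qed
      ultimately show ?thesis using upper by (intro bexI[of _ u]) (auto simp: S_def R_def le_fun_def)
    qed
  qed
  then obtain m where m: "sublinear m" "m \<le> p" and min: "\<And>q. sublinear q \<Longrightarrow> q \<le> m \<Longrightarrow> q = m"
    unfolding S_def R_def by (auto intro: order_trans)
  have add: "m (v + x) = m v + m x" for v x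
  proof -
    obtain q where q: "sublinear q" "\<And>v. q v \<le> m v" "\<And>v. q v \<le> m (v + x) - m x"
      using sublinear_directional[OF m(1)] by blast
    have "q = m" using q by (intro min) (auto simp: le_fun_def)
    with q(3)[of v] sublinear_add[OF m(1), of v x] show ?thesis by simp
  qed
  have neg: "m (- x) = - m x" for x
    using add[of x "- x"] sublinear_zero[OF m(1)] by simp
  have "linear m"
  proof (rule linearI)
    fix c :: real and x
    show "m (c *\<^sub>R x) = c *\<^sub>R m x"
      using sublinear_scale[OF m(1), of c x] sublinear_scale[OF m(1), of "- c" x] neg[of "c *\<^sub>R x"]
      by (cases "c \<ge> 0") auto
  qed (rule add)
  with m(2) that show thesis by (auto simp: le_fun_def)
qed

text \<open>Regularizing the norm in direction x forces f (- x) <= q (- x) <= norm 0 - norm x, so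
  any linear functional below the regularization attains the norm at x.\<close>

lemma norming_functional:
  fixes x :: "'a::real_normed_vector"
  obtains f :: "'a \<Rightarrow> real" where "bounded_linear f" "\<And>v. f v \<le> norm v" "f x = norm x"
proof -
  obtain q where q: "sublinear q" "\<And>v. q v \<le> norm v" "\<And>v. q v \<le> norm (v + x) - norm x"
    using sublinear_directional[OF sublinear_norm] by metis
  obtain f where f: "linear f" "\<And>v. f v \<le> q v"
    using sublinear_dominates_linear[OF q(1)] by blast
  have le: "f v \<le> norm v" for v using f(2) q(2) by (rule order_trans)
  have neg: "f (- v) = - f v" for v using f(1) by (rule linear_neg)
  have "bounded_linear f"
  proof (rule bounded_linear_intro[of _ 1])
    show "norm (f v) \<le> norm v * 1" for v using le[of v] le[of "- v"] neg[of v] by simp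
  qed (use f(1) in \<open>auto simp: linear_add linear_scale\<close>)
  moreover have "f x = norm x"
    using le[of x] f(2)[of "- x"] q(3)[of "- x"] neg[of x] by simp
  ultimately show thesis using le that by blast
qed

text \<open>Norming functionals of a countable dense set suffice, because each of them is
  1-Lipschitz. A closed ball thereby becomes a countable intersection of half-spaces.\<close>

lemma countable_norming_family:
  obtains D :: "'a::{real_normed_vector, second_countable_topology} set" and F :: "'a \<Rightarrow> 'a \<Rightarrow> real"
  where "countable D" "closure D = UNIV" "\<And>d. bounded_linear (F d)"
    "\<And>x r. norm x \<le> r \<longleftrightarrow> (\<forall>d\<in>D. F d x \<le> r)"
proof -
  obtain D :: "'a set" where D: "countable D" "\<And>X. open X \<Longrightarrow> X \<noteq> {} \<Longrightarrow> \<exists>d\<in>D. d \<in> X"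
    by (rule countable_dense_setE) blast
  have "\<forall>d::'a. \<exists>f. bounded_linear f \<and> (\<forall>v. f v \<le> norm v) \<and> f d = norm d"
    using norming_functional by metis
  then obtain F where F: "\<And>d::'a. bounded_linear (F d)" "\<And>d v. F d v \<le> norm v" "\<And>d. F d d = norm d"
    by metis
  have cl: "closure D = UNIV"
  proof (rule ccontr)
    assume "closure D \<noteq> UNIV"
    then have "\<exists>d\<in>D. d \<in> - closure D" by (intro D(2)) auto
    then show False using closure_subset by auto
  qed
  have "norm x \<le> r" if le: "\<forall>d\<in>D. F d x \<le> r" for x r
  proof (rule ccontr)
    assume "\<not> norm x \<le> r"
    \<comment> \<open>Half the gap, because the distance from x to d is lost twice: once in norm x
      against norm d, once in F d d against F d x.\<close>
    then have "\<exists>d\<in>D. d \<in> ball x ((norm x - r) / 2)" by (intro D(2)) auto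
    then obtain d where d: "d \<in> D" "norm (x - d) < (norm x - r) / 2"
      by (auto simp: dist_norm)
    have "norm d \<le> F d x + norm (x - d)"
      using F(2)[of d "d - x"] F(3)[of d] bounded_linear.linear[OF F(1)[of d]]
      by (simp add: linear_diff norm_minus_commute)
    moreover have "norm x \<le> norm d + norm (x - d)" using norm_triangle_sub[of x d] by (simp add: add.commute)
    ultimately show False using d le by (force simp: field_simps)
  qed
  then have "norm x \<le> r \<longleftrightarrow> (\<forall>d\<in>D. F d x \<le> r)" for x r using F(2) order_trans by blast
  with D(1) cl F(1) that show thesis by blast
qed

section \<open>Cylinder sets and the Borel sigma-algebra\<close>

text \<open>The constraints form a list: concatenation is intersection, which gives stability under
  intersections, and list induction adds one functional at a time.\<close>

definition cylinder_set :: "(('a \<Rightarrow> real) \<times> real set) list \<Rightarrow> 'a set" where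
  "cylinder_set L = {x. \<forall>(f, A)\<in>set L. f x \<in> A}"

definition cylinder_data :: "(('a::real_normed_vector \<Rightarrow> real) \<times> real set) list set" where
  "cylinder_data = {L. \<forall>(f, A)\<in>set L. bounded_linear f \<and> A \<in> sets borel}"

lemma bounded_linear_borel_measurable:
  "bounded_linear f \<Longrightarrow> f \<in> borel_measurable borel"
  by (intro borel_measurable_continuous_onI linear_continuous_on)

lemma cylinder_set_borel:
  "L \<in> cylinder_data \<Longrightarrow> cylinder_set L \<in> sets (borel :: 'a::real_normed_vector measure)"
proof (induction L)
  case (Cons p L)
  obtain f A where p: "p = (f, A)" by force
  from Cons.prems have "f -` A \<inter> space borel \<in> sets borel"
    by (intro measurable_sets[OF bounded_linear_borel_measurable]) (auto simp: cylinder_data_def p)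
  moreover have "cylinder_set (p # L) = (f -` A \<inter> space borel) \<inter> cylinder_set L"
    by (auto simp: cylinder_set_def p)
  moreover have "L \<in> cylinder_data" using Cons.prems by (auto simp: cylinder_data_def)
  ultimately show ?case using Cons.IH by auto
qed (simp add: cylinder_set_def)

text \<open>Separability enters twice: closed balls are countable intersections of half-spaces by
  the norming family, and open sets are countable unions of closed balls with dense centres and
  rational radii.\<close>

lemma borel_eq_cylinder:
  "sets (borel :: 'a::{real_normed_vector, second_countable_topology} measure)
     = sigma_sets UNIV (cylinder_set ` cylinder_data)"
proof
  let ?\<Sigma> = "sigma_sets UNIV (cylinder_set ` cylinder_data) :: 'a set set"
  obtain D and F :: "'a \<Rightarrow> 'a \<Rightarrow> real" where D: "countable D" "closure D = UNIV" and F: "\<And>d. bounded_linear (F d)"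
    "\<And>x r. norm x \<le> r \<longleftrightarrow> (\<forall>d\<in>D. F d x \<le> r)"
    using countable_norming_family by metis
  interpret \<Sigma>: sigma_algebra UNIV ?\<Sigma> by (rule sigma_algebra_sigma_sets) auto
  have D0: "D \<noteq> {}" using D(2) by auto
  have cball: "cball c r \<in> ?\<Sigma>" for c :: 'a and r
  proof -
    have "cball c r = {x. norm (x - c) \<le> r}" by (auto simp: dist_norm norm_minus_commute)
    also have "\<dots> = (\<Inter>d\<in>D. {x. F d (x - c) \<le> r})" using F(2) by auto
    also have "\<dots> = (\<Inter>d\<in>D. cylinder_set [(F d, {..r + F d c})])"
      using F(1) by (auto simp: cylinder_set_def bounded_linear.linear linear_diff algebra_simps)
    also have "\<dots> \<in> ?\<Sigma>"
    proof (rule \<Sigma>.countable_INT'[OF D(1) D0], rule image_subsetI)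
      fix d
      have "[(F d, {..r + F d c})] \<in> cylinder_data" using F(1) by (simp add: cylinder_data_def)
      then show "cylinder_set [(F d, {..r + F d c})] \<in> ?\<Sigma>" by (intro sigma_sets.Basic imageI)
    qed
    finally show ?thesis .
  qed
  have "U \<in> ?\<Sigma>" if U: "open U" for U :: "'a set"
  proof -
    have "U = (\<Union>p\<in>{p\<in>D \<times> \<rat>. cball (fst p) (snd p) \<subseteq> U}. cball (fst p) (snd p))"
    proof (intro equalityI subsetI)
      fix x assume x: "x \<in> U"
      obtain e where e: "e > 0" "ball x e \<subseteq> U" using U x by (auto elim: openE)
      obtain q where q: "q \<in> \<rat>" "0 < q" "q < e / 2" using Rats_dense_in_real[of 0 "e/2"] e by auto
      have "x \<in> closure D" using D(2) by simp
      then obtain d where d: "d \<in> D" "dist d x < q" using q(2) by (auto simp: closure_approachable)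
      have "cball d q \<subseteq> U"
      proof
        fix y assume "y \<in> cball d q"
        then have "dist x y < e" using d(2) q(3) dist_triangle[of x y d] by (auto simp: dist_commute)
        then show "y \<in> U" using e(2) by auto
      qed
      then show "x \<in> (\<Union>p\<in>{p\<in>D \<times> \<rat>. cball (fst p) (snd p) \<subseteq> U}. cball (fst p) (snd p))"
        using d q by (intro UN_I[of "(d, q)"]) (auto simp: dist_commute)
    qed auto
    also have "\<dots> \<in> ?\<Sigma>"
      using D(1) cball by (intro \<Sigma>.countable_UN') (auto intro: countable_subset[of _ "D \<times> \<rat>"] simp: countable_rat)
    finally show ?thesis .
  qed
  then show "sets borel \<subseteq> ?\<Sigma>"
    unfolding sets_borel by (intro \<Sigma>.sigma_sets_subset) auto
  show "?\<Sigma> \<subseteq> sets borel"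
    using cylinder_set_borel sets.sigma_sets_subset[of "cylinder_set ` cylinder_data" borel] by auto
qed

section \<open>Uniqueness of laws from characteristic functionals\<close>

text \<open>Dividing the weight by its total mass c gives probability measures whose images under f
  have equal characteristic functions; t = 0 shows that c is common to both. If c = 0, the weight
  vanishes almost everywhere and both sides are 0.\<close>

lemma integral_indicator_eq_if_weighted_char_eq:
  fixes h f :: "'a \<Rightarrow> real"
  assumes M: "prob_space M" "prob_space M'" "sets M' = sets M"
    and h: "h \<in> borel_measurable M" "\<And>x. 0 \<le> h x" "\<And>x. h x \<le> C"
    and f: "f \<in> borel_measurable M"
    and eq: "\<And>t. (CLINT x|M. h x *\<^sub>R iexp (t * f x)) = (CLINT x|M'. h x *\<^sub>R iexp (t * f x))"
    and A: "A \<in> sets borel"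
  shows "(LINT x|M. h x * indicator A (f x)) = (LINT x|M'. h x * indicator A (f x))"
proof -
  define c where "c = (LINT x|M. h x)"
  have c': "c = (LINT x|M'. h x)"
  proof -
    have "complex_of_real (LINT x|M. h x) = complex_of_real (LINT x|M'. h x)"
      using eq[of 0] by (simp add: scaleR_conv_of_real flip: integral_complex_of_real)
    then show ?thesis by (simp only: c_def of_real_eq_iff)
  qed
  have int: "integrable N h" if "prob_space N" "sets N = sets M" for N
  proof -
    interpret prob_space N by fact
    have "h \<in> borel_measurable N" using h(1) measurable_cong_sets[OF that(2) refl] by blast
    then show ?thesis by (intro integrable_const_bound[of _ C]) (use h in auto)
  qed
  have *: "(LINT x|N. h x * indicator A (f x)) = c * measure (distr (density N (\<lambda>x. ennreal (h x / c))) borel f) A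
         \<and> real_distribution (distr (density N (\<lambda>x. ennreal (h x / c))) borel f)
         \<and> char (distr (density N (\<lambda>x. ennreal (h x / c))) borel f) = (\<lambda>t. (CLINT x|N. h x *\<^sub>R iexp (t * f x)) / c)"
    if N: "prob_space N" "sets N = sets M" and cN: "c = (LINT x|N. h x)" and c0: "c > 0" for N
  proof -
    interpret prob_space N by fact
    have [measurable]: "h \<in> borel_measurable N" "f \<in> borel_measurable N" "A \<in> sets borel"
      using h(1) f A measurable_cong_sets[OF N(2) refl] by blast+
    let ?D = "density N (\<lambda>x. ennreal (h x / c))"
    have hc: "0 \<le> h x / c" for x using h(2) c0 by simp
    have "emeasure ?D (space ?D) = (\<integral>\<^sup>+x. ennreal (h x / c) \<partial>N)"
      by (subst emeasure_density) (auto intro!: nn_integral_cong)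
    also have "\<dots> = ennreal (LINT x|N. h x / c)"
      using int[OF N] hc by (intro nn_integral_eq_integral) auto
    also have "\<dots> = 1" using cN c0 by simp
    finally have D: "prob_space ?D" by (rule prob_spaceI)
    have "measure (distr ?D borel f) A = (LINT x|distr ?D borel f. indicator A x)" by simp
    also have "\<dots> = (LINT x|?D. indicator A (f x))" by (subst integral_distr) auto
    also have "\<dots> = (LINT x|N. (h x / c) *\<^sub>R indicator A (f x))"
      using hc by (subst integral_density) auto
    also have "\<dots> = (LINT x|N. h x * indicator A (f x)) / c" by simp
    finally have 1: "measure (distr ?D borel f) A = (LINT x|N. h x * indicator A (f x)) / c" .
    have "char (distr ?D borel f) t = (CLINT x|N. h x *\<^sub>R iexp (t * f x)) / c" for t
    proof -
      have "char (distr ?D borel f) t = (CLINT x|?D. iexp (t * f x))"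
        unfolding char_def by (subst integral_distr) auto
      also have "\<dots> = (CLINT x|N. (h x / c) *\<^sub>R iexp (t * f x))"
        using hc by (subst integral_density) auto
      also have "\<dots> = (CLINT x|N. (h x *\<^sub>R iexp (t * f x)) / c)"
        by (intro Bochner_Integration.integral_cong) (auto simp: scaleR_conv_of_real)
      finally show ?thesis by simp
    qed
    moreover have "real_distribution (distr ?D borel f)"
      by (rule prob_space.real_distribution_distr[OF D]) measurable
    ultimately show ?thesis using 1 c0 by auto
  qed
  show ?thesis
  proof (cases "c > 0")
    case True
    note 1 = *[OF M(1) refl c_def True] and 2 = *[OF M(2) M(3) c' True]
    have "distr (density M (\<lambda>x. ennreal (h x / c))) borel f = distr (density M' (\<lambda>x. ennreal (h x / c))) borel f"
      using 1 2 eq by (intro Levy_uniqueness) auto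
    with 1 2 show ?thesis by simp
  next
    case False
    have zero: "(LINT x|N. h x * indicator A (f x)) = 0"
      if N: "prob_space N" "sets N = sets M" and cN: "c = (LINT x|N. h x)" for N
    proof -
      have "(LINT x|N. h x) = 0"
        using False cN h(2) by (simp add: order_antisym integral_nonneg)
      then have "AE x in N. h x = 0"
        using int[OF N] h(2) by (subst (asm) integral_nonneg_eq_0_iff_AE) auto
      then show ?thesis by (intro integral_eq_zero_AE) auto
    qed
    from zero[OF M(1) refl c_def] zero[OF M(2) M(3) c'] show ?thesis by simp
  qed
qed

text \<open>Reassembles the complex transform once the cosine and sine integrals have been treated
  separately with nonnegative weights.\<close>

lemma integral_iexp_eq_cos_sin:
  assumes M: "prob_space M" and [measurable]: "k \<in> borel_measurable M" "g \<in> borel_measurable M"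
    and k: "\<And>x. 0 \<le> k x" "\<And>x. k x \<le> (1::real)"
  shows "(CLINT x|M. k x *\<^sub>R iexp (g x)) =
    complex_of_real (LINT x|M. k x * cos (g x)) + \<i> * complex_of_real (LINT x|M. k x * sin (g x))"
proof -
  interpret prob_space M by fact
  have "integrable M (\<lambda>x. k x *\<^sub>R iexp (g x))"
    using k by (intro integrable_const_bound[of _ 1]) (auto simp: norm_mult)
  then have "Re (CLINT x|M. k x *\<^sub>R iexp (g x)) = (LINT x|M. Re (k x *\<^sub>R iexp (g x)))"
    "Im (CLINT x|M. k x *\<^sub>R iexp (g x)) = (LINT x|M. Im (k x *\<^sub>R iexp (g x)))"
    by (simp_all only: integral_Re integral_Im)
  then have "(LINT x|M. k x * cos (g x)) = Re (CLINT x|M. k x *\<^sub>R iexp (g x))"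
    "(LINT x|M. k x * sin (g x)) = Im (CLINT x|M. k x *\<^sub>R iexp (g x))"
    by (simp_all add: Re_exp Im_exp)
  then show ?thesis by (simp only: complex_eq[symmetric])
qed

text \<open>
  The exponentials of finitely many functionals are replaced by indicators one at a time. The weights
  \<open>1 + cos g\<close> and \<open>1 + sin g\<close> are nonnegative, so that the one-dimensional uniqueness theorem
  for probability measures applies after normalization.
\<close>

theorem char_functional_unique:
  fixes \<mu> \<mu>' :: "'a::{real_normed_vector, second_countable_topology} measure"
  assumes \<mu>: "prob_space \<mu>" "sets \<mu> = sets borel" and \<mu>': "prob_space \<mu>'" "sets \<mu>' = sets borel"
    and eq: "\<And>f. bounded_linear f \<Longrightarrow> (CLINT x|\<mu>. iexp (f x)) = (CLINT x|\<mu>'. iexp (f x))"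
  shows "\<mu> = \<mu>'"
proof -
  interpret \<mu>: prob_space \<mu> by fact
  interpret \<mu>': prob_space \<mu>' by fact
  have bl [measurable]: "f \<in> borel_measurable \<mu>" "f \<in> borel_measurable \<mu>'" if "bounded_linear f" for f :: "'a \<Rightarrow> real"
    using bounded_linear_borel_measurable[OF that] \<mu>(2) \<mu>'(2) by (auto cong: measurable_cong_sets)
  have cyl: "L \<in> cylinder_data \<Longrightarrow> cylinder_set L \<in> sets \<mu>" "L \<in> cylinder_data \<Longrightarrow> cylinder_set L \<in> sets \<mu>'" for L :: "(('a \<Rightarrow> real) \<times> real set) list"
    using cylinder_set_borel \<mu>(2) \<mu>'(2) by auto
  \<comment> \<open>The free functional g stays in the claim because the induction hypothesis is
    needed for all combinations t f + s g.\<close>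
  have main: "\<forall>g. bounded_linear g \<longrightarrow>
      (CLINT x|\<mu>. indicator (cylinder_set L) x *\<^sub>R iexp (g x)) = (CLINT x|\<mu>'. indicator (cylinder_set L) x *\<^sub>R iexp (g x))"
    if "L \<in> cylinder_data" for L
    using that
  proof (induction L)
    case Nil
    then show ?case using eq by (simp add: cylinder_set_def)
  next
    case (Cons p L)
    obtain f A where p: "p = (f, A)" by force
    have L: "L \<in> cylinder_data" and f: "bounded_linear f" and A: "A \<in> sets borel"
      using Cons.prems by (auto simp: cylinder_data_def p)
    note IH = Cons.IH[OF L, rule_format]
    let ?I = "\<lambda>x. indicator (cylinder_set L) x :: real"
    note [measurable] = cyl[OF L] bl[OF f] A
    have split: "indicator (cylinder_set (p # L)) x = ?I x * indicator A (f x)" for x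
      by (auto simp: cylinder_set_def p indicator_def)
    show ?case
    proof (intro allI impI)
      fix g :: "'a \<Rightarrow> real" assume g: "bounded_linear g"
      note [measurable] = bl[OF g]
      have lin: "bounded_linear (\<lambda>x. t * f x + s * g x)" for t s
        by (intro bounded_linear_add bounded_linear_const_mult f g)
      define F where "F = (\<lambda>t s x. ?I x *\<^sub>R iexp (t * f x + s * g x))"
      have tr: "(CLINT x|\<mu>. F t s x) = (CLINT x|\<mu>'. F t s x)" for t s
        using IH[OF lin] by (simp add: F_def)
      have int: "integrable \<mu> (F t s)" "integrable \<mu>' (F t s)" for t s
        unfolding F_def by (intro \<mu>.integrable_const_bound[of _ 1] \<mu>'.integrable_const_bound[of _ 1]; simp add: norm_mult indicator_def)+
      have sets': "sets \<mu>' = sets \<mu>" using \<mu>(2) \<mu>'(2) by simp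
      have w0: "(LINT x|\<mu>. ?I x * indicator A (f x)) = (LINT x|\<mu>'. ?I x * indicator A (f x))"
        by (rule integral_indicator_eq_if_weighted_char_eq[OF \<mu>(1) \<mu>'(1) sets', where C = 1])
           (use tr[of _ 0] A in \<open>auto simp: indicator_def F_def\<close>)
      \<comment> \<open>By Euler's formula the weight 1 + cos g only involves the exponents s = 0,
        1, -1, whose transforms agree by the induction hypothesis.\<close>
      have ecos: "(?I x * (1 + cos (g x))) *\<^sub>R iexp (t * f x) =
          F t 0 x + F t 1 x / 2 + F t (-1) x / 2" for x t
        by (simp add: F_def exp_add exp_diff cos_of_real[symmetric] cos_exp_eq scaleR_conv_of_real exp_minus field_simps del: cos_of_real)
      have wc: "(LINT x|\<mu>. (?I x * (1 + cos (g x))) * indicator A (f x)) = (LINT x|\<mu>'. (?I x * (1 + cos (g x))) * indicator A (f x))"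
      proof (rule integral_indicator_eq_if_weighted_char_eq[OF \<mu>(1) \<mu>'(1) sets', where C = 2])
        show "(CLINT x|\<mu>. (?I x * (1 + cos (g x))) *\<^sub>R iexp (t * f x)) = (CLINT x|\<mu>'. (?I x * (1 + cos (g x))) *\<^sub>R iexp (t * f x))" for t
          unfolding ecos using int tr by simp
        have "0 \<le> 1 + cos (g x)" for x using cos_ge_minus_one[of "g x"] by linarith
        then show "0 \<le> ?I x * (1 + cos (g x))" for x by (simp add: indicator_def)
      qed (use A in \<open>auto simp: indicator_def\<close>)
      have esin: "(?I x * (1 + sin (g x))) *\<^sub>R iexp (t * f x) =
          F t 0 x + F t 1 x / (2 * \<i>) - F t (-1) x / (2 * \<i>)" for x t
        by (simp add: F_def exp_add exp_diff sin_of_real[symmetric] sin_exp_eq scaleR_conv_of_real exp_minus field_simps del: sin_of_real)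
      have ws: "(LINT x|\<mu>. (?I x * (1 + sin (g x))) * indicator A (f x)) = (LINT x|\<mu>'. (?I x * (1 + sin (g x))) * indicator A (f x))"
      proof (rule integral_indicator_eq_if_weighted_char_eq[OF \<mu>(1) \<mu>'(1) sets', where C = 2])
        show "(CLINT x|\<mu>. (?I x * (1 + sin (g x))) *\<^sub>R iexp (t * f x)) = (CLINT x|\<mu>'. (?I x * (1 + sin (g x))) *\<^sub>R iexp (t * f x))" for t
          unfolding esin using int tr by simp
        have "0 \<le> 1 + sin (g x)" for x using sin_ge_minus_one[of "g x"] by linarith
        then show "0 \<le> ?I x * (1 + sin (g x))" for x by (simp add: indicator_def)
      qed (use A in \<open>auto simp: indicator_def\<close>)
      let ?J = "\<lambda>x. ?I x * indicator A (f x)"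
      \<comment> \<open>Subtracting the identity \<open>w0\<close> removes the constant 1 that had
        been added to make the weights nonnegative.\<close>
      have diff: "(LINT x|N. ?J x * k (g x)) = (LINT x|N. (?I x * (1 + k (g x))) * indicator A (f x)) - (LINT x|N. ?J x)"
        if "N = \<mu> \<or> N = \<mu>'" and [measurable]: "k \<in> borel_measurable borel" and k: "\<And>x. \<bar>k x\<bar> \<le> 1" for N and k :: "real \<Rightarrow> real"
      proof -
        interpret prob_space N using that(1) \<mu>(1) \<mu>'(1) by auto
        have [measurable]: "?I \<in> borel_measurable N" "(\<lambda>x. indicator A (f x) :: real) \<in> borel_measurable N" "g \<in> borel_measurable N"
          using that(1) by auto
        have [measurable]: "(\<lambda>x. k (g x)) \<in> borel_measurable N" by measurable
        have "integrable N ?J"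
          by (rule integrable_const_bound[of _ 1], rule AE_I2, simp add: indicator_def, measurable)
        moreover have "integrable N (\<lambda>x. ?J x * k (g x))"
          by (rule integrable_const_bound[of _ 1], rule AE_I2, use k in \<open>simp add: indicator_def\<close>, measurable)
        ultimately have "(LINT x|N. ?J x + ?J x * k (g x)) = (LINT x|N. ?J x) + (LINT x|N. ?J x * k (g x))"
          by (rule Bochner_Integration.integral_add)
        then show ?thesis by (simp add: algebra_simps)
      qed
      have "(LINT x|\<mu>. ?J x * cos (g x)) = (LINT x|\<mu>'. ?J x * cos (g x))"
        "(LINT x|\<mu>. ?J x * sin (g x)) = (LINT x|\<mu>'. ?J x * sin (g x))"
        using diff[of \<mu> cos] diff[of \<mu>' cos] diff[of \<mu> sin] diff[of \<mu>' sin] w0 wc ws by auto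
      then show "(CLINT x|\<mu>. indicator (cylinder_set (p # L)) x *\<^sub>R iexp (g x))
          = (CLINT x|\<mu>'. indicator (cylinder_set (p # L)) x *\<^sub>R iexp (g x))"
        unfolding split
        by (subst (1 2) integral_iexp_eq_cos_sin) (auto simp: \<mu>(1) \<mu>'(1) indicator_def)
    qed
  qed
  show ?thesis
  proof (rule measure_eqI_generator_eq[where E = "cylinder_set ` cylinder_data" and \<Omega> = UNIV and A = "\<lambda>_. UNIV"])
    show "Int_stable (cylinder_set ` cylinder_data :: 'a set set)"
    proof (rule Int_stableI_image)
      fix L L' :: "(('a \<Rightarrow> real) \<times> real set) list" assume "L \<in> cylinder_data" "L' \<in> cylinder_data"
      then show "\<exists>K\<in>cylinder_data. cylinder_set L \<inter> cylinder_set L' = cylinder_set K"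
        by (intro bexI[of _ "L @ L'"]) (auto simp: cylinder_set_def cylinder_data_def)
    qed
    show "sets \<mu> = sigma_sets UNIV (cylinder_set ` cylinder_data)"
      "sets \<mu>' = sigma_sets UNIV (cylinder_set ` cylinder_data)"
      by (simp_all add: \<mu>(2) \<mu>'(2) borel_eq_cylinder)
    have "UNIV = cylinder_set ([] :: (('a \<Rightarrow> real) \<times> real set) list)" by (simp add: cylinder_set_def)
    then show "range (\<lambda>_. UNIV :: 'a set) \<subseteq> cylinder_set ` cylinder_data"
      by (force simp: cylinder_data_def)
    fix X assume "X \<in> (cylinder_set ` cylinder_data :: 'a set set)"
    then obtain L where L: "L \<in> cylinder_data" "X = cylinder_set L" by auto
    have "complex_of_real (measure \<mu> X) = (CLINT x|\<mu>. indicator X x *\<^sub>R iexp 0)"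
      using cyl[OF L(1)] by (simp add: L(2) scaleR_conv_of_real)
    also have "\<dots> = (CLINT x|\<mu>'. indicator X x *\<^sub>R iexp 0)"
      using main[OF L(1), rule_format, of "\<lambda>_. 0"] L(2) bounded_linear_zero by simp
    also have "\<dots> = complex_of_real (measure \<mu>' X)"
      using cyl[OF L(1)] by (simp add: L(2) scaleR_conv_of_real)
    finally show "emeasure \<mu> X = emeasure \<mu>' X"
      by (simp only: of_real_eq_iff \<mu>.emeasure_eq_measure \<mu>'.emeasure_eq_measure)
  qed auto
qed

section \<open>Beta densities and their multiplicative convolution\<close>

text \<open>The density of the clock measure |dr|, extended by 0 outside (0, 1) so that only the
  truncation at the lower end has to be written.\<close>

definition beta_density :: "real \<Rightarrow> real \<Rightarrow> real \<Rightarrow> real" where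
  "beta_density \<beta> \<alpha> t =
     (if 0 < t \<and> t < 1 then (1 - t) powr (\<alpha> - \<beta> - 1) * t powr (- \<alpha> - 1) / Gamma (\<alpha> - \<beta>) else 0)"

lemma beta_density_measurable [measurable]: "beta_density \<beta> \<alpha> \<in> borel_measurable borel"
  unfolding beta_density_def by measurable

lemma beta_density_nonneg: "\<beta> < \<alpha> \<Longrightarrow> 0 \<le> beta_density \<beta> \<alpha> t"
  using Gamma_real_pos[of "\<alpha> - \<beta>"] by (simp add: beta_density_def)

lemma beta_density_pos: "\<beta> < \<alpha> \<Longrightarrow> 0 < t \<Longrightarrow> t < 1 \<Longrightarrow> 0 < beta_density \<beta> \<alpha> t"
  using Gamma_real_pos[of "\<alpha> - \<beta>"] by (simp add: beta_density_def)

text \<open>Away from 0 the only possible singularity is at 1, where the exponent exceeds -1; the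
  majorant is a multiple of a Beta integrand with first parameter 1.\<close>

lemma set_integrable_beta_density:
  assumes "\<beta> < \<alpha>" "0 < d"
  shows "set_integrable lborel {d<..} (beta_density \<beta> \<alpha>)"
proof -
  have "set_integrable lborel {0..1} (\<lambda>t::real. t powr (1 - 1) * (1 - t) powr (\<alpha> - \<beta> - 1))"
    using assms by (intro integrable_Beta) auto
  then have "integrable lborel (\<lambda>t. ((d powr (- \<alpha> - 1) + 1) / Gamma (\<alpha> - \<beta>)) * (indicator {0..1} t * (t powr (1 - 1) * (1 - t) powr (\<alpha> - \<beta> - 1))))"
    unfolding set_integrable_def by (intro integrable_mult_right) simp
  then show ?thesis
    unfolding set_integrable_def
  proof (rule Bochner_Integration.integrable_bound)
    have "indicator {d<..} t * beta_density \<beta> \<alpha> t \<le>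
       ((d powr (- \<alpha> - 1) + 1) / Gamma (\<alpha> - \<beta>)) * (indicator {0..1} t * (t powr (1 - 1) * (1 - t) powr (\<alpha> - \<beta> - 1)))" for t
    proof (cases "d < t \<and> t < 1")
      case True
      \<comment> \<open>The added 1 makes one bound serve both signs of the exponent: a decreasing
        power is largest at d, an increasing one is at most 1.\<close>
      have "t powr (- \<alpha> - 1) \<le> d powr (- \<alpha> - 1) + 1"
      proof (cases "- \<alpha> - 1 \<le> 0")
        case t: True
        then show ?thesis using powr_mono2'[of "- \<alpha> - 1" d t] assms(2) True by simp
      next
        case False
        then have "t powr (- \<alpha> - 1) \<le> 1 powr (- \<alpha> - 1)" using True assms(2) by (intro powr_mono2) auto
        then show ?thesis by (simp add: add.commute add_increasing2)
      qed
      then have "(1 - t) powr (\<alpha> - \<beta> - 1) * t powr (- \<alpha> - 1) \<le> (1 - t) powr (\<alpha> - \<beta> - 1) * (d powr (- \<alpha> - 1) + 1)"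
        by (rule mult_left_mono) simp
      then show ?thesis
        using True assms Gamma_real_pos[of "\<alpha> - \<beta>"]
        by (simp add: beta_density_def divide_right_mono mult_ac)
    qed (use assms Gamma_real_pos[of "\<alpha> - \<beta>"] in \<open>auto simp: beta_density_def indicator_def\<close>)
    then show "AE t in lborel. norm (indicator {d<..} t *\<^sub>R beta_density \<beta> \<alpha> t) \<le>
       norm (((d powr (- \<alpha> - 1) + 1) / Gamma (\<alpha> - \<beta>)) * (indicator {0..1} t * (t powr (1 - 1) * (1 - t) powr (\<alpha> - \<beta> - 1))))"
      using beta_density_nonneg[OF assms(1)] Gamma_real_pos[of "\<alpha> - \<beta>"] assms by (auto intro!: AE_I2 simp: indicator_def)
  qed measurable
qed

lemma beta_clock_eq_integral:
  "beta_clock \<beta> \<alpha> t = (LINT x:{t<..}|lborel. beta_density \<beta> \<alpha> x)" if "0 < t"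
proof -
  have "beta_clock \<beta> \<alpha> t = (LINT x|lborel. (1 / Gamma (\<alpha> - \<beta>)) * (indicator {t<..<1} x *\<^sub>R ((1 - x) powr (\<alpha> - \<beta> - 1) * x powr (- \<alpha> - 1))))"
    unfolding beta_clock_def set_lebesgue_integral_def by simp
  also have "\<dots> = (LINT x:{t<..}|lborel. beta_density \<beta> \<alpha> x)"
    unfolding set_lebesgue_integral_def using that
    by (intro Bochner_Integration.integral_cong) (auto simp: beta_density_def indicator_def)
  finally show ?thesis .
qed

lemma beta_clock_diff:
  assumes "\<beta> < \<alpha>" "0 < s" "s \<le> t"
  shows "beta_clock \<beta> \<alpha> s - beta_clock \<beta> \<alpha> t = (LINT x:{s<..t}|lborel. beta_density \<beta> \<alpha> x)"
proof -
  have "{s<..} = {s<..t} \<union> {t<..}" using assms by auto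
  moreover have "set_integrable lborel {s<..t} (beta_density \<beta> \<alpha>)" "set_integrable lborel {t<..} (beta_density \<beta> \<alpha>)"
    using assms by (auto intro!: set_integrable_subset[OF set_integrable_beta_density[of \<beta> \<alpha> s]])
  ultimately have "(LINT x:{s<..}|lborel. beta_density \<beta> \<alpha> x) = (LINT x:{s<..t}|lborel. beta_density \<beta> \<alpha> x) + (LINT x:{t<..}|lborel. beta_density \<beta> \<alpha> x)"
    using set_integral_Un[of "{s<..t}" "{t<..}" lborel "beta_density \<beta> \<alpha>"] by force
  then show ?thesis using assms by (simp add: beta_clock_eq_integral)
qed

section \<open>The Beta distribution and the substitution\<close>

definition beta_weight :: "real \<Rightarrow> real \<Rightarrow> real \<Rightarrow> real" where
  "beta_weight a b x = (if 0 < x \<and> x < 1 then x powr (a - 1) * (1 - x) powr (b - 1) / Beta a b else 0)"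

lemma Beta_real_pos: "0 < a \<Longrightarrow> 0 < b \<Longrightarrow> 0 < Beta a (b::real)"
  by (simp add: Beta_def)

lemma beta_weight_measurable [measurable]: "beta_weight a b \<in> borel_measurable borel"
  unfolding beta_weight_def by measurable

lemma beta_weight_nonneg: "0 < a \<Longrightarrow> 0 < b \<Longrightarrow> 0 \<le> beta_weight a b x"
  using Beta_real_pos[of a b] by (simp add: beta_weight_def)

lemma prob_space_beta_weight:
  assumes "0 < a" "0 < b"
  shows "prob_space (density lborel (\<lambda>x. ennreal (beta_weight a b x)))"
proof (rule prob_spaceI)
  have "set_integrable lborel {0..1} (\<lambda>t. t powr (a - 1) * (1 - t) powr (b - 1))"
    using assms by (rule integrable_Beta)
  then have int: "integrable lborel (\<lambda>t. indicator {0..1} t * (t powr (a - 1) * (1 - t) powr (b - 1)))"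
    unfolding set_integrable_def by simp
  have "(LINT t:{0..1}|lborel. t powr (a - 1) * (1 - t) powr (b - 1)) = integral {0..1} (\<lambda>t. t powr (a - 1) * (1 - t) powr (b - 1))"
    using assms by (intro set_borel_integral_eq_integral(2) integrable_Beta)
  also have "\<dots> = Beta a b" using has_integral_Beta_real[OF assms] by (rule integral_unique)
  finally have val: "(LINT t|lborel. indicator {0..1} t * (t powr (a - 1) * (1 - t) powr (b - 1))) = Beta a b"
    by (simp add: set_lebesgue_integral_def)
  have "emeasure (density lborel (\<lambda>x. ennreal (beta_weight a b x))) (space lborel) = (\<integral>\<^sup>+x. ennreal (beta_weight a b x) \<partial>lborel)"
    by (subst emeasure_density) auto
  also have "\<dots> = (\<integral>\<^sup>+x. ennreal (indicator {0..1} x * (x powr (a - 1) * (1 - x) powr (b - 1)) / Beta a b) \<partial>lborel)"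
  proof (rule nn_integral_cong_AE)
    have "AE x in lborel. x \<noteq> 0 \<and> x \<noteq> (1::real)"
      using AE_lborel_singleton[of "0::real"] AE_lborel_singleton[of "1::real"] by eventually_elim auto
    then show "AE x in lborel. ennreal (beta_weight a b x) = ennreal (indicator {0..1} x * (x powr (a - 1) * (1 - x) powr (b - 1)) / Beta a b)"
      by eventually_elim (auto simp: beta_weight_def indicator_def)
  qed
  also have "\<dots> = ennreal (LINT x|lborel. indicator {0..1} x * (x powr (a - 1) * (1 - x) powr (b - 1)) / Beta a b)"
    using int Beta_real_pos[OF assms] by (intro nn_integral_eq_integral) (auto intro!: AE_I2)
  also have "(LINT x|lborel. indicator {0..1} x * (x powr (a - 1) * (1 - x) powr (b - 1)) / Beta a b) = 1"
    using val Beta_real_pos[OF assms] by simp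
  finally show "emeasure (density lborel (\<lambda>x. ennreal (beta_weight a b x))) (space (density lborel (\<lambda>x. ennreal (beta_weight a b x)))) = 1"
    by simp
qed

text \<open>The factor (1 - u) / s is the Jacobian: dt = du / s for fixed s and |ds| = (1 - u) dx
  for fixed u. All powers of s cancel, the powers of 1 - u add up to \<alpha> - \<gamma> - 1, and
  the Gamma factors combine through Gamma(\<alpha> - \<gamma>) Beta(\<beta> - \<gamma>, \<alpha> -
  \<beta>) = Gamma(\<beta> - \<gamma>) Gamma(\<alpha> - \<beta>).\<close>

lemma beta_density_mult:
  assumes "\<gamma> < \<beta>" "\<beta> < \<alpha>" "0 < u" "u < 1" "0 < x" "x < 1"
    and s_def: "s = 1 - x * (1 - u)"
  shows "beta_density \<gamma> \<beta> s * beta_density \<beta> \<alpha> (u / s) * (1 - u) / s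
       = beta_density \<gamma> \<alpha> u * beta_weight (\<beta> - \<gamma>) (\<alpha> - \<beta>) x"
proof -
  have s: "0 < s" "s < 1" "u < s"
  proof -
    have "x * (1 - u) < 1 * (1 - u)" using assms by (intro mult_strict_right_mono) auto
    then show "u < s" by (simp add: s_def)
    then show "0 < s" using assms by simp
    show "s < 1" using assms by (simp add: s_def)
  qed
  have us: "0 < u / s" "u / s < 1" using s assms by auto
  have 1: "1 - s = x * (1 - u)" by (simp add: s_def)
  have 2: "1 - u / s = (1 - x) * (1 - u) / s" using s by (simp add: s_def field_simps)
  have pos: "0 < 1 - u" "0 < 1 - x" using assms by auto
  have G: "Gamma (\<beta> - \<gamma>) \<noteq> 0" "Gamma (\<alpha> - \<beta>) \<noteq> 0" "Gamma (\<alpha> - \<gamma>) \<noteq> 0"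
    by (rule less_imp_neq[OF Gamma_real_pos, symmetric], use assms in simp)+
  have e1: "s powr (- \<beta> - 1) * s powr (1 - (\<alpha> - \<beta>)) * s powr (\<alpha> + 1) = s"
    using s by (simp flip: powr_add)
  have e2: "(1 - u) powr (\<beta> - \<gamma> - 1) * (1 - u) powr (\<alpha> - \<beta> - 1) * (1 - u) = (1 - u) powr (\<alpha> - \<gamma> - 1)"
  proof -
    have "(1 - u) powr (\<beta> - \<gamma> - 1) * (1 - u) powr (\<alpha> - \<beta> - 1) * (1 - u) powr 1 = (1 - u) powr (\<alpha> - \<gamma> - 1)"
      by (simp only: powr_add[symmetric]) simp
    then show ?thesis using pos by simp
  qed
  have "beta_density \<gamma> \<beta> s * beta_density \<beta> \<alpha> (u / s) * (1 - u) / s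
     = ((x * (1 - u)) powr (\<beta> - \<gamma> - 1) * s powr (- \<beta> - 1) / Gamma (\<beta> - \<gamma>))
       * (((1 - x) * (1 - u) / s) powr (\<alpha> - \<beta> - 1) * (u / s) powr (- \<alpha> - 1) / Gamma (\<alpha> - \<beta>)) * (1 - u) / s"
    using s us unfolding beta_density_def 1 2 by simp
  also have "\<dots> = x powr (\<beta> - \<gamma> - 1) * (1 - x) powr (\<alpha> - \<beta> - 1) * u powr (- \<alpha> - 1)
      * ((1 - u) powr (\<beta> - \<gamma> - 1) * (1 - u) powr (\<alpha> - \<beta> - 1) * (1 - u))
      * (s powr (- \<beta> - 1) * s powr (1 - (\<alpha> - \<beta>)) * s powr (\<alpha> + 1)) / s / (Gamma (\<beta> - \<gamma>) * Gamma (\<alpha> - \<beta>))"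
    using s pos assms G by (simp add: powr_mult powr_divide powr_minus_divide[symmetric] divide_powr_uminus mult_ac add.commute)
  also have "\<dots> = x powr (\<beta> - \<gamma> - 1) * (1 - x) powr (\<alpha> - \<beta> - 1) * u powr (- \<alpha> - 1) * (1 - u) powr (\<alpha> - \<gamma> - 1) / (Gamma (\<beta> - \<gamma>) * Gamma (\<alpha> - \<beta>))"
    unfolding e1 e2 using s by simp
  also have "\<dots> = beta_density \<gamma> \<alpha> u * beta_weight (\<beta> - \<gamma>) (\<alpha> - \<beta>) x"
    using assms G by (simp add: beta_density_def beta_weight_def Beta_def)
  finally show ?thesis .
qed

definition beta_measure :: "real \<Rightarrow> real \<Rightarrow> real measure" where
  "beta_measure \<beta> \<alpha> = density lborel (\<lambda>t. ennreal (beta_density \<beta> \<alpha> t))"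

lemma sets_beta_measure [simp, measurable_cong]: "sets (beta_measure \<beta> \<alpha>) = sets borel"
  by (simp add: beta_measure_def)

lemma space_beta_measure [simp]: "space (beta_measure \<beta> \<alpha>) = UNIV"
  by (simp add: beta_measure_def)

lemma sigma_finite_beta_measure: "sigma_finite_measure (beta_measure \<beta> \<alpha>)"
  unfolding beta_measure_def by (subst sigma_finite_measure.sigma_finite_iff_density_finite[OF sigma_finite_lborel]) auto

text \<open>The inverse substitution (u, x) -> (s, t); it satisfies s t = u wherever s is
  nonzero.\<close>

definition beta_split :: "real \<times> real \<Rightarrow> real \<times> real" where
  "beta_split p = (1 - snd p * (1 - fst p), fst p / (1 - snd p * (1 - fst p)))"

lemma beta_split_measurable [measurable]: "beta_split \<in> borel \<Otimes>\<^sub>M borel \<rightarrow>\<^sub>M borel \<Otimes>\<^sub>M borel"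
  unfolding beta_split_def by measurable

text \<open>A planar change of variables is avoided: t = u / s for fixed s and s = 1 - (1 - u) x for
  fixed u are affine substitutions on the line, with Tonelli's theorem exchanging the integrals in
  between.\<close>

lemma nn_integral_beta_pair:
  assumes ab: "\<gamma> < \<beta>" "\<beta> < \<alpha>" and H [measurable]: "H \<in> borel_measurable (borel \<Otimes>\<^sub>M borel)"
  shows "(\<integral>\<^sup>+p. H p \<partial>(beta_measure \<gamma> \<beta> \<Otimes>\<^sub>M beta_measure \<beta> \<alpha>))
       = (\<integral>\<^sup>+p. H (beta_split p) \<partial>(beta_measure \<gamma> \<alpha> \<Otimes>\<^sub>M density lborel (\<lambda>x. ennreal (beta_weight (\<beta> - \<gamma>) (\<alpha> - \<beta>) x))))"
proof -
  let ?w1 = "beta_density \<gamma> \<beta>" and ?w2 = "beta_density \<beta> \<alpha>" and ?w3 = "beta_density \<gamma> \<alpha>"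
  let ?k = "beta_weight (\<beta> - \<gamma>) (\<alpha> - \<beta>)"
  let ?K = "density lborel (\<lambda>x. ennreal (?k x))"
  interpret N2: sigma_finite_measure "beta_measure \<beta> \<alpha>" by (rule sigma_finite_beta_measure)
  have "prob_space ?K" using ab by (intro prob_space_beta_weight) auto
  then interpret K: prob_space ?K .
  have nn: "0 \<le> ?w1 s" "0 \<le> ?w2 s" "0 \<le> ?w3 s" "0 \<le> ?k s" for s
    using ab by (auto intro!: beta_density_nonneg beta_weight_nonneg)
  have zero: "?w1 s = 0" "?w2 s = 0" "?w3 s = 0" "?k s = 0" if "s \<le> 0 \<or> 1 \<le> s" for s
    using that by (auto simp: beta_density_def beta_weight_def)
  have "(\<integral>\<^sup>+p. H p \<partial>(beta_measure \<gamma> \<beta> \<Otimes>\<^sub>M beta_measure \<beta> \<alpha>))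
      = (\<integral>\<^sup>+s. (\<integral>\<^sup>+t. H (s, t) \<partial>beta_measure \<beta> \<alpha>) \<partial>beta_measure \<gamma> \<beta>)"
    by (rule N2.nn_integral_fst[symmetric]) measurable
  also have "\<dots> = (\<integral>\<^sup>+s. ennreal (?w1 s) * (\<integral>\<^sup>+t. ennreal (?w2 t) * H (s, t) \<partial>lborel) \<partial>lborel)"
    unfolding beta_measure_def by (simp add: nn_integral_density)
  also have "\<dots> = (\<integral>\<^sup>+s. (\<integral>\<^sup>+u. ennreal (?w1 s * ?w2 (u / s) * \<bar>1 / s\<bar>) * H (s, u / s) \<partial>lborel) \<partial>lborel)"
  proof (rule nn_integral_cong)
    fix s :: real
    show "ennreal (?w1 s) * (\<integral>\<^sup>+t. ennreal (?w2 t) * H (s, t) \<partial>lborel)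
        = (\<integral>\<^sup>+u. ennreal (?w1 s * ?w2 (u / s) * \<bar>1 / s\<bar>) * H (s, u / s) \<partial>lborel)"
    proof (cases "s \<le> 0 \<or> 1 \<le> s")
      case True
      then show ?thesis using zero by simp
    next
      case False
      then have s: "s \<noteq> 0" by auto
      have "(\<integral>\<^sup>+t. ennreal (?w2 t) * H (s, t) \<partial>lborel) = \<bar>1 / s\<bar> * (\<integral>\<^sup>+u. ennreal (?w2 (0 + (1 / s) * u)) * H (s, 0 + (1 / s) * u) \<partial>lborel)"
        using s by (intro nn_integral_real_affine) auto
      then have e: "ennreal (?w1 s) * (\<integral>\<^sup>+t. ennreal (?w2 t) * H (s, t) \<partial>lborel)
          = (\<integral>\<^sup>+u. ennreal (?w1 s) * (ennreal \<bar>1 / s\<bar> * (ennreal (?w2 (u / s)) * H (s, u / s))) \<partial>lborel)"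
        by (simp add: nn_integral_cmult)
      have "ennreal (?w1 s) * (ennreal c * (ennreal (?w2 v) * h)) = ennreal (?w1 s * ?w2 v * c) * h"
        if "0 \<le> c" for c v h
        using nn that by (simp add: ennreal_mult mult_ac)
      from this[OF abs_ge_zero] show ?thesis unfolding e by (simp only:)
    qed
  qed
  also have "\<dots> = (\<integral>\<^sup>+u. (\<integral>\<^sup>+s. ennreal (?w1 s * ?w2 (u / s) * \<bar>1 / s\<bar>) * H (s, u / s) \<partial>lborel) \<partial>lborel)"
    by (rule lborel_pair.Fubini'[symmetric]) measurable
  also have "\<dots> = (\<integral>\<^sup>+u. ennreal (?w3 u) * (\<integral>\<^sup>+x. ennreal (?k x) * H (beta_split (u, x)) \<partial>lborel) \<partial>lborel)"
  proof (rule nn_integral_cong)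
    fix u :: real
    show "(\<integral>\<^sup>+s. ennreal (?w1 s * ?w2 (u / s) * \<bar>1 / s\<bar>) * H (s, u / s) \<partial>lborel)
        = ennreal (?w3 u) * (\<integral>\<^sup>+x. ennreal (?k x) * H (beta_split (u, x)) \<partial>lborel)"
    proof (cases "u \<le> 0 \<or> 1 \<le> u")
      case True
      have "?w1 s * ?w2 (u / s) = 0" for s
      proof (cases "s \<le> 0 \<or> 1 \<le> s")
        case False
        then have "u / s \<le> 0 \<or> 1 \<le> u / s" using True by (auto simp: divide_nonpos_pos)
        then show ?thesis using zero by simp
      qed (use zero in simp)
      then show ?thesis using zero(3)[OF True] by (simp only:) simp
    next
      case False
      then have u: "0 < u" "u < 1" by auto
      let ?s = "\<lambda>x. 1 + - (1 - u) * x"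
      have "(\<integral>\<^sup>+s. ennreal (?w1 s * ?w2 (u / s) * \<bar>1 / s\<bar>) * H (s, u / s) \<partial>lborel)
         = \<bar>- (1 - u)\<bar> * (\<integral>\<^sup>+x. ennreal (?w1 (?s x) * ?w2 (u / ?s x) * \<bar>1 / ?s x\<bar>) * H (?s x, u / ?s x) \<partial>lborel)"
        using u by (intro nn_integral_real_affine) auto
      also have "\<dots> = (\<integral>\<^sup>+x. ennreal (1 - u) * (ennreal (?w1 (?s x) * ?w2 (u / ?s x) * \<bar>1 / ?s x\<bar>) * H (?s x, u / ?s x)) \<partial>lborel)"
        using u by (subst nn_integral_cmult) auto
      also have "\<dots> = (\<integral>\<^sup>+x. ennreal (?w3 u) * (ennreal (?k x) * H (beta_split (u, x))) \<partial>lborel)"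
      proof (rule nn_integral_cong)
        fix x :: real
        have sx: "?s x = 1 - x * (1 - u)" by (simp add: algebra_simps)
        have "(1 - u) * (?w1 (?s x) * ?w2 (u / ?s x) * \<bar>1 / ?s x\<bar>) = ?w3 u * ?k x"
        proof (cases "x \<le> 0 \<or> 1 \<le> x")
          \<comment> \<open>Outside 0 < x < 1 both sides vanish: x <= 0 gives s >= 1, while x >= 1
            gives s <= u, hence s <= 0 or u / s >= 1.\<close>
          case True
          have "?w1 (?s x) * ?w2 (u / ?s x) = 0"
          proof (cases "x \<le> 0")
            case True
            then have "1 \<le> ?s x" using u mult_nonpos_nonneg[of x "1 - u"] unfolding sx by linarith
            then show ?thesis using zero by simp
          next
            case False
            then have "1 \<le> x" using True by simp
            then have "?s x \<le> u" using u mult_right_mono[of 1 x "1 - u"] unfolding sx mult_1 by linarith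
            then have "?s x \<le> 0 \<or> 1 \<le> u / ?s x" by (cases "?s x \<le> 0") auto
            then show ?thesis using zero by auto
          qed
          then show ?thesis using zero(4)[OF True] by (simp only:)
        next
          case False
          then have x: "0 < x" "x < 1" by auto
          have "x * (1 - u) < 1 * (1 - u)" using u x by (intro mult_strict_right_mono) auto
          then have s0: "0 < 1 - x * (1 - u)" using u unfolding mult_1 by linarith
          show ?thesis
            using beta_density_mult[OF ab u x refl] s0 unfolding sx by (simp add: mult_ac)
        qed
        then have "ennreal (1 - u) * ennreal (?w1 (?s x) * ?w2 (u / ?s x) * \<bar>1 / ?s x\<bar>) = ennreal (?w3 u) * ennreal (?k x)"
          using u nn by (simp add: ennreal_mult[symmetric] del: mult_minus_left)
        moreover have "(?s x, u / ?s x) = beta_split (u, x)" unfolding sx beta_split_def by simp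
        ultimately show "ennreal (1 - u) * (ennreal (?w1 (?s x) * ?w2 (u / ?s x) * \<bar>1 / ?s x\<bar>) * H (?s x, u / ?s x))
            = ennreal (?w3 u) * (ennreal (?k x) * H (beta_split (u, x)))"
          by (simp only: mult.assoc[symmetric])
      qed
      also have "\<dots> = ennreal (?w3 u) * (\<integral>\<^sup>+x. ennreal (?k x) * H (beta_split (u, x)) \<partial>lborel)"
        by (rule nn_integral_cmult) measurable
      finally show ?thesis .
    qed
  qed
  also have "\<dots> = (\<integral>\<^sup>+u. (\<integral>\<^sup>+x. H (beta_split (u, x)) \<partial>?K) \<partial>beta_measure \<gamma> \<alpha>)"
    unfolding beta_measure_def by (simp add: nn_integral_density)
  also have "\<dots> = (\<integral>\<^sup>+p. H (beta_split p) \<partial>(beta_measure \<gamma> \<alpha> \<Otimes>\<^sub>M ?K))"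
    by (rule K.nn_integral_fst) measurable
  finally show ?thesis .
qed

text \<open>Stated for measures, the substitution also transports integrability and the integrals of
  complex functions.\<close>

lemma beta_measure_pair_eq_distr:
  assumes "\<gamma> < \<beta>" "\<beta> < \<alpha>"
  shows "beta_measure \<gamma> \<beta> \<Otimes>\<^sub>M beta_measure \<beta> \<alpha>
    = distr (beta_measure \<gamma> \<alpha> \<Otimes>\<^sub>M density lborel (\<lambda>x. ennreal (beta_weight (\<beta> - \<gamma>) (\<alpha> - \<beta>) x)))
        (borel \<Otimes>\<^sub>M borel) beta_split" (is "?L = distr ?R _ _")
proof (rule measure_eqI)
  have sL: "sets ?L = sets (borel \<Otimes>\<^sub>M borel)" by (intro sets_pair_measure_cong) auto
  then show "sets ?L = sets (distr ?R (borel \<Otimes>\<^sub>M borel) beta_split)" by simp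
  fix A assume "A \<in> sets ?L"
  then have A [measurable]: "A \<in> sets (borel \<Otimes>\<^sub>M borel)" using sL by simp
  have "emeasure ?L A = (\<integral>\<^sup>+p. indicator A p \<partial>?L)" using A sL by simp
  also have "\<dots> = (\<integral>\<^sup>+p. indicator A (beta_split p) \<partial>?R)"
    by (rule nn_integral_beta_pair[OF assms]) measurable
  also have "\<dots> = (\<integral>\<^sup>+p. indicator A p \<partial>distr ?R (borel \<Otimes>\<^sub>M borel) beta_split)"
    by (rule nn_integral_distr[symmetric]) measurable
  also have "\<dots> = emeasure (distr ?R (borel \<Otimes>\<^sub>M borel) beta_split) A" by simp
  finally show "emeasure ?L A = emeasure (distr ?R (borel \<Otimes>\<^sub>M borel) beta_split) A" .
qed

section \<open>Truncated exponents and their double limit\<close>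

text \<open>For a beta density w this is the exponent at u of the random integral over (a, 1), with
  the upper limit already taken.\<close>

definition cut_integral :: "(real \<Rightarrow> real) \<Rightarrow> (real \<Rightarrow> complex) \<Rightarrow> real \<Rightarrow> real \<Rightarrow> complex" where
  "cut_integral w \<psi> a u = (CLINT t:{a<..}|lborel. w t *\<^sub>R \<psi> (t * u))"

lemma integral_beta_measure:
  fixes f :: "real \<Rightarrow> 'a::{banach, second_countable_topology}"
  assumes "\<beta> < \<alpha>" "f \<in> borel_measurable borel"
  shows "(LINT t|beta_measure \<beta> \<alpha>. f t) = (LINT t|lborel. beta_density \<beta> \<alpha> t *\<^sub>R f t)"
    "integrable (beta_measure \<beta> \<alpha>) f \<longleftrightarrow> integrable lborel (\<lambda>t. beta_density \<beta> \<alpha> t *\<^sub>R f t)"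
  unfolding beta_measure_def using assms beta_density_nonneg[OF assms(1)]
  by (simp_all add: integral_density integrable_density)

lemma emeasure_beta_measure_finite:
  assumes "\<beta> < \<alpha>" "0 < a"
  shows "emeasure (beta_measure \<beta> \<alpha>) {a<..} < \<infinity>"
proof -
  have "integrable lborel (\<lambda>t. beta_density \<beta> \<alpha> t *\<^sub>R (indicator {a<..} t :: real))"
    using set_integrable_beta_density[OF assms] unfolding set_integrable_def by (simp add: mult.commute)
  then have "integrable (beta_measure \<beta> \<alpha>) (indicator {a<..} :: real \<Rightarrow> real)"
    using assms(1) by (subst integral_beta_measure) auto
  then show ?thesis by (subst (asm) integrable_indicator_iff) auto
qed

lemma cut_integral_beta_measure:
  assumes "\<beta> < \<alpha>" "\<psi> \<in> borel_measurable borel"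
  shows "cut_integral (beta_density \<beta> \<alpha>) \<psi> a u = (LINT t|beta_measure \<beta> \<alpha>. indicator {a<..} t *\<^sub>R \<psi> (t * u))"
proof -
  have "(\<lambda>t. indicator {a<..} t *\<^sub>R \<psi> (t * u)) \<in> borel_measurable borel" using assms(2) by measurable
  then show ?thesis
    unfolding cut_integral_def set_lebesgue_integral_def
    by (subst integral_beta_measure[OF assms(1)]) (simp_all add: mult.commute)
qed


text \<open>For fixed x each of the two conditions is a lower bound on u, so together they say that
  u exceeds the larger threshold. The first threshold may be negative, but the second is positive;
  since x < 1, the first is at most e and the second at most d, uniformly in x.\<close>

lemma beta_split_cut_iff:
  assumes u: "0 < u" "u < 1" and x: "0 < x" "x < 1" and e: "0 < e" "e < 1" and d: "0 < d" "d < 1"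
  defines "m \<equiv> max (1 - (1 - e) / x) (d * (1 - x) / (1 - d * x))"
  shows "e < fst (beta_split (u, x)) \<and> d < snd (beta_split (u, x)) \<longleftrightarrow> m < u"
    "0 < m" "m \<le> max e d"
proof -
  have dx: "0 < 1 - d * x"
  proof -
    have "d * x < 1 * 1" using d x by (intro mult_strict_mono) auto
    then show ?thesis by linarith
  qed
  have "x * (1 - u) < 1 * (1 - u)" using u x by (intro mult_strict_right_mono) auto
  then have s: "0 < 1 - x * (1 - u)" using u unfolding mult_1 by linarith
  have "e < 1 - x * (1 - u) \<longleftrightarrow> 1 - (1 - e) / x < u"
    using x by (simp add: field_simps)
  moreover have "d < u / (1 - x * (1 - u)) \<longleftrightarrow> d * (1 - x) < u * (1 - d * x)"
    using s by (simp add: pos_less_divide_eq algebra_simps)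
  moreover have "d * (1 - x) < u * (1 - d * x) \<longleftrightarrow> d * (1 - x) / (1 - d * x) < u"
    using dx by (simp add: pos_divide_less_eq)
  ultimately show "e < fst (beta_split (u, x)) \<and> d < snd (beta_split (u, x)) \<longleftrightarrow> m < u"
    by (simp add: beta_split_def m_def)
  have "0 < d * (1 - x) / (1 - d * x)" using d x dx by simp
  then show "0 < m" by (simp add: m_def)
  have "1 - (1 - e) / x \<le> e"
  proof -
    have "(1 - e) * x \<le> (1 - e) * 1" using e x by (intro mult_left_mono) auto
    then have "1 - e \<le> (1 - e) / x" using x by (simp add: pos_le_divide_eq)
    then show ?thesis by linarith
  qed
  moreover have "d * (1 - x) / (1 - d * x) \<le> d"
  proof -
    have "d * x \<le> 1 * x" using d x by (intro mult_right_mono) auto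
    then have "d * (1 - x) \<le> d * (1 - d * x)" using d by (intro mult_left_mono) auto
    then show ?thesis using dx by (simp add: pos_divide_le_eq)
  qed
  ultimately show "m \<le> max e d" by (auto simp: m_def)
qed

text \<open>On the rectangle s > e, t > d both measures are finite and \<psi> is bounded at s t,
  which lies in (0, 1) almost everywhere. Fubini's theorem therefore applies: the two orders of
  integration give the left-hand sides, and integrating over u first after the substitution gives
  the Beta average.\<close>

lemma beta_rectangle_integral:
  fixes \<psi> :: "real \<Rightarrow> complex"
  assumes ab: "\<gamma> < \<beta>" "\<beta> < \<alpha>" and cont: "continuous_on UNIV \<psi>"
    and e: "0 < e" "e < 1" and d: "0 < d" "d < 1"
  shows "(CLINT s:{e<..}|lborel. beta_density \<gamma> \<beta> s *\<^sub>R cut_integral (beta_density \<beta> \<alpha>) \<psi> d s)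
       = (CLINT x|density lborel (\<lambda>x. ennreal (beta_weight (\<beta> - \<gamma>) (\<alpha> - \<beta>) x)).
            cut_integral (beta_density \<gamma> \<alpha>) \<psi> (max (1 - (1 - e) / x) (d * (1 - x) / (1 - d * x))) 1)" (is "?A = ?C")
    and "(CLINT t:{d<..}|lborel. beta_density \<beta> \<alpha> t *\<^sub>R cut_integral (beta_density \<gamma> \<beta>) \<psi> e t)
       = (CLINT x|density lborel (\<lambda>x. ennreal (beta_weight (\<beta> - \<gamma>) (\<alpha> - \<beta>) x)).
            cut_integral (beta_density \<gamma> \<alpha>) \<psi> (max (1 - (1 - e) / x) (d * (1 - x) / (1 - d * x))) 1)" (is "?B = _")
    and "set_integrable lborel {e<..} (\<lambda>s. beta_density \<gamma> \<beta> s *\<^sub>R cut_integral (beta_density \<beta> \<alpha>) \<psi> d s)"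
    and "set_integrable lborel {d<..} (\<lambda>t. beta_density \<beta> \<alpha> t *\<^sub>R cut_integral (beta_density \<gamma> \<beta>) \<psi> e t)"
    and "integrable (density lborel (\<lambda>x. ennreal (beta_weight (\<beta> - \<gamma>) (\<alpha> - \<beta>) x)))
          (\<lambda>x. cut_integral (beta_density \<gamma> \<alpha>) \<psi> (max (1 - (1 - e) / x) (d * (1 - x) / (1 - d * x))) 1)"
proof -
  let ?N1 = "beta_measure \<gamma> \<beta>" and ?N2 = "beta_measure \<beta> \<alpha>" and ?N3 = "beta_measure \<gamma> \<alpha>"
  let ?K = "density lborel (\<lambda>x. ennreal (beta_weight (\<beta> - \<gamma>) (\<alpha> - \<beta>) x))"
  let ?m = "\<lambda>x. max (1 - (1 - e) / x) (d * (1 - x) / (1 - d * x))"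
  have ac: "\<gamma> < \<alpha>" using ab by simp
  have "prob_space ?K" using ab by (intro prob_space_beta_weight) auto
  then interpret K: prob_space ?K .
  interpret P: pair_sigma_finite ?N1 ?N2 by (simp add: pair_sigma_finite_def sigma_finite_beta_measure)
  interpret Q: pair_sigma_finite ?N3 ?K
    by (simp add: pair_sigma_finite_def sigma_finite_beta_measure K.sigma_finite_measure_axioms)
  have psi_meas [measurable]: "\<psi> \<in> borel_measurable borel" using cont by (rule borel_measurable_continuous_onI)
  define G where "G = (\<lambda>p. indicator {e<..} (fst p) *\<^sub>R indicator {d<..} (snd p) *\<^sub>R \<psi> (fst p * snd p))"
  have G [measurable]: "G \<in> borel_measurable (borel \<Otimes>\<^sub>M borel)" unfolding G_def by measurable
  have [measurable]: "G \<in> borel_measurable (?N1 \<Otimes>\<^sub>M ?N2)" by measurable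
  have "compact (\<psi> ` {0..1})"
    by (intro compact_continuous_image continuous_on_subset[OF cont]) auto
  then have "bounded (\<psi> ` {0..1})" by (rule compact_imp_bounded)
  then obtain C where C': "\<forall>y\<in>\<psi> ` {0..1}. norm y \<le> C"
    unfolding bounded_iff by (rule exE)
  have C: "norm (\<psi> u) \<le> C" if "u \<in> {0..1}" for u
    using C' that by (rule bspec[OF _ imageI])
  have AE01: "AE s in beta_measure b c. 0 < s \<and> s < 1" for b c
    unfolding beta_measure_def by (subst AE_density) (auto simp: beta_density_def)
  have AE_pair: "AE p in ?N1 \<Otimes>\<^sub>M ?N2. (0 < fst p \<and> fst p < 1) \<and> 0 < snd p \<and> snd p < 1"
  proof (rule P.AE_pair_measure)
    show "AE s in ?N1. AE t in ?N2. (0 < fst (s, t) \<and> fst (s, t) < 1) \<and> 0 < snd (s, t) \<and> snd (s, t) < 1"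
      using AE01[of \<gamma> \<beta>]
    proof eventually_elim
      case (elim s)
      show ?case using AE01[of \<beta> \<alpha>] by eventually_elim (use elim in simp)
    qed
  qed measurable
  have ind: "integrable (?N1 \<Otimes>\<^sub>M ?N2) (\<lambda>p. C * indicator ({e<..} \<times> {d<..}) p)"
    using emeasure_beta_measure_finite[OF ab(1) e(1)] emeasure_beta_measure_finite[OF ab(2) d(1)]
    by (intro integrable_mult_right) (auto simp: P.M2.emeasure_pair_measure_Times ennreal_mult_less_top)
  have intG: "integrable (?N1 \<Otimes>\<^sub>M ?N2) G"
  proof (rule Bochner_Integration.integrable_bound[OF ind])
    show "AE p in ?N1 \<Otimes>\<^sub>M ?N2. norm (G p) \<le> norm (C * indicator ({e<..} \<times> {d<..}) p)"
      using AE_pair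
    proof eventually_elim
      case (elim p)
      then have "fst p * snd p \<in> {0..1}" by (auto intro: mult_le_one less_imp_le)
      then have "norm (\<psi> (fst p * snd p)) \<le> \<bar>C\<bar>" using C by fastforce
      then show ?case by (cases p) (auto simp: G_def indicator_def)
    qed
  qed measurable
  have inner2: "(CLINT t|?N2. G (s, t)) = indicator {e<..} s *\<^sub>R cut_integral (beta_density \<beta> \<alpha>) \<psi> d s" for s
  proof -
    have "(CLINT t|?N2. G (s, t)) = (CLINT t|?N2. indicator {e<..} s *\<^sub>R (indicator {d<..} t *\<^sub>R \<psi> (t * s)))"
      by (rule Bochner_Integration.integral_cong) (auto simp: G_def mult.commute)
    then show ?thesis
      unfolding cut_integral_beta_measure[OF ab(2) psi_meas] by (simp only: integral_scaleR_right)
  qed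
  have inner1: "(CLINT s|?N1. G (s, t)) = indicator {d<..} t *\<^sub>R cut_integral (beta_density \<gamma> \<beta>) \<psi> e t" for t
  proof -
    have "(CLINT s|?N1. G (s, t)) = (CLINT s|?N1. indicator {d<..} t *\<^sub>R (indicator {e<..} s *\<^sub>R \<psi> (s * t)))"
      by (rule Bochner_Integration.integral_cong) (auto simp: G_def mult.commute)
    then show ?thesis
      unfolding cut_integral_beta_measure[OF ab(1) psi_meas] by (simp only: integral_scaleR_right)
  qed
  have meas1: "(\<lambda>s. CLINT t|?N2. G (s, t)) \<in> borel_measurable borel"
    by (rule P.M2.borel_measurable_lebesgue_integral[of "\<lambda>s t. G (s, t)" borel]) measurable
  have meas2: "(\<lambda>t. CLINT s|?N1. G (s, t)) \<in> borel_measurable borel"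
    by (rule P.M1.borel_measurable_lebesgue_integral[of "\<lambda>t s. G (s, t)" borel]) measurable
  show "set_integrable lborel {e<..} (\<lambda>s. beta_density \<gamma> \<beta> s *\<^sub>R cut_integral (beta_density \<beta> \<alpha>) \<psi> d s)"
    using P.integrable_fst'[OF intG] meas1 unfolding set_integrable_def inner2
    by (subst (asm) integral_beta_measure[OF ab(1)]) (auto simp: mult.commute)
  have intG': "integrable (?N1 \<Otimes>\<^sub>M ?N2) (case_prod (\<lambda>s t. G (s, t)))" using intG by simp
  show "set_integrable lborel {d<..} (\<lambda>t. beta_density \<beta> \<alpha> t *\<^sub>R cut_integral (beta_density \<gamma> \<beta>) \<psi> e t)"
    using P.integrable_snd[OF intG'] meas2 unfolding set_integrable_def inner1
    by (subst (asm) integral_beta_measure[OF ab(2)]) (auto simp: mult.commute)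
  have "?A = (CLINT s|?N1. CLINT t|?N2. G (s, t))"
    using meas1 unfolding set_lebesgue_integral_def inner2
    by (subst integral_beta_measure[OF ab(1)]) (simp_all add: mult.commute)
  then have A: "?A = integral\<^sup>L (?N1 \<Otimes>\<^sub>M ?N2) G" using P.integral_fst'[OF intG] by simp
  have "?B = (CLINT t|?N2. CLINT s|?N1. G (s, t))"
    using meas2 unfolding set_lebesgue_integral_def inner1
    by (subst integral_beta_measure[OF ab(2)]) (simp_all add: mult.commute)
  then have B: "?B = integral\<^sup>L (?N1 \<Otimes>\<^sub>M ?N2) G" using P.integral_snd[OF intG'] by simp
  have sm: "beta_split \<in> ?N3 \<Otimes>\<^sub>M ?K \<rightarrow>\<^sub>M borel \<Otimes>\<^sub>M borel" by measurable
  have intQ: "integrable (?N3 \<Otimes>\<^sub>M ?K) (case_prod (\<lambda>u x. G (beta_split (u, x))))"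
    using intG unfolding beta_measure_pair_eq_distr[OF ab] by (subst (asm) integrable_distr_eq[OF sm G]) (simp only: case_prod_beta' prod.collapse)
  have "integral\<^sup>L (?N1 \<Otimes>\<^sub>M ?N2) G = (CLINT p|?N3 \<Otimes>\<^sub>M ?K. G (beta_split p))"
    unfolding beta_measure_pair_eq_distr[OF ab] by (rule integral_distr[OF sm G])
  also have "\<dots> = (CLINT x|?K. CLINT u|?N3. G (beta_split (u, x)))"
    using Q.integral_snd[OF intQ] by (simp only: case_prod_beta' prod.collapse)
  finally have *: "integral\<^sup>L (?N1 \<Otimes>\<^sub>M ?N2) G = (CLINT x|?K. CLINT u|?N3. G (beta_split (u, x)))" .
  \<comment> \<open>Since s t = u, the integrand no longer depends on x; only the truncation point
    does.\<close>
  have inner3: "(CLINT u|?N3. G (beta_split (u, x))) = cut_integral (beta_density \<gamma> \<alpha>) \<psi> (?m x) 1" if x: "0 < x" "x < 1" for x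
    unfolding cut_integral_beta_measure[OF ac psi_meas]
  proof (rule integral_cong_AE)
    show "AE u in ?N3. G (beta_split (u, x)) = indicator {?m x<..} u *\<^sub>R \<psi> (u * 1)"
      using AE01
    proof eventually_elim
      case (elim u)
      then have u: "0 < u" "u < 1" by auto
      have "x * (1 - u) < 1 * (1 - u)" using u x by (intro mult_strict_right_mono) auto
      then have s: "1 - x * (1 - u) \<noteq> 0" using u unfolding mult_1 by linarith
      have "fst (beta_split (u, x)) * snd (beta_split (u, x)) = u" using s by (simp add: beta_split_def)
      then show ?case
        using beta_split_cut_iff(1)[OF u x e d] by (auto simp: G_def indicator_def)
    qed
  qed measurable
  have AEx: "AE x in ?K. 0 < x \<and> x < 1"
    by (subst AE_density) (auto simp: beta_weight_def)
  have cutm [measurable]: "(\<lambda>x. cut_integral (beta_density \<gamma> \<alpha>) \<psi> (?m x) 1) \<in> borel_measurable ?K"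
    unfolding cut_integral_beta_measure[OF ac psi_meas]
    by (rule Q.M1.borel_measurable_lebesgue_integral[of "\<lambda>x t. indicator {?m x<..} t *\<^sub>R \<psi> (t * 1)"]) (simp add: indicator_def)
  have gm: "(\<lambda>x. CLINT u|?N3. G (beta_split (u, x))) \<in> borel_measurable ?K"
    by (rule Q.M1.borel_measurable_lebesgue_integral[of "\<lambda>x u. G (beta_split (u, x))"]) measurable
  have AEeq: "AE x in ?K. (CLINT u|?N3. G (beta_split (u, x))) = cut_integral (beta_density \<gamma> \<alpha>) \<psi> (?m x) 1"
    using AEx by eventually_elim (simp add: inner3)
  have **: "(CLINT x|?K. CLINT u|?N3. G (beta_split (u, x))) = ?C"
    using AEeq gm cutm by (intro integral_cong_AE)
  show "?A = ?C" "?B = ?C" using A B * ** by simp_all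
  show "integrable ?K (\<lambda>x. cut_integral (beta_density \<gamma> \<alpha>) \<psi> (?m x) 1)"
    using Q.integrable_snd[OF intQ] AEeq gm cutm by (subst (asm) integrable_cong_AE)
qed

text \<open>The truncation points lie in (0, max e d] for every x, so all averaged values are within
  \<eta> of L simultaneously, and so is their mean under a probability measure.\<close>

lemma beta_rectangle_tendsto:
  fixes \<psi> :: "real \<Rightarrow> complex"
  assumes ab: "\<gamma> < \<beta>" "\<beta> < \<alpha>" and cont: "continuous_on UNIV \<psi>"
    and L: "((\<lambda>a. cut_integral (beta_density \<gamma> \<alpha>) \<psi> a 1) \<longlongrightarrow> L) (at_right 0)"
    and \<eta>: "0 < \<eta>"
  obtains r where "0 < r" "r < 1"
    "\<And>e d. 0 < e \<Longrightarrow> e < r \<Longrightarrow> 0 < d \<Longrightarrow> d < r \<Longrightarrow>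
      dist (CLINT s:{e<..}|lborel. beta_density \<gamma> \<beta> s *\<^sub>R cut_integral (beta_density \<beta> \<alpha>) \<psi> d s) L \<le> \<eta>"
proof -
  from tendstoD[OF L \<eta>] obtain b where b: "b > 0"
    "\<And>a. 0 < a \<Longrightarrow> a < b \<Longrightarrow> dist (cut_integral (beta_density \<gamma> \<alpha>) \<psi> a 1) L < \<eta>"
    by (auto simp: eventually_at_right_field)
  let ?K = "density lborel (\<lambda>x. ennreal (beta_weight (\<beta> - \<gamma>) (\<alpha> - \<beta>) x))"
  have "prob_space ?K" using ab by (intro prob_space_beta_weight) auto
  then interpret K: prob_space ?K .
  have "dist (CLINT s:{e<..}|lborel. beta_density \<gamma> \<beta> s *\<^sub>R cut_integral (beta_density \<beta> \<alpha>) \<psi> d s) L \<le> \<eta>"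
    if e: "0 < e" "e < min b (1/2)" and d: "0 < d" "d < min b (1/2)" for e d
  proof -
    have e': "0 < e" "e < 1" and d': "0 < d" "d < 1" using e d by auto
    let ?m = "\<lambda>x. max (1 - (1 - e) / x) (d * (1 - x) / (1 - d * x))"
    let ?F = "\<lambda>x. cut_integral (beta_density \<gamma> \<alpha>) \<psi> (?m x) 1"
    note int = beta_rectangle_integral(5)[OF ab cont e' d']
    have "AE x in ?K. norm (?F x - L) \<le> \<eta>"
    proof -
      have "AE x in ?K. 0 < x \<and> x < 1" by (subst AE_density) (auto simp: beta_weight_def)
      then show ?thesis
      proof eventually_elim
        case (elim x)
        have "0 < ?m x" "?m x \<le> max e d"
          using beta_split_cut_iff(2,3)[of "1/2" x e d] elim e' d' by auto
        moreover have "max e d < b" using e d by simp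
        ultimately have "dist (?F x) L < \<eta>" by (intro b(2)) linarith+
        then show ?case by (simp add: dist_norm)
      qed
    qed
    then have "norm (CLINT x|?K. ?F x - L) \<le> \<eta>"
      using int \<eta> by (intro order_trans[OF integral_norm_bound] K.integral_le_const integrable_norm Bochner_Integration.integrable_diff) auto
    moreover have "(CLINT x|?K. ?F x - L) = (CLINT x|?K. ?F x) - L"
      using int K.prob_space by (subst Bochner_Integration.integral_diff) auto
    ultimately show ?thesis
      unfolding beta_rectangle_integral(1)[OF ab cont e' d'] dist_norm by simp
  qed
  then show thesis using b(1) by (intro that[of "min b (1/2)"]) auto
qed

text \<open>Uniform convergence on [0, 1] is integrated against a weight that vanishes outside
  [0, 1] and has finite mass beyond e.\<close>

lemma cut_integral_limit_interchange:
  fixes C :: "real \<Rightarrow> real \<Rightarrow> complex"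
  assumes ab: "\<beta> < \<alpha>" and contL: "continuous_on UNIV \<Lambda>" and bnd: "\<And>u. u \<in> {0..1} \<Longrightarrow> norm (\<Lambda> u) \<le> B"
    and unif: "uniform_limit {0..1} C \<Lambda> (at_right 0)" and e: "0 < e"
    and int: "\<And>d. 0 < d \<Longrightarrow> d < 1 \<Longrightarrow> set_integrable lborel {e<..} (\<lambda>s. beta_density \<beta> \<alpha> s *\<^sub>R C d s)"
  shows "((\<lambda>d. CLINT s:{e<..}|lborel. beta_density \<beta> \<alpha> s *\<^sub>R C d s) \<longlongrightarrow> cut_integral (beta_density \<beta> \<alpha>) \<Lambda> e 1) (at_right 0)"
proof (rule tendstoI)
  fix \<eta> :: real assume \<eta>: "\<eta> > 0"
  let ?w = "beta_density \<beta> \<alpha>"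
  let ?W = "LINT s:{e<..}|lborel. ?w s"
  have wint: "set_integrable lborel {e<..} ?w" using ab e by (rule set_integrable_beta_density)
  have nn: "0 \<le> ?w s" for s using ab by (rule beta_density_nonneg)
  have W: "0 \<le> ?W" using nn by (auto simp: set_lebesgue_integral_def intro!: integral_nonneg)
  have w01: "?w s = 0" if "s \<notin> {0..1}" for s using that by (auto simp: beta_density_def)
  have B: "0 \<le> B" using order_trans[OF norm_ge_zero bnd[of 0]] by simp
  have [measurable]: "\<Lambda> \<in> borel_measurable borel" using contL by (rule borel_measurable_continuous_onI)
  have Lint: "set_integrable lborel {e<..} (\<lambda>s. ?w s *\<^sub>R \<Lambda> s)"
  proof -
    have "integrable lborel (\<lambda>s. B * (indicator {e<..} s *\<^sub>R ?w s))"
      using wint unfolding set_integrable_def by (rule integrable_mult_right)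
    then show ?thesis
      unfolding set_integrable_def
    proof (rule Bochner_Integration.integrable_bound)
      show "AE s in lborel. norm (indicator {e<..} s *\<^sub>R ?w s *\<^sub>R \<Lambda> s) \<le> norm (B * (indicator {e<..} s *\<^sub>R ?w s))"
      proof (rule AE_I2)
        fix s :: real
        show "norm (indicator {e<..} s *\<^sub>R ?w s *\<^sub>R \<Lambda> s) \<le> norm (B * (indicator {e<..} s *\<^sub>R ?w s))"
        proof (cases "s \<in> {0..1}")
          case True
          then have "?w s * norm (\<Lambda> s) \<le> ?w s * B" using bnd nn by (intro mult_left_mono) auto
          then show ?thesis using nn[of s] B by (simp add: indicator_def mult.commute)
        qed (simp add: w01)
      qed
    qed measurable
  qed
  \<comment> \<open>The 1 added to the mass \<open>?W\<close> avoids a division by 0 and makes the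
    final bound strictly smaller than \<eta>.\<close>
  have pos: "0 < \<eta> / (?W + 1)" using \<eta> W by simp
  have "eventually (\<lambda>d. \<forall>u\<in>{0..1}. dist (C d u) (\<Lambda> u) < \<eta> / (?W + 1)) (at_right 0)"
    using unif pos by (rule uniform_limitD)
  moreover have "eventually (\<lambda>d. 0 < d \<and> d < 1) (at_right (0::real))"
    by (auto simp: eventually_at_right_field intro!: exI[of _ 1])
  ultimately show "eventually (\<lambda>d. dist (CLINT s:{e<..}|lborel. ?w s *\<^sub>R C d s) (cut_integral ?w \<Lambda> e 1) < \<eta>) (at_right 0)"
  proof eventually_elim
    case (elim d)
    note Cint = int[of d]
    have "(CLINT s:{e<..}|lborel. ?w s *\<^sub>R C d s) - cut_integral ?w \<Lambda> e 1 = (CLINT s:{e<..}|lborel. ?w s *\<^sub>R C d s - ?w s *\<^sub>R \<Lambda> s)"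
      unfolding cut_integral_def using Cint Lint elim by (subst set_integral_diff(2)) auto
    also have "norm \<dots> \<le> (LINT s:{e<..}|lborel. norm (?w s *\<^sub>R C d s - ?w s *\<^sub>R \<Lambda> s))"
      using Cint Lint elim by (intro set_integral_norm_bound set_integral_diff(1)) auto
    also have "\<dots> \<le> (LINT s:{e<..}|lborel. \<eta> / (?W + 1) * ?w s)"
    proof (rule set_integral_mono)
      show "set_integrable lborel {e<..} (\<lambda>s. norm (?w s *\<^sub>R C d s - ?w s *\<^sub>R \<Lambda> s))"
        using Cint Lint elim by (intro set_integrable_norm set_integral_diff(1)) auto
      show "set_integrable lborel {e<..} (\<lambda>s. \<eta> / (?W + 1) * ?w s)" using wint by simp
      fix s :: real assume "s \<in> {e<..}"
      show "norm (?w s *\<^sub>R C d s - ?w s *\<^sub>R \<Lambda> s) \<le> \<eta> / (?W + 1) * ?w s"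
      proof (cases "s \<in> {0..1}")
        case True
        then have "dist (C d s) (\<Lambda> s) \<le> \<eta> / (?W + 1)" using elim by (auto intro: less_imp_le)
        then have "?w s * norm (C d s - \<Lambda> s) \<le> ?w s * (\<eta> / (?W + 1))" using nn by (intro mult_left_mono) (auto simp: dist_norm)
        moreover have "norm (?w s *\<^sub>R C d s - ?w s *\<^sub>R \<Lambda> s) = ?w s * norm (C d s - \<Lambda> s)"
          using nn[of s] by (simp flip: scaleR_diff_right)
        ultimately show ?thesis by (simp add: mult.commute)
      qed (simp add: w01)
    qed
    also have "\<dots> = \<eta> / (?W + 1) * ?W" by simp
    also have "\<dots> < \<eta>" using \<eta> W by (simp add: field_simps)
    finally show ?case by (simp add: dist_norm)
  qed
qed

text \<open>Here \<Lambda> is the exponent of the intermediate law. Its uniform approximation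
  identifies the inner limit of the rectangle integrals for each fixed outer truncation; the joint
  limit L then governs the outer limit.\<close>

theorem beta_exponent_composition:
  fixes \<psi> \<Lambda> :: "real \<Rightarrow> complex"
  assumes ab: "\<gamma> < \<beta>" "\<beta> < \<alpha>" and cont: "continuous_on UNIV \<psi>" "continuous_on UNIV \<Lambda>"
    and L: "((\<lambda>a. cut_integral (beta_density \<gamma> \<alpha>) \<psi> a 1) \<longlongrightarrow> L) (at_right 0)"
  shows "uniform_limit {0..1} (cut_integral (beta_density \<beta> \<alpha>) \<psi>) \<Lambda> (at_right 0) \<Longrightarrow>
      ((\<lambda>a. cut_integral (beta_density \<gamma> \<beta>) \<Lambda> a 1) \<longlongrightarrow> L) (at_right 0)"
    and "uniform_limit {0..1} (cut_integral (beta_density \<gamma> \<beta>) \<psi>) \<Lambda> (at_right 0) \<Longrightarrow>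
      ((\<lambda>a. cut_integral (beta_density \<beta> \<alpha>) \<Lambda> a 1) \<longlongrightarrow> L) (at_right 0)"
proof -
  have "compact (\<Lambda> ` {0..1})"
    by (intro compact_continuous_image continuous_on_subset[OF cont(2)]) auto
  then have "bounded (\<Lambda> ` {0..1})" by (rule compact_imp_bounded)
  then obtain B where B': "\<forall>y\<in>\<Lambda> ` {0..1}. norm y \<le> B"
    unfolding bounded_iff by (rule exE)
  have B: "norm (\<Lambda> u) \<le> B" if "u \<in> {0..1}" for u
    using B' that by (rule bspec[OF _ imageI])
  \<comment> \<open>A joint limit together with existing inner limits gives the iterated limit. The
    closed bound \<eta> / 2 survives d -> 0 and leaves room for the strict bound \<eta>.\<close>
  have iter: "((\<lambda>e. k e) \<longlongrightarrow> L) (at_right 0)"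
    if J: "\<And>\<eta>. 0 < \<eta> \<Longrightarrow> \<exists>r. 0 < r \<and> r < 1 \<and> (\<forall>e d. 0 < e \<longrightarrow> e < r \<longrightarrow> 0 < d \<longrightarrow> d < r \<longrightarrow> dist (J e d) L \<le> \<eta>)"
      and k: "\<And>e. 0 < e \<Longrightarrow> e < 1 \<Longrightarrow> ((\<lambda>d. J e d) \<longlongrightarrow> k e) (at_right 0)" for J :: "real \<Rightarrow> real \<Rightarrow> complex" and k
  proof (rule tendstoI)
    fix \<eta> :: real assume \<eta>: "\<eta> > 0"
    obtain r where r: "0 < r" "r < 1" "\<And>e d. 0 < e \<Longrightarrow> e < r \<Longrightarrow> 0 < d \<Longrightarrow> d < r \<Longrightarrow> dist (J e d) L \<le> \<eta> / 2"
      using J[of "\<eta> / 2"] \<eta> by auto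
    have "dist (k e) L < \<eta>" if e: "0 < e" "e < r" for e
    proof -
      have "((\<lambda>d. dist (J e d) L) \<longlongrightarrow> dist (k e) L) (at_right 0)"
        using e r by (intro tendsto_dist k tendsto_const) auto
      moreover have "eventually (\<lambda>d. dist (J e d) L \<le> \<eta> / 2) (at_right 0)"
        unfolding eventually_at_right_field using r e by (intro exI[of _ r]) auto
      ultimately have "dist (k e) L \<le> \<eta> / 2" by (intro tendsto_upperbound) auto
      then show ?thesis using \<eta> by simp
    qed
    then show "eventually (\<lambda>e. dist (k e) L < \<eta>) (at_right 0)"
      using r by (auto simp: eventually_at_right_field intro!: exI[of _ r])
  qed
  let ?J1 = "\<lambda>e d. CLINT s:{e<..}|lborel. beta_density \<gamma> \<beta> s *\<^sub>R cut_integral (beta_density \<beta> \<alpha>) \<psi> d s"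
  let ?J2 = "\<lambda>d e. CLINT t:{d<..}|lborel. beta_density \<beta> \<alpha> t *\<^sub>R cut_integral (beta_density \<gamma> \<beta>) \<psi> e t"
  have J1: "\<exists>r. 0 < r \<and> r < 1 \<and> (\<forall>e d. 0 < e \<longrightarrow> e < r \<longrightarrow> 0 < d \<longrightarrow> d < r \<longrightarrow> dist (?J1 e d) L \<le> \<eta>)" if "0 < \<eta>" for \<eta>
    by (rule beta_rectangle_tendsto[OF ab cont(1) L that]) blast
  have eq: "?J1 e d = ?J2 d e" if "0 < e" "e < 1" "0 < d" "d < 1" for e d
    using beta_rectangle_integral(1,2)[OF ab cont(1) that] by simp
  have J2: "\<exists>r. 0 < r \<and> r < 1 \<and> (\<forall>e d. 0 < e \<longrightarrow> e < r \<longrightarrow> 0 < d \<longrightarrow> d < r \<longrightarrow> dist (?J2 e d) L \<le> \<eta>)" if \<eta>: "0 < \<eta>" for \<eta>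
  proof -
    obtain r where r: "0 < r" "r < 1" "\<And>e d. 0 < e \<Longrightarrow> e < r \<Longrightarrow> 0 < d \<Longrightarrow> d < r \<Longrightarrow> dist (?J1 e d) L \<le> \<eta>"
      using J1[OF \<eta>] by blast
    have "dist (?J2 e d) L \<le> \<eta>" if h: "0 < e" "e < r" "0 < d" "d < r" for e d
      using r(3)[of d e] eq[of d e] h r(2) by simp
    then show ?thesis using r by blast
  qed
  show "((\<lambda>a. cut_integral (beta_density \<gamma> \<beta>) \<Lambda> a 1) \<longlongrightarrow> L) (at_right 0)"
    if u: "uniform_limit {0..1} (cut_integral (beta_density \<beta> \<alpha>) \<psi>) \<Lambda> (at_right 0)"
  proof (rule iter[of ?J1])
    fix e :: real assume e: "0 < e" "e < 1"
    show "((\<lambda>d. ?J1 e d) \<longlongrightarrow> cut_integral (beta_density \<gamma> \<beta>) \<Lambda> e 1) (at_right 0)"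
      by (rule cut_integral_limit_interchange[OF ab(1) cont(2) B u e(1)])
         (use beta_rectangle_integral(3)[OF ab cont(1) e] in auto)
  qed (rule J1)
  show "((\<lambda>a. cut_integral (beta_density \<beta> \<alpha>) \<Lambda> a 1) \<longlongrightarrow> L) (at_right 0)"
    if u: "uniform_limit {0..1} (cut_integral (beta_density \<gamma> \<beta>) \<psi>) \<Lambda> (at_right 0)"
  proof (rule iter[of ?J2])
    fix d :: real assume d: "0 < d" "d < 1"
    show "((\<lambda>e. ?J2 d e) \<longlongrightarrow> cut_integral (beta_density \<beta> \<alpha>) \<Lambda> d 1) (at_right 0)"
      by (rule cut_integral_limit_interchange[OF ab(2) cont(2) B u d(1)])
         (use beta_rectangle_integral(4)[OF ab cont(1) _ _ d] in auto)
  qed (rule J2)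
qed

section \<open>Exponents of Levy processes\<close>

text \<open>The difference g - h takes values in the integer multiples of 2 pi i, any two of which
  are at least 2 pi apart; on a connected set it is constant.\<close>

lemma exp_eq_imp_eq_on_connected:
  fixes g h :: "'a::topological_space \<Rightarrow> complex"
  assumes S: "connected S" and g: "continuous_on S g" and h: "continuous_on S h"
    and eq: "\<And>x. x \<in> S \<Longrightarrow> exp (g x) = exp (h x)" and a: "a \<in> S" "g a = h a" and x: "x \<in> S"
  shows "g x = h x"
proof -
  have "(\<lambda>x. g x - h x) constant_on S"
  proof (rule continuous_discrete_range_constant[OF S])
    show "continuous_on S (\<lambda>x. g x - h x)" using g h by (intro continuous_intros)
    fix x assume x: "x \<in> S"
    have "2 * pi \<le> norm (g y - h y - (g x - h x))" if y: "y \<in> S" "g y - h y \<noteq> g x - h x" for y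
    proof -
      obtain m where m: "g x = h x + (of_int (2 * m) * pi) * \<i>" using eq[OF x] unfolding exp_eq by blast
      obtain n where n: "g y = h y + (of_int (2 * n) * pi) * \<i>" using eq[OF y(1)] unfolding exp_eq by blast
      have "g y - h y - (g x - h x) = of_real (2 * pi * of_int (n - m)) * \<i>"
        by (simp add: m n algebra_simps)
      then have "norm (g y - h y - (g x - h x)) = \<bar>2 * pi * of_int (n - m)\<bar>"
        by (simp only: norm_mult norm_of_real) simp
      also have "\<dots> = 2 * pi * of_int \<bar>n - m\<bar>" by (simp add: abs_mult)
      finally have *: "norm (g y - h y - (g x - h x)) = 2 * pi * of_int \<bar>n - m\<bar>" .
      have "n \<noteq> m" using y(2) m n by auto
      then have "1 \<le> \<bar>n - m\<bar>" by simp
      then have "2 * pi * 1 \<le> 2 * pi * (of_int \<bar>n - m\<bar> :: real)" by (intro mult_left_mono) auto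
      then show ?thesis unfolding * by simp
    qed
    then show "\<exists>e>0. \<forall>y. y \<in> S \<and> g y - h y \<noteq> g x - h x \<longrightarrow> e \<le> norm (g y - h y - (g x - h x))"
      by (intro exI[of _ "2 * pi"]) auto
  qed
  then obtain c where "\<And>x. x \<in> S \<Longrightarrow> g x - h x = c" unfolding constant_on_def by blast
  from this[OF a(1)] this[OF x] a(2) show ?thesis by simp
qed

lemma continuous_logarithm_real:
  fixes \<phi> :: "real \<Rightarrow> complex"
  assumes "continuous_on UNIV \<phi>" "\<And>u. \<phi> u \<noteq> 0" "\<phi> 0 = 1"
  obtains \<psi> where "continuous_on UNIV \<psi>" "\<psi> 0 = 0" "\<And>u. \<phi> u = exp (\<psi> u)"
proof -
  have "contractible (UNIV :: real set)" by (intro convex_imp_contractible) simp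
  then obtain g where g: "continuous_on UNIV g" "\<And>u. \<phi> u = exp (g u)"
    using continuous_logarithm_on_contractible[OF assms(1), of thesis] assms(2) by blast
  have "continuous_on UNIV (\<lambda>u. g u - g 0)" using g(1) by (intro continuous_intros)
  moreover have "\<phi> u = exp (g u - g 0)" for u using g(2) assms(3) by (metis div_by_1 exp_diff)
  ultimately show thesis by (intro that[of "\<lambda>u. g u - g 0"]) auto
qed

text \<open>This is the derivative of exp at 0. It turns inequalities between characteristic
  functions of convolution roots into inequalities between exponents.\<close>

lemma tendsto_one_minus_Re_exp:
  "(\<lambda>n. real (Suc n) * (1 - Re (exp (z / of_nat (Suc n))))) \<longlonglongrightarrow> - Re z"
proof (cases "z = 0")
  case False
  have "((\<lambda>h. (exp h - 1) / h) \<longlongrightarrow> (1::complex)) (at 0)"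
    using DERIV_exp[of "0::complex"] by (simp add: DERIV_def)
  moreover have "filterlim (\<lambda>n. z / of_nat (Suc n)) (at 0) sequentially"
    unfolding filterlim_at
  proof
    show "\<forall>\<^sub>F n in sequentially. z / of_nat (Suc n) \<in> UNIV \<and> z / of_nat (Suc n) \<noteq> 0"
      using False by (intro always_eventually allI) (auto simp del: of_nat_Suc)
    have "(\<lambda>n. z * (1 / of_nat (Suc n))) \<longlonglongrightarrow> z * 0"
      by (intro tendsto_intros LIMSEQ_Suc lim_1_over_n)
    then show "(\<lambda>n. z / of_nat (Suc n)) \<longlonglongrightarrow> 0" by simp
  qed
  ultimately have "(\<lambda>n. (exp (z / of_nat (Suc n)) - 1) / (z / of_nat (Suc n))) \<longlonglongrightarrow> 1"
    by (rule filterlim_compose)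
  then have "(\<lambda>n. - Re (z * ((exp (z / of_nat (Suc n)) - 1) / (z / of_nat (Suc n))))) \<longlonglongrightarrow> - Re (z * 1)"
    by (intro tendsto_intros)
  moreover have "- Re (z * ((exp (z / of_nat (Suc n)) - 1) / (z / of_nat (Suc n)))) = real (Suc n) * (1 - Re (exp (z / of_nat (Suc n))))" for n
  proof -
    have *: "z * ((exp (z / of_nat (Suc n)) - 1) / (z / of_nat (Suc n))) = real (Suc n) *\<^sub>R (exp (z / of_nat (Suc n)) - 1)"
      using False by (simp add: field_simps scaleR_conv_of_real del: of_nat_Suc)
    show ?thesis
      unfolding * scaleR_complex.sel minus_complex.sel one_complex.sel by (simp add: algebra_simps del: of_nat_Suc)
  qed
  ultimately show ?thesis by simp
qed simp

text \<open>The pointwise inequality 1 - cos 2y <= 4 (1 - cos y) amounts to 2 (1 - cos y)^2 >= 0.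
  The factor 4 is exact for Gaussian exponents in the limit.\<close>

lemma (in real_distribution) one_minus_Re_char_double:
  "1 - Re (char M (2 * u)) \<le> 4 * (1 - Re (char M u))"
proof -
  have Re: "Re (char M v) = (LINT x|M. cos (v * x))" for v
  proof -
    have "complex_integrable M (\<lambda>x. iexp (v * x))" by (intro integrable_iexp) auto
    then have "Re (char M v) = (LINT x|M. Re (iexp (v * x)))" unfolding char_def by (simp only: integral_Re)
    then show ?thesis by (simp add: Re_exp)
  qed
  have int: "integrable M (\<lambda>x. cos (v * x))" for v by (intro integrable_const_bound[of _ 1]) auto
  have "1 - Re (char M (2 * u)) = (LINT x|M. 1 - cos (2 * u * x))"
    unfolding Re using int[of "2 * u"] prob_space by (subst Bochner_Integration.integral_diff) auto
  also have "\<dots> \<le> (LINT x|M. 4 * (1 - cos (u * x)))"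
  proof (rule integral_mono)
    fix x
    have "cos (2 * u * x) = 2 * (cos (u * x))\<^sup>2 - 1" using cos_double_cos[of "u * x"] by (simp add: mult.assoc)
    moreover have "0 \<le> 2 * (1 - cos (u * x))\<^sup>2" by simp
    ultimately show "1 - cos (2 * u * x) \<le> 4 * (1 - cos (u * x))"
      by (simp add: power2_eq_square algebra_simps)
  qed (use int in auto)
  also have "\<dots> = 4 * (1 - Re (char M u))"
    unfolding Re using int[of u] prob_space by simp
  finally show ?thesis .
qed

text \<open>The distinguished logarithm: continuity and the value at 0 select a single branch, so it
  is a function of the law alone.\<close>

definition char_exponent :: "real measure \<Rightarrow> (real \<Rightarrow> complex) \<Rightarrow> bool" where
  "char_exponent N \<psi> \<longleftrightarrow> continuous_on UNIV \<psi> \<and> \<psi> 0 = 0 \<and> (\<forall>u. char N u = exp (\<psi> u))"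

lemma char_exponent_unique:
  assumes "char_exponent N \<psi>" "char_exponent N \<psi>'"
  shows "\<psi> = \<psi>'"
proof
  fix u
  show "\<psi> u = \<psi>' u"
    by (rule exp_eq_imp_eq_on_connected[of UNIV _ _ 0]) (use assms in \<open>auto simp: char_exponent_def\<close>)
qed

section \<open>Characteristic functions along a Levy process\<close>

lemma levy_processD:
  assumes "levy_process M Y \<nu>"
  shows "prob_space M" "\<And>t. 0 \<le> t \<Longrightarrow> Y t \<in> borel_measurable M" "\<And>\<omega>. \<omega> \<in> space M \<Longrightarrow> Y 0 \<omega> = 0"
    "\<And>\<omega>. \<omega> \<in> space M \<Longrightarrow> cadlag (\<lambda>t. Y t \<omega>)"
    "\<And>s t. 0 \<le> s \<Longrightarrow> 0 \<le> t \<Longrightarrow> distr M borel (\<lambda>\<omega>. Y (s + t) \<omega> - Y s \<omega>) = distr M borel (Y t)"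
    "\<And>n \<tau>. 0 \<le> \<tau> 0 \<Longrightarrow> mono \<tau> \<Longrightarrow> prob_space.indep_vars M (\<lambda>_. borel) (\<lambda>i \<omega>. Y (\<tau> (Suc i)) \<omega> - Y (\<tau> i) \<omega>) {..<n::nat}"
    "distr M borel (Y 1) = \<nu>"
  using assms unfolding levy_process_def by blast+

lemma char_levy_increments:
  fixes f :: "'a::{banach, second_countable_topology} \<Rightarrow> real" and \<tau> :: "nat \<Rightarrow> real"
  assumes levy: "levy_process M Y \<nu>" and f: "bounded_linear f" and \<tau>: "0 \<le> \<tau> 0" "mono \<tau>"
  shows "char (distr M borel (\<lambda>\<omega>. \<Sum>i<n. a i * f (Y (\<tau> (Suc i)) \<omega> - Y (\<tau> i) \<omega>))) u
       = (\<Prod>i<n. char (distr M borel (\<lambda>\<omega>. f (Y (\<tau> (Suc i) - \<tau> i) \<omega>))) (u * a i))"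
proof -
  note L = levy_processD[OF levy]
  interpret prob_space M by (rule L(1))
  have [measurable]: "f \<in> borel_measurable borel"
    using f by (rule bounded_linear_borel_measurable)
  have \<tau>0: "0 \<le> \<tau> i" for i using \<tau> by (meson monoD order_trans zero_le)
  have [measurable]: "Y (\<tau> i) \<in> borel_measurable M" for i by (rule L(2)[OF \<tau>0])
  have inc: "0 \<le> \<tau> (Suc i) - \<tau> i" for i using \<tau>(2) by (simp add: monoD)
  have [measurable]: "Y (\<tau> (Suc i) - \<tau> i) \<in> borel_measurable M" for i by (rule L(2)[OF inc])
  have "indep_vars (\<lambda>_. borel) (\<lambda>i \<omega>. a i * f (Y (\<tau> (Suc i)) \<omega> - Y (\<tau> i) \<omega>)) {..<n}"
    by (rule indep_vars_compose2[OF L(6)[OF \<tau>]]) measurable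
  then have "char (distr M borel (\<lambda>\<omega>. \<Sum>i<n. a i * f (Y (\<tau> (Suc i)) \<omega> - Y (\<tau> i) \<omega>))) u
      = (\<Prod>i<n. char (distr M borel (\<lambda>\<omega>. a i * f (Y (\<tau> (Suc i)) \<omega> - Y (\<tau> i) \<omega>))) u)"
    by (rule char_distr_sum)
  also have "\<dots> = (\<Prod>i<n. char (distr M borel (\<lambda>\<omega>. f (Y (\<tau> (Suc i) - \<tau> i) \<omega>))) (u * a i))"
  proof (rule prod.cong[OF refl])
    fix i
    have "char (distr M borel (\<lambda>\<omega>. a i * f (Y (\<tau> (Suc i)) \<omega> - Y (\<tau> i) \<omega>))) u
        = (CLINT x|distr M borel (\<lambda>\<omega>. Y (\<tau> (Suc i)) \<omega> - Y (\<tau> i) \<omega>). iexp (u * (a i * f x)))"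
      unfolding char_def by (subst (1 2) integral_distr) auto
    also have "distr M borel (\<lambda>\<omega>. Y (\<tau> (Suc i)) \<omega> - Y (\<tau> i) \<omega>) = distr M borel (Y (\<tau> (Suc i) - \<tau> i))"
      using L(5)[OF \<tau>0 inc, of i i] by simp
    also have "(CLINT x|distr M borel (Y (\<tau> (Suc i) - \<tau> i)). iexp (u * (a i * f x)))
        = char (distr M borel (\<lambda>\<omega>. f (Y (\<tau> (Suc i) - \<tau> i) \<omega>))) (u * a i)"
      unfolding char_def by (subst (1 2) integral_distr) (auto simp: mult.assoc)
    finally show "char (distr M borel (\<lambda>\<omega>. a i * f (Y (\<tau> (Suc i)) \<omega> - Y (\<tau> i) \<omega>))) u
        = char (distr M borel (\<lambda>\<omega>. f (Y (\<tau> (Suc i) - \<tau> i) \<omega>))) (u * a i)" .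
  qed
  finally show ?thesis .
qed

text \<open>Independence and stationarity make \<open>c\<close> multiplicative along multiples of a
  fixed time step, which settles rational times; right continuity of the paths extends the formula
  to all times. The last inequality is the property of exponents that later survives limits in
  probability.\<close>

lemma levy_process_exponent:
  fixes f :: "'a::{banach, second_countable_topology} \<Rightarrow> real"
  assumes levy: "levy_process M Y \<nu>" and f: "bounded_linear f"
  obtains \<psi> where "char_exponent (distr \<nu> borel f) \<psi>"
    "\<And>t u. 0 \<le> t \<Longrightarrow> char (distr M borel (\<lambda>\<omega>. f (Y t \<omega>))) u = exp (of_real t * \<psi> u)"
    "\<And>u. 4 * Re (\<psi> u) \<le> Re (\<psi> (2 * u))"
proof -
  note L = levy_processD[OF levy]
  interpret prob_space M by (rule L(1))
  note [measurable] = L(2)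
  have [measurable]: "f \<in> borel_measurable borel"
    using f by (rule bounded_linear_borel_measurable)
  interpret f: bounded_linear f by fact
  define c where "c t u = char (distr M borel (\<lambda>\<omega>. f (Y t \<omega>))) u" for t u
  have c_eq: "c t u = (CLINT \<omega>|M. iexp (u * f (Y t \<omega>)))" if "0 \<le> t" for t u
    unfolding c_def char_def using that by (subst integral_distr) auto
  have rd: "real_distribution (distr M borel (\<lambda>\<omega>. f (Y t \<omega>)))" if "0 \<le> t" for t
    using that by (intro real_distribution_distr) measurable
  have c_zero: "c 0 u = 1" for u
  proof -
    have "c 0 u = (CLINT \<omega>|M. iexp (u * f (Y 0 \<omega>)))" by (rule c_eq) simp
    also have "\<dots> = (CLINT \<omega>|M. 1)"
      by (rule Bochner_Integration.integral_cong) (simp_all add: L(3) f.zero)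
    finally have "c 0 u = (CLINT \<omega>|M. 1)" .
    then show ?thesis by (simp add: prob_space)
  qed
  have c_pow: "c (real m * h) u = c h u ^ m" if h: "0 \<le> h" for m h u
  proof -
    have "c (real m * h) u = char (distr M borel (\<lambda>\<omega>. \<Sum>i<m. 1 * f (Y (real (Suc i) * h) \<omega> - Y (real i * h) \<omega>))) u"
    proof -
      have "(\<Sum>i<m. 1 * f (Y (real (Suc i) * h) \<omega> - Y (real i * h) \<omega>)) = f (Y (real m * h) \<omega>)"
        if "\<omega> \<in> space M" for \<omega>
        using sum_lessThan_telescope[of "\<lambda>i. f (Y (real i * h) \<omega>)" m] L(3)[OF that]
        by (simp add: f.diff f.zero del: of_nat_Suc)
      then show ?thesis unfolding c_def by (intro arg_cong2[where f = char] distr_cong refl) auto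
    qed
    also have "\<dots> = (\<Prod>i<m. c (real (Suc i) * h - real i * h) (u * 1))"
      unfolding c_def using h
      by (intro char_levy_increments[OF levy f, where \<tau> = "\<lambda>i. real i * h"]) (auto intro!: monoI mult_right_mono)
    also have "\<dots> = c h u ^ m" by (simp add: algebra_simps)
    finally show ?thesis .
  qed
  have c_lim: "(\<lambda>n. c (q n) u) \<longlonglongrightarrow> c t u"
    if t: "0 \<le> t" and q: "\<And>n. t < q n" "q \<longlonglongrightarrow> t" for t q u
  proof -
    have q0: "0 \<le> q n" for n using q(1)[of n] t by simp
    have qr: "filterlim q (at_right t) sequentially"
      unfolding filterlim_at using q(2) less_imp_neq[OF q(1), symmetric] q(1)
      by (simp add: always_eventually)
    have "(\<lambda>n. CLINT \<omega>|M. iexp (u * f (Y (q n) \<omega>))) \<longlonglongrightarrow> (CLINT \<omega>|M. iexp (u * f (Y t \<omega>)))"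
    proof (rule integral_dominated_convergence[where w = "\<lambda>_. 1"])
      show "AE \<omega> in M. (\<lambda>n. iexp (u * f (Y (q n) \<omega>))) \<longlonglongrightarrow> iexp (u * f (Y t \<omega>))"
      proof (rule AE_I2)
        fix \<omega> assume \<omega>: "\<omega> \<in> space M"
        have "((\<lambda>s. Y s \<omega>) \<longlongrightarrow> Y t \<omega>) (at_right t)"
          using L(4)[OF \<omega>] t by (simp add: cadlag_def continuous_within)
        from filterlim_compose[OF this qr] have "(\<lambda>n. Y (q n) \<omega>) \<longlonglongrightarrow> Y t \<omega>" .
        then show "(\<lambda>n. iexp (u * f (Y (q n) \<omega>))) \<longlonglongrightarrow> iexp (u * f (Y t \<omega>))"
          by (intro tendsto_intros f.tendsto)
      qed
    qed (use q0 t in \<open>auto intro!: AE_I2\<close>)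
    then show ?thesis using q0 t by (simp add: c_eq)
  qed
  have inv: "(\<lambda>n. 1 / real (Suc n)) \<longlonglongrightarrow> 0" by (rule LIMSEQ_Suc[OF lim_1_over_n])
  have c1_pow: "c 1 u = c (1 / real (Suc n)) u ^ Suc n" for n u
    using c_pow[of "1 / real (Suc n)" "Suc n" u] by (simp del: of_nat_Suc power_Suc)
  \<comment> \<open>A zero at time 1 would be a zero at every time 1 / (n + 1), although these
    values tend to \<open>c 0 u\<close>, which is 1.\<close>
  have c1_nz: "c 1 u \<noteq> 0" for u
  proof
    assume "c 1 u = 0"
    then have "c (1 / real (Suc n)) u ^ Suc n = 0" for n using c1_pow[of u n] by (simp only:)
    then have "c (1 / real (Suc n)) u = 0" for n by (simp only: power_eq_0_iff)
    moreover have "(\<lambda>n. c (1 / real (Suc n)) u) \<longlonglongrightarrow> c 0 u"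
      by (rule c_lim) (use inv in auto)
    ultimately have "(\<lambda>n. 0::complex) \<longlonglongrightarrow> 1" by (simp add: c_zero)
    then show False by (simp add: LIMSEQ_const_iff)
  qed
  have c_cont: "continuous_on UNIV (c t)" if "0 \<le> t" for t
    unfolding c_def using real_distribution.isCont_char[OF rd[OF that]]
    by (auto intro!: continuous_at_imp_continuous_on)
  have c_at_0: "c t 0 = 1" if "0 \<le> t" for t
    unfolding c_def by (rule real_distribution.char_zero[OF rd[OF that]])
  obtain \<psi> where \<psi>: "continuous_on UNIV \<psi>" "\<psi> 0 = 0" "\<And>u. c 1 u = exp (\<psi> u)"
    using continuous_logarithm_real[OF c_cont c1_nz c_at_0] by auto
  \<comment> \<open>Both (n + 1) \<theta> and \<psi> are continuous logarithms of the same function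
    that vanish at 0, so no other branch of the root can occur.\<close>
  have root: "c (1 / real (Suc n)) u = exp (\<psi> u / of_nat (Suc n))" for n u
  proof -
    have nz: "c (1 / real (Suc n)) u \<noteq> 0" for u using c1_pow[of u n] c1_nz[of u] by auto
    obtain \<theta> where \<theta>: "continuous_on UNIV \<theta>" "\<theta> 0 = 0" "\<And>u. c (1 / real (Suc n)) u = exp (\<theta> u)"
      using continuous_logarithm_real[OF c_cont nz c_at_0] by auto
    have "of_nat (Suc n) * \<theta> u = \<psi> u"
    proof (rule exp_eq_imp_eq_on_connected[of UNIV "\<lambda>u. of_nat (Suc n) * \<theta> u" \<psi> 0 u])
      show "exp (of_nat (Suc n) * \<theta> u) = exp (\<psi> u)" for u
        using c1_pow[of u n] \<theta>(3) \<psi>(3) by (simp only: exp_of_nat_mult)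
    qed (use \<theta> \<psi> in \<open>auto intro!: continuous_intros\<close>)
    then have "\<theta> u = \<psi> u / of_nat (Suc n)" by (simp add: field_simps del: of_nat_Suc)
    then show ?thesis using \<theta>(3) by simp
  qed
  have main: "c t u = exp (of_real t * \<psi> u)" if t: "0 \<le> t" for t u
  proof -
    \<comment> \<open>The fraction m / (n + 1) exceeds t strictly, by at most 1 / (n + 1): the limit
      has to be taken from the right, where the paths are continuous.\<close>
    define m where "m n = Suc (nat \<lfloor>t * real (Suc n)\<rfloor>)" for n
    define q where "q n = real (m n) * (1 / real (Suc n))" for n
    have mb: "t * real (Suc n) < real (m n)" "real (m n) \<le> t * real (Suc n) + 1" for n
    proof -
      have "real (m n) = of_int \<lfloor>t * real (Suc n)\<rfloor> + 1" using t by (simp add: m_def)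
      then show "t * real (Suc n) < real (m n)" "real (m n) \<le> t * real (Suc n) + 1" by linarith+
    qed
    have q1: "t < q n" "q n \<le> t + 1 / real (Suc n)" for n
      using mb[of n] by (simp_all add: q_def field_simps del: of_nat_Suc)
    have q2: "q \<longlonglongrightarrow> t"
    proof (rule tendsto_sandwich[OF always_eventually always_eventually])
      show "(\<lambda>n. t) \<longlonglongrightarrow> t" by simp
      show "(\<lambda>n. t + 1 / real (Suc n)) \<longlonglongrightarrow> t" using tendsto_add[OF tendsto_const[of t] inv] by simp
    qed (use q1 in \<open>auto intro: less_imp_le\<close>)
    have "c (q n) u = exp (of_real (q n) * \<psi> u)" for n
    proof -
      have "c (q n) u = exp (\<psi> u / of_nat (Suc n)) ^ m n"
        unfolding q_def by (subst c_pow) (simp_all only: root zero_le_divide_1_iff of_nat_0_le_iff)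
      also have "\<dots> = exp (of_nat (m n) * (\<psi> u / of_nat (Suc n)))" by (simp only: exp_of_nat_mult)
      also have "of_nat (m n) * (\<psi> u / of_nat (Suc n)) = of_real (q n) * \<psi> u" by (simp add: q_def)
      finally show ?thesis .
    qed
    moreover have "(\<lambda>n. exp (of_real (q n) * \<psi> u)) \<longlonglongrightarrow> exp (of_real t * \<psi> u)"
      by (intro tendsto_intros q2)
    moreover have "(\<lambda>n. c (q n) u) \<longlonglongrightarrow> c t u" by (rule c_lim[OF t q1(1) q2])
    ultimately show ?thesis using LIMSEQ_unique by force
  qed
  \<comment> \<open>The doubling inequality is used for Y at time 1 / (n + 1); multiplied by n + 1,
    it becomes an inequality between exponents in the limit.\<close>
  have "4 * Re (\<psi> u) \<le> Re (\<psi> (2 * u))" for u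
  proof -
    have "real (Suc n) * (1 - Re (exp (\<psi> (2 * u) / of_nat (Suc n)))) \<le> 4 * (real (Suc n) * (1 - Re (exp (\<psi> u / of_nat (Suc n)))))" for n
    proof -
      have "1 - Re (c (1 / real (Suc n)) (2 * u)) \<le> 4 * (1 - Re (c (1 / real (Suc n)) u))"
        unfolding c_def by (rule real_distribution.one_minus_Re_char_double[OF rd]) simp
      then have "real (Suc n) * (1 - Re (exp (\<psi> (2 * u) / of_nat (Suc n)))) \<le> real (Suc n) * (4 * (1 - Re (exp (\<psi> u / of_nat (Suc n)))))"
        unfolding root by (rule mult_left_mono) simp
      then show ?thesis by (simp only: mult.left_commute)
    qed
    then have "- Re (\<psi> (2 * u)) \<le> 4 * (- Re (\<psi> u))"
      by (intro LIMSEQ_le[OF tendsto_one_minus_Re_exp tendsto_mult[OF tendsto_const tendsto_one_minus_Re_exp]]) blast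
    then show ?thesis by simp
  qed
  moreover have "char_exponent (distr \<nu> borel f) \<psi>"
  proof -
    have "distr \<nu> borel f = distr M borel (\<lambda>\<omega>. f (Y 1 \<omega>))"
      unfolding L(7)[symmetric] by (subst distr_distr) (auto simp: comp_def)
    then show ?thesis using \<psi> by (simp add: char_exponent_def c_def)
  qed
  ultimately show thesis using main by (intro that[of \<psi>]) (auto simp: c_def)
qed

section \<open>Path integrals as limits of sums over grids\<close>

text \<open>There are n + 1 cells, so the mesh is never a division by 0. Indices beyond n + 1
  continue with the same step to the right of b.\<close>

definition grid :: "real \<Rightarrow> real \<Rightarrow> nat \<Rightarrow> nat \<Rightarrow> real" where
  "grid a b n k = a + (b - a) * real k / real (Suc n)"

lemma grid_0 [simp]: "grid a b n 0 = a" by (simp add: grid_def)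

lemma grid_last [simp]: "grid a b n (Suc n) = b" by (simp add: grid_def del: of_nat_Suc)

lemma grid_Suc: "grid a b n (Suc k) = grid a b n k + (b - a) / real (Suc n)"
  by (simp add: grid_def field_simps add_divide_distrib[symmetric])

lemma grid_mono: "a \<le> b \<Longrightarrow> k \<le> l \<Longrightarrow> grid a b n k \<le> grid a b n l"
  by (auto simp: grid_def intro!: divide_right_mono mult_left_mono)

lemma grid_cell_exists:
  assumes t: "a < t" "t \<le> b"
  obtains k where "k \<le> n" "grid a b n k < t" "t \<le> grid a b n (Suc k)"
proof -
  have ab: "a < b" using t by simp
  define k where "k = (LEAST k. t \<le> grid a b n (Suc k))"
  have ex: "t \<le> grid a b n (Suc n)" using t by simp
  have 1: "t \<le> grid a b n (Suc k)" unfolding k_def using ex by (rule LeastI)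
  have 2: "k \<le> n" unfolding k_def using ex by (rule Least_le)
  have 3: "grid a b n k < t"
  proof (cases k)
    case (Suc j)
    then have "\<not> t \<le> grid a b n (Suc j)" using not_less_Least[of j "\<lambda>k. t \<le> grid a b n (Suc k)"] unfolding k_def by simp
    then show ?thesis using Suc by simp
  qed (use t in simp)
  show thesis using 2 3 1 by (rule that)
qed

lemma grid_cell_unique:
  assumes ab: "a \<le> b" and "grid a b n k < t" "t \<le> grid a b n (Suc k)" "grid a b n l < t" "t \<le> grid a b n (Suc l)"
  shows "k = l"
proof (rule ccontr)
  assume "k \<noteq> l"
  then have "Suc k \<le> l \<or> Suc l \<le> k" by auto
  then show False
    using grid_mono[OF ab, of "Suc k" l n] grid_mono[OF ab, of "Suc l" k n] assms by auto
qed

lemma tendsto_grid_mesh: "(\<lambda>n. c / real (Suc n)) \<longlonglongrightarrow> 0"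
proof -
  have "(\<lambda>n. c * (1 / real (Suc n))) \<longlonglongrightarrow> c * 0" by (intro tendsto_intros LIMSEQ_Suc lim_1_over_n)
  then show ?thesis by simp
qed

text \<open>Step functions with value \<open>v n k\<close> on the k-th cell converge pointwise to F
  and are dominated by a constant on a set of finite measure. The hypothesis follows the cells
  containing t, so F may be a left limit; its measurability is obtained from the
  approximation.\<close>

lemma grid_step_integral_tendsto:
  fixes N :: "real measure" and v :: "nat \<Rightarrow> nat \<Rightarrow> 'b::{banach, second_countable_topology}"
  assumes N: "sets N = sets borel" "emeasure N {a<..b} < \<infinity>" and ab: "a < b"
    and bound: "\<And>n k. m \<le> n \<Longrightarrow> k \<le> n \<Longrightarrow> norm (v n k) \<le> B"
    and conv: "\<And>t \<kappa>. a < t \<Longrightarrow> t \<le> b \<Longrightarrow> (\<And>n. \<kappa> n \<le> n) \<Longrightarrow> (\<And>n. grid a b n (\<kappa> n) < t) \<Longrightarrow>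
        (\<And>n. t \<le> grid a b n (Suc (\<kappa> n))) \<Longrightarrow> (\<lambda>n. v n (\<kappa> n)) \<longlonglongrightarrow> F t"
  shows "set_integrable N {a<..b} F"
    and "(\<lambda>n. \<Sum>k\<le>n. measure N {grid a b n k<..grid a b n (Suc k)} *\<^sub>R v n k) \<longlonglongrightarrow> (LINT t:{a<..b}|N. F t)"
proof -
  note [measurable_cong] = N(1)
  define g where "g n t = (\<Sum>k\<le>n. indicator {grid a b n k<..grid a b n (Suc k)} t *\<^sub>R v n k)" for n t
  have [measurable]: "g n \<in> borel_measurable N" for n unfolding g_def by measurable
  have cell: "{grid a b n k<..grid a b n (Suc k)} \<subseteq> {a<..b}" if "k \<le> n" for n k
    using grid_mono[of a b 0 k n] grid_mono[of a b "Suc k" "Suc n" n] ab that by auto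
  have g_in: "g n t = v n k" if "k \<le> n" "grid a b n k < t" "t \<le> grid a b n (Suc k)" for n t k
  proof -
    have "g n t = (\<Sum>l\<le>n. if l = k then v n k else 0)"
      unfolding g_def
    proof (intro sum.cong refl)
      fix l
      have lk: "l = k" if "t \<in> {grid a b n l<..grid a b n (Suc l)}"
        using that ab \<open>grid a b n k < t\<close> \<open>t \<le> grid a b n (Suc k)\<close> by (intro grid_cell_unique[of a b n l t k]) auto
      show "indicator {grid a b n l<..grid a b n (Suc l)} t *\<^sub>R v n l = (if l = k then v n k else 0)"
      proof (cases "l = k")
        case True
        have "t \<in> {grid a b n k<..grid a b n (Suc k)}"
          using \<open>grid a b n k < t\<close> \<open>t \<le> grid a b n (Suc k)\<close> by simp
        then show ?thesis unfolding True by simp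
      next
        case False
        then have "t \<notin> {grid a b n l<..grid a b n (Suc l)}" using lk by blast
        then show ?thesis using False by simp
      qed
    qed
    then show ?thesis using that(1) by simp
  qed
  have g_out: "g n t = 0" if "t \<notin> {a<..b}" for n t
    unfolding g_def
  proof (intro sum.neutral ballI)
    fix k assume "k \<in> {..n}"
    then have "t \<notin> {grid a b n k<..grid a b n (Suc k)}" using cell[of k n] that by blast
    then show "indicator {grid a b n k<..grid a b n (Suc k)} t *\<^sub>R v n k = 0" by simp
  qed
  have B: "0 \<le> B" using order_trans[OF norm_ge_zero bound[of m 0]] by simp
  \<comment> \<open>The sequence is shifted by m because the bound on v starts at that
    index.\<close>
  have lim: "(\<lambda>n. g (n + m) t) \<longlonglongrightarrow> indicator {a<..b} t *\<^sub>R F t" for t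
  proof (cases "t \<in> {a<..b}")
    case True
    then have "\<forall>n. \<exists>k. k \<le> n \<and> grid a b n k < t \<and> t \<le> grid a b n (Suc k)"
      using grid_cell_exists[of a t b] by (metis greaterThanAtMost_iff)
    then obtain \<kappa> where \<kappa>: "\<And>n. \<kappa> n \<le> n" "\<And>n. grid a b n (\<kappa> n) < t" "\<And>n. t \<le> grid a b n (Suc (\<kappa> n))" by metis
    have "(\<lambda>n. v n (\<kappa> n)) \<longlonglongrightarrow> F t" using True \<kappa> by (intro conv) auto
    moreover have "g n t = v n (\<kappa> n)" for n by (rule g_in[OF \<kappa>])
    ultimately have "(\<lambda>n. g n t) \<longlonglongrightarrow> F t" by simp
    from LIMSEQ_ignore_initial_segment[OF this, of m] show ?thesis using True by simp
  qed (simp add: g_out)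
  have Fm [measurable]: "(\<lambda>t. indicator {a<..b} t *\<^sub>R F t) \<in> borel_measurable N"
    by (rule borel_measurable_LIMSEQ_metric[OF _ lim]) measurable
  have dom: "integrable N (\<lambda>t. B * indicator {a<..b} t)"
    using N by (intro integrable_mult_right) (simp add: integrable_indicator_iff)
  have gb: "norm (g (n + m) t) \<le> B * indicator {a<..b} t" for n t
  proof (cases "t \<in> {a<..b}")
    case True
    then obtain k where k: "k \<le> n + m" "grid a b (n + m) k < t" "t \<le> grid a b (n + m) (Suc k)"
      using grid_cell_exists[of a t b "n + m"] by auto
    show ?thesis using True bound[of "n + m" k] k by (simp add: g_in[OF k])
  qed (simp add: g_out)
  show "set_integrable N {a<..b} F"
    unfolding set_integrable_def
    by (rule integrable_dominated_convergence[where s = "\<lambda>n. g (n + m)", OF Fm _ dom]) (use lim gb in auto)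
  have "(\<lambda>n. integral\<^sup>L N (g (n + m))) \<longlonglongrightarrow> (LINT t:{a<..b}|N. F t)"
    unfolding set_lebesgue_integral_def
    by (rule integral_dominated_convergence[OF Fm _ dom]) (use lim gb in auto)
  then have "(\<lambda>n. integral\<^sup>L N (g n)) \<longlonglongrightarrow> (LINT t:{a<..b}|N. F t)"
    by (rule LIMSEQ_offset)
  moreover have "integral\<^sup>L N (g n) = (\<Sum>k\<le>n. measure N {grid a b n k<..grid a b n (Suc k)} *\<^sub>R v n k)" for n
  proof -
    have fin: "emeasure N {grid a b n k<..grid a b n (Suc k)} < \<infinity>" if "k \<le> n" for k
      using emeasure_mono[OF cell[OF that], of N] N by (auto intro: le_less_trans)
    have "integral\<^sup>L N (g n) = (\<Sum>k\<le>n. LINT t|N. indicator {grid a b n k<..grid a b n (Suc k)} t *\<^sub>R v n k)"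
      unfolding g_def using fin N(1)
      by (intro Bochner_Integration.integral_sum integrable_scaleR_left) (auto simp: integrable_indicator_iff)
    also have "\<dots> = (\<Sum>k\<le>n. measure N {grid a b n k<..grid a b n (Suc k)} *\<^sub>R v n k)"
      using fin N(1) by (intro sum.cong refl) (subst integral_scaleR_left, auto simp: integrable_indicator_iff sets_eq_imp_space_eq[OF N(1)])
    finally show ?thesis .
  qed
  ultimately show "(\<lambda>n. \<Sum>k\<le>n. measure N {grid a b n k<..grid a b n (Suc k)} *\<^sub>R v n k) \<longlonglongrightarrow> (LINT t:{a<..b}|N. F t)"
    by simp
qed

text \<open>Bisection leaves a neighbourhood of one point x, where the left limit controls the
  values before x and right continuity those after it. The left limit exists because x >= p >
  0.\<close>

lemma cadlag_bounded:
  fixes y :: "real \<Rightarrow> 'a::real_normed_vector"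
  assumes y: "cadlag y" and p: "0 < p" "p \<le> q"
  shows "bounded (y ` {p..q})"
  using p(2)
proof (rule Bolzano)
  fix a b c assume "bounded (y ` {a..b})" "bounded (y ` {b..c})" "a \<le> b" "b \<le> c"
  then show "bounded (y ` {a..c})"
    by (metis bounded_Un image_Un ivl_disj_un_two_touch(4))
next
  fix x assume x: "p \<le> x" "x \<le> q"
  then have "0 < x" using p by simp
  then obtain l where l: "(y \<longlongrightarrow> l) (at_left x)" and r: "(y \<longlongrightarrow> y x) (at_right x)"
    using y by (auto simp: cadlag_def continuous_within)
  obtain d1 where d1: "d1 < x" "\<And>s. d1 < s \<Longrightarrow> s < x \<Longrightarrow> dist (y s) l < 1"
    using tendstoD[OF l, of 1] by (auto simp: eventually_at_left_field)
  obtain d2 where d2: "x < d2" "\<And>s. x < s \<Longrightarrow> s < d2 \<Longrightarrow> dist (y s) (y x) < 1"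
    using tendstoD[OF r, of 1] by (auto simp: eventually_at_right_field)
  have "bounded (y ` {a..b})" if "a \<le> x" "x \<le> b" "b - a < min (x - d1) (d2 - x)" for a b
  proof (rule bounded_subset)
    show "bounded (ball l 1 \<union> ball (y x) 1)" by simp
    show "y ` {a..b} \<subseteq> ball l 1 \<union> ball (y x) 1"
    proof (rule image_subsetI)
      fix s assume s: "s \<in> {a..b}"
      show "y s \<in> ball l 1 \<union> ball (y x) 1"
        using that s d1(2)[of s] d2(2)[of s] by (cases s x rule: linorder_cases) (auto simp: dist_commute)
    qed
  qed
  then show "\<exists>d>0. \<forall>a b. a \<le> x \<and> x \<le> b \<and> b - a < d \<longrightarrow> bounded (y ` {a..b})"
    using d1(1) d2(1) by (intro exI[of _ "min (x - d1) (d2 - x)"]) auto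
qed

section \<open>Monotonicity and continuity of the clock\<close>

lemma measure_beta_measure_Ioc:
  assumes "\<beta> < \<alpha>" "0 < s" "s \<le> t"
  shows "measure (beta_measure \<beta> \<alpha>) {s<..t} = beta_clock \<beta> \<alpha> s - beta_clock \<beta> \<alpha> t"
proof -
  have "measure (beta_measure \<beta> \<alpha>) {s<..t} = (LINT x|beta_measure \<beta> \<alpha>. indicator {s<..t} x)" by simp
  also have "\<dots> = (LINT x|lborel. beta_density \<beta> \<alpha> x *\<^sub>R indicator {s<..t} x)"
    using assms(1) by (rule integral_beta_measure) simp
  also have "\<dots> = (LINT x:{s<..t}|lborel. beta_density \<beta> \<alpha> x)"
    by (simp add: set_lebesgue_integral_def mult.commute)
  finally show ?thesis by (simp add: beta_clock_diff[OF assms])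
qed

lemma emeasure_beta_measure_Ioc_finite:
  assumes "\<beta> < \<alpha>" "0 < s"
  shows "emeasure (beta_measure \<beta> \<alpha>) {s<..t} < \<infinity>"
proof (rule le_less_trans)
  show "emeasure (beta_measure \<beta> \<alpha>) {s<..t} \<le> emeasure (beta_measure \<beta> \<alpha>) {s<..}"
    by (rule emeasure_mono) auto
qed (rule emeasure_beta_measure_finite[OF assms])

lemma beta_clock_antimono:
  assumes "\<beta> < \<alpha>" "0 < s" "s \<le> t"
  shows "beta_clock \<beta> \<alpha> t \<le> beta_clock \<beta> \<alpha> s"
  using measure_beta_measure_Ioc[OF assms] measure_nonneg[of "beta_measure \<beta> \<alpha>" "{s<..t}"] by simp

text \<open>The density is positive on (s, t], so zero mass would make this interval a Lebesgue null
  set. From 1 on the clock is constantly 0, whence the bound on t.\<close>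

lemma beta_clock_strict_antimono:
  assumes ab: "\<beta> < \<alpha>" and st: "0 < s" "s < t" "t < 1"
  shows "beta_clock \<beta> \<alpha> t < beta_clock \<beta> \<alpha> s"
proof (rule ccontr)
  assume "\<not> ?thesis"
  then have "measure (beta_measure \<beta> \<alpha>) {s<..t} \<le> 0"
    using measure_beta_measure_Ioc[OF ab, of s t] st by simp
  then have "emeasure (beta_measure \<beta> \<alpha>) {s<..t} = 0"
    using emeasure_beta_measure_Ioc_finite[OF ab st(1), of t] measure_nonneg[of "beta_measure \<beta> \<alpha>" "{s<..t}"]
    by (simp add: emeasure_eq_ennreal_measure)
  then have "(\<integral>\<^sup>+x. ennreal (beta_density \<beta> \<alpha> x) * indicator {s<..t} x \<partial>lborel) = 0"
    unfolding beta_measure_def by (subst (asm) emeasure_density) auto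
  then have "AE x in lborel. ennreal (beta_density \<beta> \<alpha> x) * indicator {s<..t} x = 0"
    by (subst (asm) nn_integral_0_iff_AE) auto
  then have "AE x in lborel. x \<notin> {s<..t}"
  proof eventually_elim
    case (elim x)
    show ?case
    proof
      assume x: "x \<in> {s<..t}"
      then have "0 < beta_density \<beta> \<alpha> x" using ab st by (intro beta_density_pos) auto
      then show False using elim x by simp
    qed
  qed
  then have "{s<..t} \<in> null_sets lborel" using AE_iff_null_sets[of "{s<..t}" lborel] by simp
  then show False using st by (simp add: null_sets_def)
qed

lemma beta_clock_nonneg: "\<beta> < \<alpha> \<Longrightarrow> 0 < t \<Longrightarrow> 0 \<le> beta_clock \<beta> \<alpha> t"
  using beta_density_nonneg[of \<beta> \<alpha>] by (auto simp: beta_clock_eq_integral set_lebesgue_integral_def intro!: integral_nonneg)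

lemma beta_clock_pos:
  assumes "\<beta> < \<alpha>" "0 < t" "t < 1"
  shows "0 < beta_clock \<beta> \<alpha> t"
proof -
  have "beta_clock \<beta> \<alpha> ((t + 1) / 2) < beta_clock \<beta> \<alpha> t"
    using assms by (intro beta_clock_strict_antimono) auto
  moreover have "0 \<le> beta_clock \<beta> \<alpha> ((t + 1) / 2)" using assms by (intro beta_clock_nonneg) auto
  ultimately show ?thesis by simp
qed

lemma beta_clock_tendsto_from_right:
  assumes ab: "\<beta> < \<alpha>" and t: "0 < t" and s: "\<And>n. t \<le> s n" "s \<longlonglongrightarrow> t"
  shows "(\<lambda>n. beta_clock \<beta> \<alpha> (s n)) \<longlonglongrightarrow> beta_clock \<beta> \<alpha> t"
proof -
  have int: "integrable (beta_measure \<beta> \<alpha>) (indicator {t<..} :: real \<Rightarrow> real)"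
    using emeasure_beta_measure_finite[OF ab t] by (simp add: integrable_indicator_iff)
  have "(\<lambda>n. LINT x|beta_measure \<beta> \<alpha>. indicator {t<..s n} x) \<longlonglongrightarrow> (LINT x|beta_measure \<beta> \<alpha>. 0::real)"
  proof (rule integral_dominated_convergence[OF _ _ int])
    show "AE x in beta_measure \<beta> \<alpha>. (\<lambda>n. indicator {t<..s n} x) \<longlonglongrightarrow> (0::real)"
    proof (rule AE_I2)
      fix x
      show "(\<lambda>n. indicator {t<..s n} x) \<longlonglongrightarrow> (0::real)"
      proof (cases "t < x")
        case True
        have "eventually (\<lambda>n. s n < x) sequentially" using s(2) True by (rule order_tendstoD)
        then have "eventually (\<lambda>n. indicator {t<..s n} x = (0::real)) sequentially"
          by eventually_elim simp
        then show ?thesis by (rule tendsto_eventually)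
      qed simp
    qed
  qed (auto intro!: AE_I2 simp: indicator_def)
  then have "(\<lambda>n. beta_clock \<beta> \<alpha> t - beta_clock \<beta> \<alpha> (s n)) \<longlonglongrightarrow> 0"
    by (simp add: measure_beta_measure_Ioc[OF ab t s(1)])
  from tendsto_diff[OF tendsto_const[of "beta_clock \<beta> \<alpha> t"] this] show ?thesis by simp
qed

lemma grid_in_cell_tendsto:
  assumes ab: "a < b" and \<kappa>: "\<And>n. grid a b n (\<kappa> n) < t" "\<And>n. t \<le> grid a b n (Suc (\<kappa> n))"
  shows "(\<lambda>n. grid a b n (\<kappa> n)) \<longlonglongrightarrow> t" "(\<lambda>n. grid a b n (Suc (Suc (\<kappa> n)))) \<longlonglongrightarrow> t"
    "\<And>n. t < grid a b n (Suc (Suc (\<kappa> n)))"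
proof -
  have d: "0 < (b - a) / real (Suc n)" for n using ab by simp
  show "(\<lambda>n. grid a b n (\<kappa> n)) \<longlonglongrightarrow> t"
  proof (rule tendsto_sandwich[OF always_eventually always_eventually])
    show "(\<lambda>n. t - (b - a) / real (Suc n)) \<longlonglongrightarrow> t"
      using tendsto_diff[OF tendsto_const[of t] tendsto_grid_mesh[of "b - a"]] by simp
    show "\<forall>n. t - (b - a) / real (Suc n) \<le> grid a b n (\<kappa> n)"
      using \<kappa>(2) unfolding grid_Suc by (simp add: algebra_simps del: of_nat_Suc)
    show "\<forall>n. grid a b n (\<kappa> n) \<le> t" using \<kappa>(1) less_imp_le by blast
  qed simp
  have "grid a b n (Suc (Suc (\<kappa> n))) = grid a b n (\<kappa> n) + 2 * (b - a) / real (Suc n)" for n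
    unfolding grid_Suc by simp
  then show "(\<lambda>n. grid a b n (Suc (Suc (\<kappa> n)))) \<longlonglongrightarrow> t"
    using tendsto_add[OF \<open>(\<lambda>n. grid a b n (\<kappa> n)) \<longlonglongrightarrow> t\<close> tendsto_grid_mesh[of "2 * (b - a)"]] by simp
  show "t < grid a b n (Suc (Suc (\<kappa> n)))" for n
    using \<kappa>(2)[of n] d[of n] by (subst grid_Suc) linarith
qed

lemma antimono_on_beta_clock:
  "\<beta> < \<alpha> \<Longrightarrow> 0 < a \<Longrightarrow> antimono_on {a..b} (beta_clock \<beta> \<alpha>)"
  by (auto intro!: monotone_onI beta_clock_antimono)

text \<open>The point with index n + 2 lies one mesh width beyond b; for large n it still stays
  below any prescribed c > b.\<close>

lemma eventually_grid_below:
  assumes "a \<le> b" "b < c"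
  obtains n0 where "\<And>n k. n0 \<le> n \<Longrightarrow> k \<le> Suc (Suc n) \<Longrightarrow> grid a b n k \<le> c"
proof -
  have "(\<lambda>n. b + (b - a) / real (Suc n)) \<longlonglongrightarrow> b"
    using tendsto_add[OF tendsto_const[of b] tendsto_grid_mesh[of "b - a"]] by simp
  then have "eventually (\<lambda>n. b + (b - a) / real (Suc n) < c) sequentially"
    using assms(2) by (rule order_tendstoD)
  then obtain n0 where n0: "\<And>n. n0 \<le> n \<Longrightarrow> b + (b - a) / real (Suc n) < c"
    by (auto simp: eventually_sequentially)
  have "grid a b n k \<le> c" if "n0 \<le> n" "k \<le> Suc (Suc n)" for n k
    using grid_mono[OF assms(1) that(2), of n] n0[OF that(1)] unfolding grid_Suc[of _ _ _ "Suc n"] grid_last by simp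
  then show thesis by (rule that)
qed

text \<open>
  On the cell \<open>(p\<^sub>k, p\<^sub>k\<^sub>+\<^sub>1]\<close> the path is evaluated at \<open>p\<^sub>k\<^sub>+\<^sub>2\<close>: this point lies strictly to the right of the
  cell and the clock is strictly decreasing, so the values converge to the left limit of the path,
  also at grid points.
\<close>

lemma stieltjes_integral_clock_path:
  fixes y :: "real \<Rightarrow> 'a::{banach, second_countable_topology}"
  assumes y: "cadlag y" and ab: "\<beta> < \<alpha>" and a: "0 < a" "a < b" "b < 1"
  shows "(\<lambda>n. \<Sum>k\<le>n. ((b - a) / real (Suc n)) *\<^sub>R y (beta_clock \<beta> \<alpha> (grid a b n (Suc (Suc k)))))
     \<longlonglongrightarrow> stieltjes_integral (\<lambda>t. left_limit y (beta_clock \<beta> \<alpha> t)) (\<lambda>t. t) a b"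
    and "\<exists>B n0. \<forall>n\<ge>n0. \<forall>k\<le>Suc (Suc n). norm (y (beta_clock \<beta> \<alpha> (grid a b n k))) \<le> B"
proof -
  let ?r = "beta_clock \<beta> \<alpha>"
  \<comment> \<open>A point strictly between b and 1 leaves room for the grid point after b while
    the clock is still positive and strictly decreasing.\<close>
  define c where "c = (1 + b) / 2"
  have c: "b < c" "c < 1" "0 < c" using a by (auto simp: c_def)
  obtain n0 where n0: "\<And>n k. n0 \<le> n \<Longrightarrow> k \<le> Suc (Suc n) \<Longrightarrow> grid a b n k \<le> c"
    using eventually_grid_below[of a b c] a c by auto
  have ga: "a \<le> grid a b n k" for n k using grid_mono[of a b 0 k n] a by simp
  have "bounded (y ` {?r c..?r a})"
    using y beta_clock_pos[OF ab c(3,2)] beta_clock_antimono[OF ab a(1), of c] a c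
    by (intro cadlag_bounded) auto
  then obtain B where B: "\<forall>z\<in>y ` {?r c..?r a}. norm z \<le> B" unfolding bounded_iff by (rule exE)
  have bd: "norm (y (?r (grid a b n k))) \<le> B" if "n0 \<le> n" "k \<le> Suc (Suc n)" for n k
  proof -
    have "?r (grid a b n k) \<in> {?r c..?r a}"
      using beta_clock_antimono[OF ab a(1) ga[of n k]] beta_clock_antimono[OF ab, of "grid a b n k" c] n0[OF that] ga[of n k] a(1)
      by auto
    with B show ?thesis by (rule bspec[OF _ imageI])
  qed
  then show "\<exists>B n0. \<forall>n\<ge>n0. \<forall>k\<le>Suc (Suc n). norm (y (?r (grid a b n k))) \<le> B" by blast
  let ?v = "\<lambda>n k. y (?r (grid a b n (Suc (Suc k))))"
  let ?F = "\<lambda>t. left_limit y (?r t)"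
  have conv: "(\<lambda>n. ?v n (\<kappa> n)) \<longlonglongrightarrow> ?F t"
    if t: "a < t" "t \<le> b" and \<kappa>: "\<And>n. \<kappa> n \<le> n" "\<And>n. grid a b n (\<kappa> n) < t" "\<And>n. t \<le> grid a b n (Suc (\<kappa> n))" for t \<kappa>
  proof -
    have rt: "0 < ?r t" using t a by (intro beta_clock_pos[OF ab]) auto
    let ?s = "\<lambda>n. grid a b n (Suc (Suc (\<kappa> n)))"
    note s = grid_in_cell_tendsto(2,3)[OF a(2) \<kappa>(2,3)]
    have "(\<lambda>n. ?r (?s n)) \<longlonglongrightarrow> ?r t"
      using t a s by (intro beta_clock_tendsto_from_right[OF ab]) (auto intro: less_imp_le)
    moreover have "eventually (\<lambda>n. ?r (?s n) < ?r t) sequentially"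
      using eventually_ge_at_top[of n0]
    proof eventually_elim
      case (elim n)
      have "?s n \<le> c" using elim \<kappa>(1)[of n] by (intro n0) auto
      then show ?case using t a c s(2)[of n] by (intro beta_clock_strict_antimono[OF ab]) auto
    qed
    then have "eventually (\<lambda>n. ?r (?s n) \<in> {..<?r t} \<and> ?r (?s n) \<noteq> ?r t) sequentially"
      by eventually_elim auto
    ultimately have lim: "filterlim (\<lambda>n. ?r (?s n)) (at_left (?r t)) sequentially"
      unfolding filterlim_at by blast
    obtain l where l: "(y \<longlongrightarrow> l) (at_left (?r t))" using y rt by (auto simp: cadlag_def)
    then have "left_limit y (?r t) = l"
      using rt by (simp add: left_limit_def tendsto_Lim)
    then show ?thesis using filterlim_compose[OF l lim] by simp
  qed
  \<comment> \<open>Needed for every nondecreasing right-continuous h, because the Stieltjes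
    integral may be witnessed by any decomposition h1 - h2.\<close>
  have step: "set_integrable (interval_measure h) {a<..b} ?F"
    "(\<lambda>n. \<Sum>k\<le>n. (h (grid a b n (Suc k)) - h (grid a b n k)) *\<^sub>R ?v n k) \<longlonglongrightarrow> (LINT t:{a<..b}|interval_measure h. ?F t)"
    if h: "mono h" "\<And>t. continuous (at_right t) h" for h
  proof -
    have h': "\<And>x y. x \<le> y \<Longrightarrow> h x \<le> h y" using h(1) by (rule monoD)
    have fin: "emeasure (interval_measure h) {a<..b} < \<infinity>"
      using emeasure_interval_measure_Ioc[OF less_imp_le[OF a(2)] h' h(2)] by simp
    have bd': "norm (?v n k) \<le> B" if "n0 \<le> n" "k \<le> n" for n k
      using that by (intro bd) auto
    note st = grid_step_integral_tendsto[where N = "interval_measure h" and v = ?v and F = ?F and B = B and m = n0,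
        OF sets_interval_measure fin a(2) bd' conv]
    show "set_integrable (interval_measure h) {a<..b} ?F" by (rule st(1))
    have m: "measure (interval_measure h) {grid a b n k<..grid a b n (Suc k)} = h (grid a b n (Suc k)) - h (grid a b n k)" for n k
      using a by (intro measure_interval_measure_Ioc h' h(2) grid_mono) auto
    show "(\<lambda>n. \<Sum>k\<le>n. (h (grid a b n (Suc k)) - h (grid a b n k)) *\<^sub>R ?v n k) \<longlonglongrightarrow> (LINT t:{a<..b}|interval_measure h. ?F t)"
      using st(2) unfolding m .
  qed
  let ?S = "\<lambda>n. \<Sum>k\<le>n. ((b - a) / real (Suc n)) *\<^sub>R ?v n k"
  \<comment> \<open>On each cell the increments of h1 and h2 differ by exactly the mesh, so every
    decomposition leads to the same sums \<open>?S\<close>. Their limit is unique, which makes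
    \<open>stieltjes_integral\<close> well defined here.\<close>
  have uniq: "?S \<longlonglongrightarrow> I" if I: "has_stieltjes_integral ?F (\<lambda>t. t) a b I" for I
  proof -
    obtain h1 h2 where h: "mono h1" "mono h2" "\<And>t. continuous (at_right t) h1" "\<And>t. continuous (at_right t) h2"
      "\<And>t. t \<in> {a..b} \<Longrightarrow> t = h1 t - h2 t"
      "I = (LINT t:{a<..b}|interval_measure h1. ?F t) - (LINT t:{a<..b}|interval_measure h2. ?F t)"
      using I unfolding has_stieltjes_integral_def by blast
    have "(\<lambda>n. (\<Sum>k\<le>n. (h1 (grid a b n (Suc k)) - h1 (grid a b n k)) *\<^sub>R ?v n k)
             - (\<Sum>k\<le>n. (h2 (grid a b n (Suc k)) - h2 (grid a b n k)) *\<^sub>R ?v n k)) \<longlonglongrightarrow> I"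
      unfolding h(6) by (intro tendsto_diff step h)
    moreover have "(\<Sum>k\<le>n. (h1 (grid a b n (Suc k)) - h1 (grid a b n k)) *\<^sub>R ?v n k)
             - (\<Sum>k\<le>n. (h2 (grid a b n (Suc k)) - h2 (grid a b n k)) *\<^sub>R ?v n k) = ?S n" for n
    proof -
      have "(h1 (grid a b n (Suc k)) - h1 (grid a b n k)) - (h2 (grid a b n (Suc k)) - h2 (grid a b n k)) = (b - a) / real (Suc n)"
        if "k \<le> n" for k
      proof -
        have "grid a b n k \<in> {a..b}" "grid a b n (Suc k) \<in> {a..b}"
          using ga grid_mono[of a b _ "Suc n" n] a that by auto
        from h(5)[OF this(1)] h(5)[OF this(2)] show ?thesis using grid_Suc[of a b n k] by linarith
      qed
      then show ?thesis
        unfolding sum_subtractf[symmetric] scaleR_diff_left[symmetric] by (intro sum.cong refl) simp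
    qed
    ultimately show ?thesis by simp
  qed
  define I0 where "I0 = (LINT t:{a<..b}|interval_measure (\<lambda>t. t). ?F t) - (LINT t:{a<..b}|interval_measure (\<lambda>t. 0). ?F t)"
  have I0: "has_stieltjes_integral ?F (\<lambda>t. t) a b I0"
    unfolding has_stieltjes_integral_def I0_def
    by (intro exI[of _ "\<lambda>t. t"] exI[of _ "\<lambda>t. 0"] conjI step) (auto intro: monoI continuous_intros)
  have ex: "has_stieltjes_integral ?F (\<lambda>t. t) a b (stieltjes_integral ?F (\<lambda>t. t) a b)"
    unfolding stieltjes_integral_def
  proof (rule theI)
    show "has_stieltjes_integral ?F (\<lambda>t. t) a b I0" by (rule I0)
    fix I assume "has_stieltjes_integral ?F (\<lambda>t. t) a b I"
    then show "I = I0" by (rule LIMSEQ_unique[OF uniq uniq[OF I0]])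
  qed
  show "?S \<longlonglongrightarrow> stieltjes_integral ?F (\<lambda>t. t) a b" by (rule uniq[OF ex])
qed

text \<open>Summation by parts, the discrete form of the defining formula. The clock decreases, so
  the path integral carries the reversed sign and the increments are taken from right to
  left.\<close>

lemma path_integral_tendsto:
  fixes y :: "real \<Rightarrow> 'a::{banach, second_countable_topology}"
  assumes y: "cadlag y" and ab: "\<beta> < \<alpha>" and a: "0 < a" "a < b" "b < 1"
  shows "(\<lambda>n. \<Sum>k\<le>n. grid a b n k *\<^sub>R (y (beta_clock \<beta> \<alpha> (grid a b n k)) - y (beta_clock \<beta> \<alpha> (grid a b n (Suc k)))))
     \<longlonglongrightarrow> path_integral (\<lambda>t. t) (beta_clock \<beta> \<alpha>) a b y"
proof -
  let ?r = "beta_clock \<beta> \<alpha>"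
  let ?z = "\<lambda>n k. y (?r (grid a b n k))" and ?d = "\<lambda>n. (b - a) / real (Suc n)"
  let ?I = "stieltjes_integral (\<lambda>t. left_limit y (?r t)) (\<lambda>t. t) a b"
  note S = stieltjes_integral_clock_path[OF y ab a]
  obtain B n0 where B: "\<And>n k. n0 \<le> n \<Longrightarrow> k \<le> Suc (Suc n) \<Longrightarrow> norm (?z n k) \<le> B" using S(2) by blast
  \<comment> \<open>Summation by parts evaluates the path at index k + 1, the Stieltjes sums at k +
    2. The shift telescopes to two bounded values times the mesh.\<close>
  have err: "(\<lambda>n. ?d n *\<^sub>R (?z n (Suc (Suc n)) - ?z n 1)) \<longlonglongrightarrow> 0"
  proof (rule Lim_null_comparison)
    show "eventually (\<lambda>n. norm (?d n *\<^sub>R (?z n (Suc (Suc n)) - ?z n 1)) \<le> (b - a) * (2 * B) / real (Suc n)) sequentially"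
      using eventually_ge_at_top[of n0]
    proof eventually_elim
      case (elim n)
      have "norm (?z n (Suc (Suc n)) - ?z n 1) \<le> 2 * B"
        using norm_triangle_ineq4[of "?z n (Suc (Suc n))" "?z n 1"] B[OF elim, of "Suc (Suc n)"] B[OF elim, of 1] by simp
      then have "?d n * norm (?z n (Suc (Suc n)) - ?z n 1) \<le> ?d n * (2 * B)"
        using a by (intro mult_left_mono) auto
      then show ?case using a by simp
    qed
  qed (rule tendsto_grid_mesh)
  have "(\<lambda>n. (a *\<^sub>R y (?r a) - b *\<^sub>R y (?r b)) + ((\<Sum>k\<le>n. ?d n *\<^sub>R ?z n (Suc (Suc k))) - ?d n *\<^sub>R (?z n (Suc (Suc n)) - ?z n 1)))
      \<longlonglongrightarrow> (a *\<^sub>R y (?r a) - b *\<^sub>R y (?r b)) + (?I - 0)"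
    by (intro tendsto_add tendsto_diff tendsto_const S(1) err)
  moreover have "(a *\<^sub>R y (?r a) - b *\<^sub>R y (?r b)) + ((\<Sum>k\<le>n. ?d n *\<^sub>R ?z n (Suc (Suc k))) - ?d n *\<^sub>R (?z n (Suc (Suc n)) - ?z n 1))
     = (\<Sum>k\<le>n. grid a b n k *\<^sub>R (?z n k - ?z n (Suc k)))" for n
  proof -
    have 1: "(\<Sum>k\<le>n. ?d n *\<^sub>R ?z n (Suc (Suc k))) = (\<Sum>k\<le>n. ?d n *\<^sub>R ?z n (Suc k)) + ?d n *\<^sub>R (?z n (Suc (Suc n)) - ?z n 1)"
    proof -
      have "(\<Sum>k\<le>n. ?z n (Suc (Suc k))) - (\<Sum>k\<le>n. ?z n (Suc k)) = ?z n (Suc (Suc n)) - ?z n 1"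
        using sum_lessThan_telescope[of "\<lambda>k. ?z n (Suc k)" "Suc n"] by (simp add: sum_subtractf lessThan_Suc_atMost)
      then have "(\<Sum>k\<le>n. ?z n (Suc (Suc k))) = (\<Sum>k\<le>n. ?z n (Suc k)) + (?z n (Suc (Suc n)) - ?z n 1)"
        by (simp only: diff_eq_eq add.commute)
      then show ?thesis by (simp only: scaleR_sum_right[symmetric] scaleR_add_right)
    qed
    have 2: "(\<Sum>k\<le>n. grid a b n (Suc k) *\<^sub>R ?z n (Suc k) - grid a b n k *\<^sub>R ?z n k) = b *\<^sub>R y (?r b) - a *\<^sub>R y (?r a)"
      using sum_lessThan_telescope[of "\<lambda>k. grid a b n k *\<^sub>R ?z n k" "Suc n"] by (simp only: lessThan_Suc_atMost grid_last grid_0)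
    have "(\<Sum>k\<le>n. grid a b n k *\<^sub>R (?z n k - ?z n (Suc k)))
        = (\<Sum>k\<le>n. ?d n *\<^sub>R ?z n (Suc k) - (grid a b n (Suc k) *\<^sub>R ?z n (Suc k) - grid a b n k *\<^sub>R ?z n k))"
    proof (rule sum.cong[OF refl])
      fix k
      have "grid a b n (Suc k) *\<^sub>R ?z n (Suc k) = grid a b n k *\<^sub>R ?z n (Suc k) + ?d n *\<^sub>R ?z n (Suc k)"
        by (simp only: grid_Suc[of a b n k] scaleR_add_left)
      then show "grid a b n k *\<^sub>R (?z n k - ?z n (Suc k)) = ?d n *\<^sub>R ?z n (Suc k) - (grid a b n (Suc k) *\<^sub>R ?z n (Suc k) - grid a b n k *\<^sub>R ?z n k)"
        by (simp only: scaleR_diff_right) simp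
    qed
    also have "\<dots> = (\<Sum>k\<le>n. ?d n *\<^sub>R ?z n (Suc k)) - (b *\<^sub>R y (?r b) - a *\<^sub>R y (?r a))"
      by (simp only: sum_subtractf[of "\<lambda>k. ?d n *\<^sub>R ?z n (Suc k)"] 2)
    finally show ?thesis unfolding 1 by simp
  qed
  moreover have "path_integral (\<lambda>t. t) ?r a b y = (a *\<^sub>R y (?r a) - b *\<^sub>R y (?r b)) + (?I - 0)"
    using antimono_on_beta_clock[OF ab a(1)] by (simp add: path_integral_def Let_def)
  ultimately show ?thesis by simp
qed

section \<open>Characteristic functions of proper path integrals\<close>

text \<open>The exponent at u of the integral over (a, b]. The upper end is kept, because the
  improper integral is a joint limit in a and b.\<close>

definition band_integral :: "real \<Rightarrow> real \<Rightarrow> (real \<Rightarrow> complex) \<Rightarrow> real \<Rightarrow> real \<Rightarrow> real \<Rightarrow> complex" where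
  "band_integral \<beta> \<alpha> \<psi> a b u = (CLINT t:{a<..b}|beta_measure \<beta> \<alpha>. \<psi> (t * u))"

text \<open>The path integral is given by a definite description for each path, so measurability
  comes from the approximating grid sums.\<close>

lemma path_integral_measurable:
  assumes levy: "levy_process M Y \<nu>" and ab: "\<beta> < \<alpha>" and a: "0 < a" "a < b" "b < 1"
  shows "(\<lambda>\<omega>. path_integral (\<lambda>t. t) (beta_clock \<beta> \<alpha>) a b (\<lambda>t. Y t \<omega>)) \<in> borel_measurable M"
proof (rule borel_measurable_LIMSEQ_metric)
  note L = levy_processD[OF levy]
  fix \<omega> assume "\<omega> \<in> space M"
  then show "(\<lambda>n. \<Sum>k\<le>n. grid a b n k *\<^sub>R (Y (beta_clock \<beta> \<alpha> (grid a b n k)) \<omega> - Y (beta_clock \<beta> \<alpha> (grid a b n (Suc k))) \<omega>))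
     \<longlonglongrightarrow> path_integral (\<lambda>t. t) (beta_clock \<beta> \<alpha>) a b (\<lambda>t. Y t \<omega>)"
    by (intro path_integral_tendsto[OF L(4) ab a])
next
  fix n
  have "0 < grid a b n k" for k using grid_mono[of a b 0 k n] a by simp
  then have [measurable]: "Y (beta_clock \<beta> \<alpha> (grid a b n k)) \<in> borel_measurable M" for k
    by (intro levy_processD(2)[OF levy] beta_clock_nonneg ab)
  show "(\<lambda>\<omega>. \<Sum>k\<le>n. grid a b n k *\<^sub>R (Y (beta_clock \<beta> \<alpha> (grid a b n k)) \<omega> - Y (beta_clock \<beta> \<alpha> (grid a b n (Suc k))) \<omega>)) \<in> borel_measurable M"
    by measurable
qed

lemma sum_atMost_reverse: "(\<Sum>k\<le>n. g k) = (\<Sum>i<Suc n. g (n - i))" for g :: "nat \<Rightarrow> 'b::comm_monoid_add"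
  using sum.nat_diff_reindex[of g "Suc n"] by (simp add: lessThan_Suc_atMost)

text \<open>The increments between successive clock values are independent, and the time they span
  is the clock measure of the cell; the exponent is thus a Riemann sum for the band
  integral.\<close>

lemma char_grid_sum:
  fixes f :: "'a::{banach, second_countable_topology} \<Rightarrow> real"
  assumes levy: "levy_process M Y \<nu>" and f: "bounded_linear f" and \<psi>: "char_exponent (distr \<nu> borel f) \<psi>"
    and ab: "\<beta> < \<alpha>" and a: "0 < a" "a < b" "b < 1"
  shows "char (distr M borel (\<lambda>\<omega>. \<Sum>k\<le>n. grid a b n k * f (Y (beta_clock \<beta> \<alpha> (grid a b n k)) \<omega> - Y (beta_clock \<beta> \<alpha> (grid a b n (Suc k))) \<omega>))) u
    = exp (\<Sum>k\<le>n. measure (beta_measure \<beta> \<alpha>) {grid a b n k<..grid a b n (Suc k)} *\<^sub>R \<psi> (grid a b n k * u))"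
proof -
  obtain \<psi>' where \<psi>': "char_exponent (distr \<nu> borel f) \<psi>'"
    "\<And>t u. 0 \<le> t \<Longrightarrow> char (distr M borel (\<lambda>\<omega>. f (Y t \<omega>))) u = exp (of_real t * \<psi>' u)"
    using levy_process_exponent[OF levy f] by metis
  have "\<psi>' = \<psi>" using \<psi>'(1) \<psi> by (rule char_exponent_unique)
  note ch = \<psi>'(2)[unfolded this]
  let ?r = "beta_clock \<beta> \<alpha>"
  \<comment> \<open>the clock is decreasing, so time runs through the grid backwards\<close>
  define \<tau> where "\<tau> i = ?r (grid a b n (Suc n - i))" for i
  have ga: "a \<le> grid a b n k" for k using grid_mono[of a b 0 k n] a by simp
  then have g0: "0 < grid a b n k" for k using a(1) by (rule less_le_trans[rotated])
  have mono: "mono \<tau>"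
    unfolding \<tau>_def using a by (intro monoI beta_clock_antimono[OF ab g0] grid_mono) auto
  have \<tau>0: "0 \<le> \<tau> 0" unfolding \<tau>_def by (rule beta_clock_nonneg[OF ab g0])
  have \<tau>n: "\<tau> (Suc i) = ?r (grid a b n (n - i))" "\<tau> i = ?r (grid a b n (Suc (n - i)))" if "i < Suc n" for i
    using that by (simp_all add: \<tau>_def Suc_diff_le)
  have "(\<Sum>k\<le>n. grid a b n k * f (Y (?r (grid a b n k)) \<omega> - Y (?r (grid a b n (Suc k))) \<omega>))
      = (\<Sum>i<Suc n. grid a b n (n - i) * f (Y (\<tau> (Suc i)) \<omega> - Y (\<tau> i) \<omega>))" for \<omega>
    unfolding sum_atMost_reverse by (intro sum.cong refl) (simp add: \<tau>n)
  then have "char (distr M borel (\<lambda>\<omega>. \<Sum>k\<le>n. grid a b n k * f (Y (?r (grid a b n k)) \<omega> - Y (?r (grid a b n (Suc k))) \<omega>))) u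
      = char (distr M borel (\<lambda>\<omega>. \<Sum>i<Suc n. grid a b n (n - i) * f (Y (\<tau> (Suc i)) \<omega> - Y (\<tau> i) \<omega>))) u"
    by simp
  also have "\<dots> = (\<Prod>i<Suc n. char (distr M borel (\<lambda>\<omega>. f (Y (\<tau> (Suc i) - \<tau> i) \<omega>))) (u * grid a b n (n - i)))"
    by (rule char_levy_increments[OF levy f \<tau>0 mono])
  also have "\<dots> = (\<Prod>i<Suc n. exp (of_real (\<tau> (Suc i) - \<tau> i) * \<psi> (u * grid a b n (n - i))))"
    using mono by (intro prod.cong refl ch) (simp add: monoD)
  also have "\<dots> = exp (\<Sum>i<Suc n. of_real (\<tau> (Suc i) - \<tau> i) * \<psi> (u * grid a b n (n - i)))"
    by (rule exp_sum[symmetric]) simp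
  also have "(\<Sum>i<Suc n. of_real (\<tau> (Suc i) - \<tau> i) * \<psi> (u * grid a b n (n - i)))
      = (\<Sum>k\<le>n. measure (beta_measure \<beta> \<alpha>) {grid a b n k<..grid a b n (Suc k)} *\<^sub>R \<psi> (grid a b n k * u))"
    unfolding sum_atMost_reverse
  proof (intro sum.cong refl)
    fix i assume "i \<in> {..<Suc n}"
    then have "\<tau> (Suc i) - \<tau> i = measure (beta_measure \<beta> \<alpha>) {grid a b n (n - i)<..grid a b n (Suc (n - i))}"
      using a by (subst measure_beta_measure_Ioc[OF ab g0 grid_mono]) (auto simp: \<tau>n)
    then show "of_real (\<tau> (Suc i) - \<tau> i) * \<psi> (u * grid a b n (n - i))
      = measure (beta_measure \<beta> \<alpha>) {grid a b n (n - i)<..grid a b n (Suc (n - i))} *\<^sub>R \<psi> (grid a b n (n - i) * u)"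
      by (simp only: scaleR_conv_of_real mult.commute[of u])
  qed
  finally show ?thesis .
qed

lemma continuous_bounded_on_interval:
  fixes \<psi> :: "real \<Rightarrow> complex"
  assumes "continuous_on UNIV \<psi>"
  obtains C where "\<And>x. \<bar>x\<bar> \<le> R \<Longrightarrow> norm (\<psi> x) \<le> C"
proof -
  have "compact (\<psi> ` {-R..R})"
    by (intro compact_continuous_image continuous_on_subset[OF assms]) auto
  then have "bounded (\<psi> ` {-R..R})" by (rule compact_imp_bounded)
  then obtain C where C: "\<forall>y\<in>\<psi> ` {-R..R}. norm y \<le> C" unfolding bounded_iff by (rule exE)
  show thesis
  proof (rule that)
    fix x assume "\<bar>x\<bar> \<le> R"
    then have "x \<in> {-R..R}" by auto
    with C show "norm (\<psi> x) \<le> C" by (rule bspec[OF _ imageI])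
  qed
qed

text \<open>Both sides are limits along the same grids: on the left characteristic functions
  converge by domination by 1, on the right the Riemann sums of the exponent converge.\<close>

lemma char_path_integral:
  fixes f :: "'a::{banach, second_countable_topology} \<Rightarrow> real"
  assumes levy: "levy_process M Y \<nu>" and f: "bounded_linear f" and \<psi>: "char_exponent (distr \<nu> borel f) \<psi>"
    and ab: "\<beta> < \<alpha>" and a: "0 < a" "a < b" "b < 1"
  shows "(CLINT \<omega>|M. iexp (u * f (path_integral (\<lambda>t. t) (beta_clock \<beta> \<alpha>) a b (\<lambda>t. Y t \<omega>))))
    = exp (band_integral \<beta> \<alpha> \<psi> a b u)"
proof -
  note L = levy_processD[OF levy]
  interpret prob_space M by (rule L(1))
  interpret f: bounded_linear f by fact
  have [measurable]: "f \<in> borel_measurable borel"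
    using f by (rule bounded_linear_borel_measurable)
  have cont: "continuous_on UNIV \<psi>" using \<psi> by (simp add: char_exponent_def)
  let ?r = "beta_clock \<beta> \<alpha>"
  let ?P = "\<lambda>\<omega>. path_integral (\<lambda>t. t) ?r a b (\<lambda>t. Y t \<omega>)"
  let ?S = "\<lambda>n \<omega>. \<Sum>k\<le>n. grid a b n k * f (Y (?r (grid a b n k)) \<omega> - Y (?r (grid a b n (Suc k))) \<omega>)"
  have [measurable]: "?P \<in> borel_measurable M" by (rule path_integral_measurable[OF levy ab a])
  have ga: "a \<le> grid a b n k" for n k using grid_mono[of a b 0 k n] a by simp
  then have g0: "0 < grid a b n k" for n k using a(1) by (rule less_le_trans[rotated])
  have [measurable]: "Y (?r (grid a b n k)) \<in> borel_measurable M" for n k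
    by (intro L(2) beta_clock_nonneg[OF ab g0])
  have Sm [measurable]: "?S n \<in> borel_measurable M" for n by measurable
  have "(\<lambda>n. CLINT \<omega>|M. iexp (u * ?S n \<omega>)) \<longlonglongrightarrow> (CLINT \<omega>|M. iexp (u * f (?P \<omega>)))"
  proof (rule integral_dominated_convergence[where w = "\<lambda>_. 1"])
    show "AE \<omega> in M. (\<lambda>n. iexp (u * ?S n \<omega>)) \<longlonglongrightarrow> iexp (u * f (?P \<omega>))"
    proof (rule AE_I2)
      fix \<omega> assume "\<omega> \<in> space M"
      from f.tendsto[OF path_integral_tendsto[OF L(4)[OF this] ab a]]
      have "(\<lambda>n. ?S n \<omega>) \<longlonglongrightarrow> f (?P \<omega>)" by (simp only: f.sum f.scaleR real_scaleR_def)
      then show "(\<lambda>n. iexp (u * ?S n \<omega>)) \<longlonglongrightarrow> iexp (u * f (?P \<omega>))" by (intro tendsto_intros)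
    qed
    show "AE \<omega> in M. norm (iexp (u * ?S n \<omega>)) \<le> 1" for n
      by (intro AE_I2) (simp del: of_real_mult of_real_sum)
  qed measurable
  moreover have "(CLINT \<omega>|M. iexp (u * ?S n \<omega>)) = exp (\<Sum>k\<le>n. measure (beta_measure \<beta> \<alpha>) {grid a b n k<..grid a b n (Suc k)} *\<^sub>R \<psi> (grid a b n k * u))" for n
    using char_grid_sum[OF levy f \<psi> ab a, of n u] unfolding char_def by (subst (asm) integral_distr) auto
  moreover have "(\<lambda>n. \<Sum>k\<le>n. measure (beta_measure \<beta> \<alpha>) {grid a b n k<..grid a b n (Suc k)} *\<^sub>R \<psi> (grid a b n k * u)) \<longlonglongrightarrow> band_integral \<beta> \<alpha> \<psi> a b u"
    unfolding band_integral_def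
  proof -
    obtain C where C: "\<And>x. \<bar>x\<bar> \<le> \<bar>u\<bar> \<Longrightarrow> norm (\<psi> x) \<le> C" using continuous_bounded_on_interval[OF cont] by blast
    show "(\<lambda>n. \<Sum>k\<le>n. measure (beta_measure \<beta> \<alpha>) {grid a b n k<..grid a b n (Suc k)} *\<^sub>R \<psi> (grid a b n k * u))
        \<longlonglongrightarrow> (CLINT t:{a<..b}|beta_measure \<beta> \<alpha>. \<psi> (t * u))"
    proof (rule grid_step_integral_tendsto(2)[where m = 0 and B = C])
      show "emeasure (beta_measure \<beta> \<alpha>) {a<..b} < \<infinity>" by (rule emeasure_beta_measure_Ioc_finite[OF ab a(1)])
      show "norm (\<psi> (grid a b n k * u)) \<le> C" if "0 \<le> n" "k \<le> n" for n k
      proof (rule C)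
        have "grid a b n k \<le> 1" using grid_mono[of a b k "Suc n" n] a that by simp
        then show "\<bar>grid a b n k * u\<bar> \<le> \<bar>u\<bar>" using g0[of n k] by (simp add: abs_mult mult_left_le_one_le)
      qed
      fix t \<kappa> assume \<kappa>: "\<And>n. grid a b n (\<kappa> n) < t" "\<And>n. t \<le> grid a b n (Suc (\<kappa> n))"
      have "isCont \<psi> (t * u)" using cont by (simp add: continuous_on_eq_continuous_at)
      then show "(\<lambda>n. \<psi> (grid a b n (\<kappa> n) * u)) \<longlonglongrightarrow> \<psi> (t * u)"
        by (rule isCont_tendsto_compose) (intro tendsto_intros grid_in_cell_tendsto(1)[OF a(2) \<kappa>])
    qed (use a in auto)
  qed
  ultimately have "(\<lambda>n. exp (\<Sum>k\<le>n. measure (beta_measure \<beta> \<alpha>) {grid a b n k<..grid a b n (Suc k)} *\<^sub>R \<psi> (grid a b n k * u))) \<longlonglongrightarrow> (CLINT \<omega>|M. iexp (u * f (?P \<omega>)))"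
    "(\<lambda>n. exp (\<Sum>k\<le>n. measure (beta_measure \<beta> \<alpha>) {grid a b n k<..grid a b n (Suc k)} *\<^sub>R \<psi> (grid a b n k * u))) \<longlonglongrightarrow> exp (band_integral \<beta> \<alpha> \<psi> a b u)"
    by (simp_all only: tendsto_exp)
  then show ?thesis by (rule LIMSEQ_unique)
qed

section \<open>Exponents of improper random integrals\<close>

lemma set_integrable_band:
  assumes ab: "\<beta> < \<alpha>" and a: "0 < a" "b \<le> 1" and cont: "continuous_on UNIV \<psi>"
  shows "set_integrable (beta_measure \<beta> \<alpha>) {a<..b} (\<lambda>t. \<psi> (t * u) :: complex)"
proof -
  have [measurable]: "\<psi> \<in> borel_measurable borel" using cont by (rule borel_measurable_continuous_onI)
  obtain C where C: "\<And>x. \<bar>x\<bar> \<le> \<bar>u\<bar> \<Longrightarrow> norm (\<psi> x) \<le> C" using continuous_bounded_on_interval[OF cont] by blast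
  have dom: "integrable (beta_measure \<beta> \<alpha>) (\<lambda>t. C * indicator {a<..b} t)"
    using emeasure_beta_measure_Ioc_finite[OF ab a(1)] by (intro integrable_mult_right) (simp add: integrable_indicator_iff)
  show ?thesis
    unfolding set_integrable_def
  proof (rule Bochner_Integration.integrable_bound[OF dom])
    show "AE t in beta_measure \<beta> \<alpha>. norm (indicator {a<..b} t *\<^sub>R \<psi> (t * u)) \<le> norm (C * indicator {a<..b} t)"
    proof (rule AE_I2)
      fix t
      have "norm (\<psi> (t * u)) \<le> \<bar>C\<bar>" if "t \<in> {a<..b}"
      proof -
        have "\<bar>t * u\<bar> \<le> \<bar>u\<bar>" using that a by (simp add: abs_mult mult_left_le_one_le)
        then show ?thesis using C by fastforce
      qed
      then show "norm (indicator {a<..b} t *\<^sub>R \<psi> (t * u)) \<le> norm (C * indicator {a<..b} t)"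
        by (simp add: indicator_def)
    qed
  qed measurable
qed

text \<open>The doubling inequality is linear in the exponent and holds at each point t u, so
  integrating over t preserves it. This prepares the passage to limit laws.\<close>

lemma band_integral_double:
  assumes ab: "\<beta> < \<alpha>" and a: "0 < a" "b \<le> 1" and cont: "continuous_on UNIV \<psi>"
    and dbl: "\<And>u. 4 * Re (\<psi> u) \<le> Re (\<psi> (2 * u))"
  shows "4 * Re (band_integral \<beta> \<alpha> \<psi> a b u) \<le> Re (band_integral \<beta> \<alpha> \<psi> a b (2 * u))"
proof -
  let ?N = "beta_measure \<beta> \<alpha>"
  have int: "integrable ?N (\<lambda>t. indicator {a<..b} t *\<^sub>R \<psi> (t * v))" for v
    using set_integrable_band[OF ab a cont] by (simp add: set_integrable_def)
  have intR: "integrable ?N (\<lambda>t. Re (indicator {a<..b} t *\<^sub>R \<psi> (t * v)))" for v by (rule integrable_Re[OF int])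
  have Re: "Re (band_integral \<beta> \<alpha> \<psi> a b v) = (LINT t|?N. Re (indicator {a<..b} t *\<^sub>R \<psi> (t * v)))" for v
    unfolding band_integral_def set_lebesgue_integral_def by (rule integral_Re[OF int, symmetric])
  have "4 * Re (band_integral \<beta> \<alpha> \<psi> a b u) = (LINT t|?N. 4 * Re (indicator {a<..b} t *\<^sub>R \<psi> (t * u)))"
    unfolding Re by simp
  also have "\<dots> \<le> (LINT t|?N. Re (indicator {a<..b} t *\<^sub>R \<psi> (t * (2 * u))))"
  proof (rule integral_mono)
    fix t
    show "4 * Re (indicator {a<..b} t *\<^sub>R \<psi> (t * u)) \<le> Re (indicator {a<..b} t *\<^sub>R \<psi> (t * (2 * u)))"
      using dbl[of "t * u"] by (simp add: indicator_def mult.left_commute)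
  qed (use intR in auto)
  finally show ?thesis unfolding Re .
qed

lemma continuous_on_band_integral:
  assumes ab: "\<beta> < \<alpha>" and a: "0 < a" "b \<le> 1" and cont: "continuous_on UNIV \<psi>"
  shows "continuous_on UNIV (band_integral \<beta> \<alpha> \<psi> a b)"
proof (rule continuous_at_imp_continuous_on, rule ballI)
  fix u :: real
  show "isCont (band_integral \<beta> \<alpha> \<psi> a b) u"
    unfolding continuous_at_sequentially
  proof (intro allI impI)
    fix v assume v: "v \<longlonglongrightarrow> u"
    have [measurable]: "\<psi> \<in> borel_measurable borel" using cont by (rule borel_measurable_continuous_onI)
    obtain R where R: "\<And>n. \<bar>v n\<bar> \<le> R" using convergent_imp_Bseq[of v] v by (auto simp: convergent_def Bseq_def)
    obtain C where C: "\<And>x. \<bar>x\<bar> \<le> R \<Longrightarrow> norm (\<psi> x) \<le> C" using continuous_bounded_on_interval[OF cont] by blast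
    have dom: "integrable (beta_measure \<beta> \<alpha>) (\<lambda>t. C * indicator {a<..b} t)"
      using emeasure_beta_measure_Ioc_finite[OF ab a(1)] by (intro integrable_mult_right) (simp add: integrable_indicator_iff)
    have "(\<lambda>n. CLINT t|beta_measure \<beta> \<alpha>. indicator {a<..b} t *\<^sub>R \<psi> (t * v n)) \<longlonglongrightarrow> (CLINT t|beta_measure \<beta> \<alpha>. indicator {a<..b} t *\<^sub>R \<psi> (t * u))"
    proof (rule integral_dominated_convergence[OF _ _ dom])
      show "AE t in beta_measure \<beta> \<alpha>. (\<lambda>n. indicator {a<..b} t *\<^sub>R \<psi> (t * v n)) \<longlonglongrightarrow> indicator {a<..b} t *\<^sub>R \<psi> (t * u)"
      proof (rule AE_I2)
        fix t
        have "isCont \<psi> (t * u)" using cont by (simp add: continuous_on_eq_continuous_at)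
        then have "(\<lambda>n. \<psi> (t * v n)) \<longlonglongrightarrow> \<psi> (t * u)"
          by (rule isCont_tendsto_compose) (intro tendsto_intros v)
        then show "(\<lambda>n. indicator {a<..b} t *\<^sub>R \<psi> (t * v n)) \<longlonglongrightarrow> indicator {a<..b} t *\<^sub>R \<psi> (t * u)"
          by (intro tendsto_intros)
      qed
      show "AE t in beta_measure \<beta> \<alpha>. norm (indicator {a<..b} t *\<^sub>R \<psi> (t * v n)) \<le> C * indicator {a<..b} t" for n
      proof (rule AE_I2)
        fix t
        have "norm (\<psi> (t * v n)) \<le> C" if t: "t \<in> {a<..b}"
        proof (rule C)
          have "\<bar>t * v n\<bar> \<le> \<bar>v n\<bar>" using t a by (simp add: abs_mult mult_left_le_one_le)
          then show "\<bar>t * v n\<bar> \<le> R" using R[of n] by simp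
        qed
        then show "norm (indicator {a<..b} t *\<^sub>R \<psi> (t * v n)) \<le> C * indicator {a<..b} t"
          by (simp add: indicator_def)
      qed
    qed measurable
    then show "(band_integral \<beta> \<alpha> \<psi> a b \<circ> v) \<longlonglongrightarrow> band_integral \<beta> \<alpha> \<psi> a b u"
      by (simp add: band_integral_def set_lebesgue_integral_def comp_def)
  qed
qed

text \<open>Once a > 0 is fixed, the clock measure beyond a is finite, so the limit at the end 1 is
  absolutely convergent.\<close>

lemma band_integral_tendsto_cut_integral:
  assumes ab: "\<beta> < \<alpha>" and a: "0 < a" and cont: "continuous_on UNIV \<psi>" and q: "\<And>n. q n < 1" "q \<longlonglongrightarrow> 1"
  shows "(\<lambda>n. band_integral \<beta> \<alpha> \<psi> a (q n) u) \<longlonglongrightarrow> cut_integral (beta_density \<beta> \<alpha>) \<psi> a u"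
proof -
  have psi [measurable]: "\<psi> \<in> borel_measurable borel" using cont by (rule borel_measurable_continuous_onI)
  obtain C where C: "\<And>x. \<bar>x\<bar> \<le> \<bar>u\<bar> \<Longrightarrow> norm (\<psi> x) \<le> C" using continuous_bounded_on_interval[OF cont] by blast
  have C0: "0 \<le> C" using order_trans[OF norm_ge_zero C[of 0]] by simp
  have dom: "integrable (beta_measure \<beta> \<alpha>) (\<lambda>t. C * indicator {a<..} t)"
    using emeasure_beta_measure_finite[OF ab a] by (intro integrable_mult_right) (simp add: integrable_indicator_iff)
  have AE1: "AE t in beta_measure \<beta> \<alpha>. t < 1"
    unfolding beta_measure_def by (subst AE_density) (auto simp: beta_density_def)
  show ?thesis
    unfolding band_integral_def set_lebesgue_integral_def cut_integral_beta_measure[OF ab psi]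
  proof (rule integral_dominated_convergence[OF _ _ dom])
    show "AE t in beta_measure \<beta> \<alpha>. (\<lambda>n. indicator {a<..q n} t *\<^sub>R \<psi> (t * u)) \<longlonglongrightarrow> indicator {a<..} t *\<^sub>R \<psi> (t * u)"
      using AE1
    proof eventually_elim
      case (elim t)
      have "eventually (\<lambda>n. t < q n) sequentially" using q(2) elim by (rule order_tendstoD)
      then have "eventually (\<lambda>n. indicator {a<..q n} t *\<^sub>R \<psi> (t * u) = indicator {a<..} t *\<^sub>R \<psi> (t * u)) sequentially"
        by eventually_elim (auto simp: indicator_def)
      then show ?case by (rule tendsto_eventually)
    qed
    show "AE t in beta_measure \<beta> \<alpha>. norm (indicator {a<..q n} t *\<^sub>R \<psi> (t * u)) \<le> C * indicator {a<..} t" for n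
    proof (rule AE_I2)
      fix t
      have "norm (\<psi> (t * u)) \<le> C" if "t \<in> {a<..q n}"
      proof (rule C)
        show "\<bar>t * u\<bar> \<le> \<bar>u\<bar>" using that a q(1)[of n] by (simp add: abs_mult mult_left_le_one_le)
      qed
      then show "norm (indicator {a<..q n} t *\<^sub>R \<psi> (t * u)) \<le> C * indicator {a<..} t"
        using C0 by (simp add: indicator_def)
    qed
  qed measurable
qed

text \<open>In the product filter a and b move independently: for fixed small a the bound e / 2
  holds for all b near 1 and, being closed, survives b -> 1.\<close>

lemma uniform_limit_cut_integral:
  assumes ab: "\<beta> < \<alpha>" and cont: "continuous_on UNIV \<psi>"
    and lim: "uniform_limit S (\<lambda>(a, b). band_integral \<beta> \<alpha> \<psi> a b) \<Lambda> (at_right 0 \<times>\<^sub>F at_left 1)"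
  shows "uniform_limit S (cut_integral (beta_density \<beta> \<alpha>) \<psi>) \<Lambda> (at_right 0)"
proof (rule uniform_limitI)
  fix e :: real assume e: "0 < e"
  then have "0 < e / 2" by simp
  from uniform_limitD[OF lim this] obtain P Q where P: "eventually P (at_right 0)" and Q: "eventually Q (at_left 1)"
    and PQ: "\<And>a b u. P a \<Longrightarrow> Q b \<Longrightarrow> u \<in> S \<Longrightarrow> dist (band_integral \<beta> \<alpha> \<psi> a b u) (\<Lambda> u) < e / 2"
    unfolding eventually_prod_filter by auto
  obtain c where c: "c < 1" "\<And>b. c < b \<Longrightarrow> b < 1 \<Longrightarrow> Q b"
    using Q by (auto simp: eventually_at_left_field)
  \<comment> \<open>A sequence tending to 1 inside (c, 1); the denominator n + 2 keeps even its
    first term strictly above c.\<close>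
  define q where "q n = 1 - (1 - c) / real (Suc (Suc n))" for n
  have q1: "c < q n" "q n < 1" for n
  proof -
    have "(1 - c) / real (Suc (Suc n)) < (1 - c) / 1" using c(1) by (intro divide_strict_left_mono) auto
    then show "c < q n" unfolding q_def div_by_1 by linarith
    have "0 < (1 - c) / real (Suc (Suc n))" using c(1) by simp
    then show "q n < 1" unfolding q_def by linarith
  qed
  have q2: "q \<longlonglongrightarrow> 1"
    using tendsto_diff[OF tendsto_const[of 1] LIMSEQ_Suc[OF tendsto_grid_mesh[of "1 - c"]]] by (simp add: q_def[abs_def])
  show "eventually (\<lambda>a. \<forall>u\<in>S. dist (cut_integral (beta_density \<beta> \<alpha>) \<psi> a u) (\<Lambda> u) < e) (at_right 0)"
    using P eventually_at_right_less[of "0::real"]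
  proof eventually_elim
    case (elim a)
    show ?case
    proof
      fix u assume u: "u \<in> S"
      have "(\<lambda>n. dist (band_integral \<beta> \<alpha> \<psi> a (q n) u) (\<Lambda> u)) \<longlonglongrightarrow> dist (cut_integral (beta_density \<beta> \<alpha>) \<psi> a u) (\<Lambda> u)"
        using elim by (intro tendsto_dist tendsto_const band_integral_tendsto_cut_integral[OF ab _ cont q1(2) q2]) auto
      moreover have "dist (band_integral \<beta> \<alpha> \<psi> a (q n) u) (\<Lambda> u) \<le> e / 2" for n
        using PQ[OF elim(1) c(2)[OF q1] u] by (rule less_imp_le)
      ultimately have "dist (cut_integral (beta_density \<beta> \<alpha>) \<psi> a u) (\<Lambda> u) \<le> e / 2" by (intro LIMSEQ_le_const2) auto
      then show "dist (cut_integral (beta_density \<beta> \<alpha>) \<psi> a u) (\<Lambda> u) < e" using e by simp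
    qed
  qed
qed

section \<open>From convergence in probability to convergence of exponents\<close>

lemma norm_iexp_diff_le: "norm (iexp x - iexp y) \<le> \<bar>x - y\<bar>" for x y :: real
proof -
  have "iexp x - iexp y = iexp y * (iexp (x - y) - 1)"
    by (simp add: right_diff_distrib exp_add[symmetric] algebra_simps)
  then have "norm (iexp x - iexp y) = norm (iexp (x - y) - 1)" by (simp add: norm_mult)
  also have "\<dots> \<le> \<bar>x - y\<bar>" using iexp_approx1[of "x - y" 0] by simp
  finally show ?thesis .
qed

text \<open>For |u| <= U the integrands are Lipschitz in the random vector with a common constant U
  K. Where the vectors are within d of each other this gives at most e / 2; elsewhere the integrands
  differ by at most 2, on an event of small probability.\<close>

lemma tendsto_in_prob_char:
  fixes f :: "'a::{banach, second_countable_topology} \<Rightarrow> real"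
  assumes M: "prob_space M" and X: "tendsto_in_prob M X Z F" and f: "bounded_linear f" and U: "0 \<le> U"
  shows "uniform_limit {-U..U} (\<lambda>i u. CLINT \<omega>|M. iexp (u * f (X i \<omega>))) (\<lambda>u. CLINT \<omega>|M. iexp (u * f (Z \<omega>))) F"
proof (rule uniform_limitI)
  fix e :: real assume e: "0 < e"
  interpret prob_space M by fact
  interpret f: bounded_linear f by fact
  have [measurable]: "f \<in> borel_measurable borel"
    using f by (rule bounded_linear_borel_measurable)
  obtain K where K: "0 < K" "\<And>x. norm (f x) \<le> norm x * K" using f.pos_bounded by blast
  \<comment> \<open>Chosen so that U K d <= e / 2; the added 1 covers U = 0.\<close>
  define d where "d = e / (2 * (U * K + 1))"
  have UK: "0 \<le> U * K" using U K by simp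
  have d: "0 < d" using e UK by (simp add: d_def)
  have dle: "U * K * d \<le> e / 2"
  proof -
    have "U * K * d = (U * K / (U * K + 1)) * (e / 2)" by (simp add: d_def)
    also have "\<dots> \<le> 1 * (e / 2)" using UK e by (intro mult_right_mono) auto
    finally show ?thesis by simp
  qed
  have Z [measurable]: "Z \<in> borel_measurable M" using X by (simp add: tendsto_in_prob_def)
  have "((\<lambda>i. measure M {\<omega> \<in> space M. d < dist (X i \<omega>) (Z \<omega>)}) \<longlongrightarrow> 0) F"
    using X d by (simp add: tendsto_in_prob_def)
  then have "eventually (\<lambda>i. measure M {\<omega> \<in> space M. d < dist (X i \<omega>) (Z \<omega>)} < e / 4) F"
    by (rule order_tendstoD) (use e in simp)
  moreover have "eventually (\<lambda>i. X i \<in> borel_measurable M) F" using X by (simp add: tendsto_in_prob_def)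
  ultimately show "eventually (\<lambda>i. \<forall>u\<in>{-U..U}. dist (CLINT \<omega>|M. iexp (u * f (X i \<omega>))) (CLINT \<omega>|M. iexp (u * f (Z \<omega>))) < e) F"
  proof eventually_elim
    case (elim i)
    note [measurable] = elim(2)
    let ?A = "{\<omega> \<in> space M. d < dist (X i \<omega>) (Z \<omega>)}"
    have A [measurable]: "?A \<in> sets M" by measurable
    show ?case
    proof
      fix u assume u: "u \<in> {-U..U}"
      have int: "complex_integrable M (\<lambda>\<omega>. iexp (u * f (X i \<omega>)))" "complex_integrable M (\<lambda>\<omega>. iexp (u * f (Z \<omega>)))"
        by (intro integrable_iexp; simp)+
      have "dist (CLINT \<omega>|M. iexp (u * f (X i \<omega>))) (CLINT \<omega>|M. iexp (u * f (Z \<omega>)))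
          = norm (CLINT \<omega>|M. iexp (u * f (X i \<omega>)) - iexp (u * f (Z \<omega>)))"
        unfolding dist_norm using int by (subst Bochner_Integration.integral_diff) auto
      also have "\<dots> \<le> (LINT \<omega>|M. norm (iexp (u * f (X i \<omega>)) - iexp (u * f (Z \<omega>))))"
        by (rule integral_norm_bound)
      also have "\<dots> \<le> (LINT \<omega>|M. e / 2 + 2 * indicator ?A \<omega>)"
      proof (rule integral_mono)
        show "integrable M (\<lambda>\<omega>. norm (iexp (u * f (X i \<omega>)) - iexp (u * f (Z \<omega>))))"
          using int by (intro integrable_norm Bochner_Integration.integrable_diff)
        show "integrable M (\<lambda>\<omega>. e / 2 + 2 * indicator ?A \<omega>)"
          by (intro Bochner_Integration.integrable_add integrable_mult_right) (auto simp: integrable_indicator_iff emeasure_eq_measure)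
        fix \<omega> assume \<omega>: "\<omega> \<in> space M"
        show "norm (iexp (u * f (X i \<omega>)) - iexp (u * f (Z \<omega>))) \<le> e / 2 + 2 * indicator ?A \<omega>"
        proof (cases "\<omega> \<in> ?A")
          case True
          have "norm (iexp (u * f (X i \<omega>)) - iexp (u * f (Z \<omega>))) \<le> norm (iexp (u * f (X i \<omega>))) + norm (iexp (u * f (Z \<omega>)))"
            by (rule norm_triangle_ineq4)
          then show ?thesis using True e by (simp del: of_real_mult)
        next
          case False
          have "norm (iexp (u * f (X i \<omega>)) - iexp (u * f (Z \<omega>))) \<le> \<bar>u\<bar> * norm (f (X i \<omega> - Z \<omega>))"
            using norm_iexp_diff_le[of "u * f (X i \<omega>)" "u * f (Z \<omega>)"]
            by (simp add: f.diff abs_mult[symmetric] right_diff_distrib del: of_real_mult)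
          also have "\<dots> \<le> U * (d * K)"
          proof (rule mult_mono)
            have "dist (X i \<omega>) (Z \<omega>) \<le> d" using False \<omega> by auto
            then show "norm (f (X i \<omega> - Z \<omega>)) \<le> d * K"
              using K(1) by (intro order_trans[OF K(2)] mult_right_mono) (auto simp: dist_norm)
          qed (use u U in auto)
          also have "\<dots> \<le> e / 2" using dle by (simp add: mult_ac)
          finally show ?thesis using False by simp
        qed
      qed
      also have "\<dots> = e / 2 + 2 * measure M ?A"
        using A by (subst Bochner_Integration.integral_add) (auto simp: integrable_indicator_iff emeasure_eq_measure prob_space)
      also have "\<dots> < e" using elim(1) by simp
      finally show "dist (CLINT \<omega>|M. iexp (u * f (X i \<omega>))) (CLINT \<omega>|M. iexp (u * f (Z \<omega>))) < e" .
    qed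
  qed
qed

text \<open>
  The doubling inequality gives \<open>\<bar>\<phi> u\<bar>\<^sup>4 \<le> \<bar>\<phi> (2 u)\<bar>\<close> in the limit. Since \<open>\<phi>\<close> does not vanish near \<open>0\<close>, it
  vanishes nowhere, and no infinite divisibility of the limit law has to be known beforehand.
\<close>

lemma exponent_limit:
  fixes c :: "'i \<Rightarrow> real \<Rightarrow> complex" and \<phi> :: "real \<Rightarrow> complex"
  assumes F: "F \<noteq> bot" and \<phi>: "continuous_on UNIV \<phi>" "\<phi> 0 = 1"
    and lim: "\<And>U. 0 \<le> U \<Longrightarrow> uniform_limit {-U..U} (\<lambda>i u. exp (c i u)) \<phi> F"
    and c: "eventually (\<lambda>i. continuous_on UNIV (c i) \<and> c i 0 = 0 \<and> (\<forall>u. 4 * Re (c i u) \<le> Re (c i (2 * u)))) F"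
  obtains \<Lambda> where "continuous_on UNIV \<Lambda>" "\<Lambda> 0 = 0" "\<And>u. \<phi> u = exp (\<Lambda> u)" "uniform_limit {0..1} c \<Lambda> F"
proof -
  have pt: "((\<lambda>i. exp (c i u)) \<longlongrightarrow> \<phi> u) F" for u
  proof (rule tendsto_uniform_limitI[OF lim[of "\<bar>u\<bar>"]])
    have "- \<bar>u\<bar> \<le> u" "u \<le> \<bar>u\<bar>" by linarith+
    then show "u \<in> {- \<bar>u\<bar>..\<bar>u\<bar>}" by simp
  qed simp
  have dbl: "norm (\<phi> u) ^ 4 \<le> norm (\<phi> (2 * u))" for u
  proof (rule tendsto_le[OF F])
    show "((\<lambda>i. norm (exp (c i (2 * u)))) \<longlongrightarrow> norm (\<phi> (2 * u))) F" by (intro tendsto_norm pt)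
    show "((\<lambda>i. norm (exp (c i u)) ^ 4) \<longlongrightarrow> norm (\<phi> u) ^ 4) F" by (intro tendsto_power tendsto_norm pt)
    show "eventually (\<lambda>i. norm (exp (c i u)) ^ 4 \<le> norm (exp (c i (2 * u)))) F"
      using c
    proof eventually_elim
      case (elim i)
      have "norm (exp (c i u)) ^ 4 = exp (4 * Re (c i u))"
        using exp_of_nat_mult[of 4 "Re (c i u)"] by simp
      also have "\<dots> \<le> norm (exp (c i (2 * u)))" using elim by simp
      finally show ?case .
    qed
  qed
  have nz: "\<phi> u \<noteq> 0" for u
  proof -
    have "isCont \<phi> 0" using \<phi>(1) by (simp add: continuous_on_eq_continuous_at)
    moreover have "(\<lambda>n. u * (1 / 2) ^ n) \<longlonglongrightarrow> u * 0"
      by (intro tendsto_intros LIMSEQ_power_zero) auto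
    ultimately have "(\<lambda>n. \<phi> (u * (1 / 2) ^ n)) \<longlonglongrightarrow> \<phi> 0"
      using isCont_tendsto_compose[of 0 \<phi> "\<lambda>n. u * (1 / 2) ^ n" sequentially] by simp
    then have "eventually (\<lambda>n. \<phi> (u * (1 / 2) ^ n) \<noteq> 0) sequentially"
      by (rule tendsto_imp_eventually_ne) (simp add: \<phi>(2))
    then obtain n where n: "\<phi> (u * (1 / 2) ^ n) \<noteq> 0" by (auto simp: eventually_sequentially)
    \<comment> \<open>Starting from the small argument u / 2^n, each application of
      \<open>dbl\<close> doubles the argument; after n doublings it is u.\<close>
    have "\<phi> (u * (1 / 2) ^ (n - k)) \<noteq> 0" if "k \<le> n" for k
      using that
    proof (induction k)
      case (Suc k)
      then have "0 < norm (\<phi> (u * (1 / 2) ^ (n - k))) ^ 4" by simp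
      moreover have "2 * (u * (1 / 2) ^ (n - k)) = u * (1 / 2) ^ (n - Suc k)"
        using Suc.prems by (simp add: Suc_diff_Suc[symmetric])
      ultimately have "0 < norm (\<phi> (u * (1 / 2) ^ (n - Suc k)))" using dbl[of "u * (1 / 2) ^ (n - k)"] by (simp only:)
      then show ?case by simp
    qed (use n in simp)
    from this[of n] show ?thesis by simp
  qed
  obtain \<Lambda> where \<Lambda>: "continuous_on UNIV \<Lambda>" "\<Lambda> 0 = 0" "\<And>u. \<phi> u = exp (\<Lambda> u)"
    using continuous_logarithm_real[OF \<phi>(1) nz \<phi>(2)] by blast
  have "uniform_limit {0..1} c \<Lambda> F"
  proof (rule uniform_limitI)
    fix e :: real assume e: "0 < e"
    \<comment> \<open>The quotient exp (c i u - \<Lambda> u) is uniformly close to 1, where the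
      principal logarithm is continuous. It recovers c i u - \<Lambda> u itself, as both vanish at u
      = 0 and are continuous on [0, 1].\<close>
    have "isCont Ln 1" by (rule continuous_at_Ln) simp
    then obtain k where k: "0 < k" "\<And>z. dist z 1 < k \<Longrightarrow> dist (Ln z) (Ln 1) < e"
      using e unfolding continuous_at_eps_delta by blast
    have "continuous_on UNIV (\<lambda>x. exp (- \<Lambda> x))" by (intro continuous_intros \<Lambda>(1))
    then obtain C where C: "\<And>x. \<bar>x\<bar> \<le> 1 \<Longrightarrow> norm (exp (- \<Lambda> x)) \<le> C"
      using continuous_bounded_on_interval[of "\<lambda>x. exp (- \<Lambda> x)" 1] by blast
    have C0: "0 \<le> C" using order_trans[OF norm_ge_zero C[of 0]] by simp
    \<comment> \<open>The bound k makes the logarithm smaller than e, and 1/2 keeps the quotient off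
      the branch cut; C + 1 absorbs the factor exp (- \<Lambda> u).\<close>
    have "0 < min k (1/2) / (C + 1)" using k(1) C0 by simp
    from uniform_limitD[OF lim[of 1, simplified] this]
    show "eventually (\<lambda>i. \<forall>u\<in>{0..1}. dist (c i u) (\<Lambda> u) < e) F"
      using c
    proof eventually_elim
      case (elim i)
      have near: "dist (exp (c i u - \<Lambda> u)) 1 < min k (1/2)" if u: "u \<in> {0..1}" for u
      proof -
        have "norm (exp (c i u) - \<phi> u) < min k (1/2) / (C + 1)" using elim(1) u by (auto simp: dist_norm)
        moreover have "exp (c i u - \<Lambda> u) - 1 = exp (- \<Lambda> u) * (exp (c i u) - \<phi> u)"
          unfolding \<Lambda>(3) by (simp add: right_diff_distrib exp_add[symmetric])
        then have "norm (exp (c i u - \<Lambda> u) - 1) = norm (exp (- \<Lambda> u)) * norm (exp (c i u) - \<phi> u)" by (simp add: norm_mult)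
        moreover have "norm (exp (- \<Lambda> u)) \<le> C" using u by (intro C) auto
        ultimately have "norm (exp (c i u - \<Lambda> u) - 1) \<le> C * (min k (1/2) / (C + 1))"
          using C0 by (simp only:, intro mult_mono) auto
        also have "\<dots> < (C + 1) * (min k (1/2) / (C + 1))"
          using k(1) C0 by (intro mult_strict_right_mono) auto
        finally show ?thesis using C0 by (simp add: dist_norm)
      qed
      have nonpos: "exp (c i u - \<Lambda> u) \<notin> \<real>\<^sub>\<le>\<^sub>0" if u: "u \<in> {0..1}" for u
      proof
        assume "exp (c i u - \<Lambda> u) \<in> \<real>\<^sub>\<le>\<^sub>0"
        then have "Re (exp (c i u - \<Lambda> u)) \<le> 0" by (auto simp: complex_nonpos_Reals_iff)
        then have "1 \<le> \<bar>Re (exp (c i u - \<Lambda> u) - 1)\<bar>" by simp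
        also have "\<dots> \<le> norm (exp (c i u - \<Lambda> u) - 1)" by (rule abs_Re_le_cmod)
        finally show False using near[OF u] by (simp add: dist_norm)
      qed
      have contd: "continuous_on {0..1} (\<lambda>u. c i u - \<Lambda> u)"
        using elim(2) \<Lambda>(1) by (intro continuous_intros) (auto intro: continuous_on_subset)
      have eq: "c i u - \<Lambda> u = Ln (exp (c i u - \<Lambda> u))" if u: "u \<in> {0..1}" for u
      proof (rule exp_eq_imp_eq_on_connected[of "{0..1}" "\<lambda>u. c i u - \<Lambda> u" "\<lambda>u. Ln (exp (c i u - \<Lambda> u))" 0 u])
        show "continuous_on {0..1} (\<lambda>u. Ln (exp (c i u - \<Lambda> u)))"
          by (rule continuous_on_Ln'[OF continuous_on_exp[OF contd] nonpos])
      qed (use contd u elim(2) \<Lambda>(2) in auto)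
      show ?case
      proof
        fix u :: real assume u: "u \<in> {0..1}"
        have "dist (Ln (exp (c i u - \<Lambda> u))) (Ln 1) < e" using near[OF u] by (intro k(2)) simp
        then show "dist (c i u) (\<Lambda> u) < e" unfolding eq[OF u, symmetric] by (simp add: dist_norm)
      qed
    qed
  qed
  with \<Lambda> show thesis by (rule that)
qed

section \<open>Laws of improper integrals and their composition\<close>

lemma has_random_integral_law_prob:
  assumes "has_random_integral_law h r c d \<nu> \<mu>"
  shows "prob_space \<mu>" "sets \<mu> = sets borel"
  using assms unfolding has_random_integral_law_def levy_process_def tendsto_in_prob_def
  by (auto intro: prob_space.prob_space_distr)

text \<open>Convergence in probability carries the characteristic functions of the proper integrals
  to the limit, \<open>exponent_limit\<close> carries their logarithms, and b -> 1 leaves the cut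
  integrals. As \<psi> depends on \<nu> alone, the choice of the Levy process is irrelevant, and
  \<Lambda> can serve as the input exponent of a second integral.\<close>

lemma random_integral_law_exponent:
  fixes f :: "'a::{banach, second_countable_topology} \<Rightarrow> real"
  assumes law: "has_random_integral_law (\<lambda>t. t) (beta_clock \<beta> \<alpha>) 0 1 \<nu> \<mu>" and ab: "\<beta> < \<alpha>"
    and f: "bounded_linear f" and \<psi>: "char_exponent (distr \<nu> borel f) \<psi>"
  obtains \<Lambda> where "char_exponent (distr \<mu> borel f) \<Lambda>"
    "uniform_limit {0..1} (cut_integral (beta_density \<beta> \<alpha>) \<psi>) \<Lambda> (at_right 0)"
proof -
  obtain M :: "(real \<Rightarrow> 'a) measure" and Y Z where levy: "levy_process M Y \<nu>"
    and lim: "tendsto_in_prob M (\<lambda>(a, b) \<omega>. path_integral (\<lambda>t. t) (beta_clock \<beta> \<alpha>) a b (\<lambda>t. Y t \<omega>)) Z (at_right 0 \<times>\<^sub>F at_left 1)"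
    and \<mu>: "\<mu> = distr M borel Z"
    using law unfolding has_random_integral_law_def by blast
  interpret prob_space M by (rule levy_processD(1)[OF levy])
  have [measurable]: "f \<in> borel_measurable borel"
    using f by (rule bounded_linear_borel_measurable)
  have Z [measurable]: "Z \<in> borel_measurable M" using lim by (simp add: tendsto_in_prob_def)
  have cont: "continuous_on UNIV \<psi>" and \<psi>0: "\<psi> 0 = 0" using \<psi> by (auto simp: char_exponent_def)
  obtain \<psi>' where \<psi>': "char_exponent (distr \<nu> borel f) \<psi>'" "\<And>u. 4 * Re (\<psi>' u) \<le> Re (\<psi>' (2 * u))"
    using levy_process_exponent[OF levy f] by metis
  have "\<psi>' = \<psi>" using \<psi>'(1) \<psi> by (rule char_exponent_unique)
  note dbl = \<psi>'(2)[unfolded this]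
  let ?F = "at_right (0::real) \<times>\<^sub>F at_left (1::real)"
  let ?c = "\<lambda>(a, b). band_integral \<beta> \<alpha> \<psi> a b"
  \<comment> \<open>The midpoint 1/2 separates the two ends, so that a < b holds although a and b
    vary independently.\<close>
  have evF: "eventually (\<lambda>(a, b). 0 < a \<and> a < b \<and> b < 1) ?F"
    unfolding eventually_prod_filter
  proof (intro exI conjI allI impI)
    show "eventually (\<lambda>a. 0 < a \<and> a < 1/2) (at_right (0::real))"
      unfolding eventually_at_right_field by (intro exI[of _ "1/2"]) auto
    show "eventually (\<lambda>b. 1/2 < b \<and> b < 1) (at_left (1::real))"
      unfolding eventually_at_left_field by (intro exI[of _ "1/2"]) auto
  qed auto
  define \<phi> where "\<phi> u = char (distr \<mu> borel f) u" for u
  have df: "distr \<mu> borel f = distr M borel (\<lambda>\<omega>. f (Z \<omega>))"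
    unfolding \<mu> by (subst distr_distr) (auto simp: comp_def)
  have \<phi>_eq: "\<phi> u = (CLINT \<omega>|M. iexp (u * f (Z \<omega>)))" for u
    unfolding \<phi>_def df char_def by (subst integral_distr) auto
  have rd: "real_distribution (distr \<mu> borel f)"
    unfolding df by (rule real_distribution_distr) measurable
  have \<phi>: "continuous_on UNIV \<phi>" "\<phi> 0 = 1"
    unfolding \<phi>_def using real_distribution.isCont_char[OF rd] real_distribution.char_zero[OF rd]
    by (auto intro!: continuous_at_imp_continuous_on)
  obtain \<Lambda> where \<Lambda>: "continuous_on UNIV \<Lambda>" "\<Lambda> 0 = 0" "\<And>u. \<phi> u = exp (\<Lambda> u)" "uniform_limit {0..1} ?c \<Lambda> ?F"
  proof (rule exponent_limit[of ?F \<phi> ?c])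
    show "?F \<noteq> bot" by (simp add: prod_filter_eq_bot)
    show "uniform_limit {-U..U} (\<lambda>i u. exp (?c i u)) \<phi> ?F" if U: "0 \<le> U" for U
    proof -
      have "eventually (\<lambda>i. \<forall>u\<in>{-U..U}. exp (?c i u) = (CLINT \<omega>|M. iexp (u * f ((case i of (a, b) \<Rightarrow> \<lambda>\<omega>. path_integral (\<lambda>t. t) (beta_clock \<beta> \<alpha>) a b (\<lambda>t. Y t \<omega>)) \<omega>)))) ?F"
        using evF
      proof eventually_elim
        case (elim i)
        obtain a b where i: "i = (a, b)" by force
        then have "0 < a" "a < b" "b < 1" using elim by auto
        then show ?case using char_path_integral[OF levy f \<psi> ab] by (simp add: i)
      qed
      then show ?thesis
        using tendsto_in_prob_char[OF prob_space_axioms lim f U]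
        by (subst uniform_limit_cong[where g = "\<lambda>i u. CLINT \<omega>|M. iexp (u * f ((case i of (a, b) \<Rightarrow> \<lambda>\<omega>. path_integral (\<lambda>t. t) (beta_clock \<beta> \<alpha>) a b (\<lambda>t. Y t \<omega>)) \<omega>))"
              and i = "\<lambda>u. CLINT \<omega>|M. iexp (u * f (Z \<omega>))"]) (auto simp: \<phi>_eq)
    qed
    show "eventually (\<lambda>i. continuous_on UNIV (?c i) \<and> ?c i 0 = 0 \<and> (\<forall>u. 4 * Re (?c i u) \<le> Re (?c i (2 * u)))) ?F"
      using evF
    proof eventually_elim
      case (elim i)
      obtain a b where i: "i = (a, b)" by force
      then have "0 < a" "b \<le> 1" using elim by auto
      then show ?case
        using continuous_on_band_integral[OF ab _ _ cont] band_integral_double[OF ab _ _ cont dbl]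
        by (auto simp: i band_integral_def \<psi>0)
    qed
  qed (use \<phi> in auto)
  have "char_exponent (distr \<mu> borel f) \<Lambda>" using \<Lambda> by (simp add: char_exponent_def \<phi>_def)
  moreover have "uniform_limit {0..1} (cut_integral (beta_density \<beta> \<alpha>) \<psi>) \<Lambda> (at_right 0)"
    by (rule uniform_limit_cut_integral[OF ab cont \<Lambda>(4)])
  ultimately show thesis by (rule that)
qed

text \<open>Comparing exponents at 1 is enough, as f runs through all functionals, scalar multiples
  included.\<close>

lemma law_eqI_exponent:
  fixes \<mu> \<mu>' :: "'a::{banach, second_countable_topology} measure"
  assumes "prob_space \<mu>" "sets \<mu> = sets borel" "prob_space \<mu>'" "sets \<mu>' = sets borel"
    and exponents: "\<And>f. bounded_linear f \<Longrightarrow> \<exists>\<Lambda> \<Lambda>'. char_exponent (distr \<mu> borel f) \<Lambda> \<and> char_exponent (distr \<mu>' borel f) \<Lambda>' \<and> \<Lambda> 1 = \<Lambda>' 1"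
  shows "\<mu> = \<mu>'"
proof (rule char_functional_unique[OF assms(1-4)])
  fix f :: "'a \<Rightarrow> real" assume f: "bounded_linear f"
  have fm: "f \<in> borel_measurable borel"
    using f by (rule bounded_linear_borel_measurable)
  have int: "(CLINT x|N. iexp (f x)) = char (distr N borel f) 1" if "sets N = sets borel" for N
  proof -
    have "f \<in> borel_measurable N" using fm measurable_cong_sets[OF that refl] by blast
    then show ?thesis unfolding char_def by (subst integral_distr) auto
  qed
  obtain \<Lambda> \<Lambda>' where "char_exponent (distr \<mu> borel f) \<Lambda>" "char_exponent (distr \<mu>' borel f) \<Lambda>'" "\<Lambda> 1 = \<Lambda>' 1"
    using exponents[OF f] by blast
  then show "(CLINT x|\<mu>. iexp (f x)) = (CLINT x|\<mu>'. iexp (f x))"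
    using assms(2,4) by (simp add: int char_exponent_def)
qed

lemma random_integral_law_levy_exponent:
  fixes f :: "'a::{banach, second_countable_topology} \<Rightarrow> real"
  assumes law: "has_random_integral_law h r c d \<nu> \<mu>" and f: "bounded_linear f"
  obtains \<psi> where "char_exponent (distr \<nu> borel f) \<psi>"
proof -
  obtain M :: "(real \<Rightarrow> 'a) measure" and Y where levy: "levy_process M Y \<nu>"
    using law unfolding has_random_integral_law_def by blast
  show thesis using levy_process_exponent[OF levy f] that by metis
qed

lemma uniform_limit_imp_tendsto_at_1:
  assumes "uniform_limit {0..1} C \<Lambda> (at_right (0::real))"
  shows "((\<lambda>a. C a (1::real)) \<longlongrightarrow> \<Lambda> 1) (at_right 0)"
  by (rule tendsto_uniform_limitI[OF assms]) simp

text \<open>Both exponents at 1 are limits of the same cut integrals, whichever Levy processes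
  realize the two laws. This justifies the definite description in
  \<open>random_integral_map\<close>.\<close>

lemma random_integral_law_unique:
  fixes \<mu> \<mu>' :: "'a::{banach, second_countable_topology} measure"
  assumes ab: "\<beta> < \<alpha>" and law: "has_random_integral_law (\<lambda>t. t) (beta_clock \<beta> \<alpha>) 0 1 \<nu> \<mu>"
    and law': "has_random_integral_law (\<lambda>t. t) (beta_clock \<beta> \<alpha>) 0 1 \<nu> \<mu>'"
  shows "\<mu> = \<mu>'"
proof (rule law_eqI_exponent)
  fix f :: "'a \<Rightarrow> real" assume f: "bounded_linear f"
  obtain \<psi> where \<psi>: "char_exponent (distr \<nu> borel f) \<psi>" using random_integral_law_levy_exponent[OF law f] .
  obtain \<Lambda> where \<Lambda>: "char_exponent (distr \<mu> borel f) \<Lambda>"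
    "uniform_limit {0..1} (cut_integral (beta_density \<beta> \<alpha>) \<psi>) \<Lambda> (at_right 0)"
    using random_integral_law_exponent[OF law ab f \<psi>] .
  obtain \<Lambda>' where \<Lambda>': "char_exponent (distr \<mu>' borel f) \<Lambda>'"
    "uniform_limit {0..1} (cut_integral (beta_density \<beta> \<alpha>) \<psi>) \<Lambda>' (at_right 0)"
    using random_integral_law_exponent[OF law' ab f \<psi>] .
  have "\<Lambda> 1 = \<Lambda>' 1"
    by (rule tendsto_unique[OF trivial_limit_at_right_real uniform_limit_imp_tendsto_at_1[OF \<Lambda>(2)] uniform_limit_imp_tendsto_at_1[OF \<Lambda>'(2)]])
  with \<Lambda>(1) \<Lambda>'(1) show "\<exists>\<Lambda> \<Lambda>'. char_exponent (distr \<mu> borel f) \<Lambda> \<and> char_exponent (distr \<mu>' borel f) \<Lambda>' \<and> \<Lambda> 1 = \<Lambda>' 1" by blast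
qed (use has_random_integral_law_prob[OF law] has_random_integral_law_prob[OF law'] in auto)

lemma random_integral_map_law:
  assumes ab: "\<beta> < \<alpha>" and "random_integral_defined (\<lambda>t. t) (beta_clock \<beta> \<alpha>) 0 1 \<nu>"
  shows "has_random_integral_law (\<lambda>t. t) (beta_clock \<beta> \<alpha>) 0 1 \<nu> (random_integral_map (\<lambda>t. t) (beta_clock \<beta> \<alpha>) 0 1 \<nu>)"
proof -
  obtain \<mu> where \<mu>: "has_random_integral_law (\<lambda>t. t) (beta_clock \<beta> \<alpha>) 0 1 \<nu> \<mu>"
    using assms(2) unfolding random_integral_defined_def by blast
  show ?thesis
    unfolding random_integral_map_def by (rule theI[of _ \<mu>]) (use \<mu> random_integral_law_unique[OF ab] in blast)+
qed

text \<open>The second integral uses a Levy process of its own, linked to the first only through the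
  exponent of \<mu>1. The single integral supplies the limit L that the exponent composition
  requires.\<close>

theorem random_integral_composition:
  fixes \<nu> \<mu>1 \<mu>2 \<mu>3 :: "'a::{banach, second_countable_topology} measure"
  assumes ab: "\<gamma> < \<beta>" "\<beta> < \<alpha>"
    and law3: "has_random_integral_law (\<lambda>t. t) (beta_clock \<gamma> \<alpha>) 0 1 \<nu> \<mu>3"
  shows "has_random_integral_law (\<lambda>t. t) (beta_clock \<gamma> \<beta>) 0 1 \<nu> \<mu>1 \<Longrightarrow>
      has_random_integral_law (\<lambda>t. t) (beta_clock \<beta> \<alpha>) 0 1 \<mu>1 \<mu>2 \<Longrightarrow> \<mu>2 = \<mu>3"
    and "has_random_integral_law (\<lambda>t. t) (beta_clock \<beta> \<alpha>) 0 1 \<nu> \<mu>1 \<Longrightarrow>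
      has_random_integral_law (\<lambda>t. t) (beta_clock \<gamma> \<beta>) 0 1 \<mu>1 \<mu>2 \<Longrightarrow> \<mu>2 = \<mu>3"
proof -
  have ac: "\<gamma> < \<alpha>" using ab by simp
  \<comment> \<open>Shared by both orders of composition, which differ only in the half of
    \<open>beta_exponent_composition\<close> supplied for \<open>comp\<close>.\<close>
  have eqI: "\<mu>2 = \<mu>3"
    if lt: "b < a" "b' < a'" and law1: "has_random_integral_law (\<lambda>t. t) (beta_clock b a) 0 1 \<nu> \<mu>1"
      and law2: "has_random_integral_law (\<lambda>t. t) (beta_clock b' a') 0 1 \<mu>1 \<mu>2"
      and comp: "\<And>\<psi> \<Lambda> L. continuous_on UNIV \<psi> \<Longrightarrow> continuous_on UNIV \<Lambda> \<Longrightarrow>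
        ((\<lambda>x. cut_integral (beta_density \<gamma> \<alpha>) \<psi> x 1) \<longlongrightarrow> L) (at_right 0) \<Longrightarrow>
        uniform_limit {0..1} (cut_integral (beta_density b a) \<psi>) \<Lambda> (at_right 0) \<Longrightarrow>
        ((\<lambda>x. cut_integral (beta_density b' a') \<Lambda> x 1) \<longlongrightarrow> L) (at_right 0)" for b a b' a'
  proof (rule law_eqI_exponent)
    fix f :: "'a \<Rightarrow> real" assume f: "bounded_linear f"
    obtain \<psi> where \<psi>: "char_exponent (distr \<nu> borel f) \<psi>" using random_integral_law_levy_exponent[OF law3 f] .
    obtain \<Lambda>1 where \<Lambda>1: "char_exponent (distr \<mu>1 borel f) \<Lambda>1"
      "uniform_limit {0..1} (cut_integral (beta_density b a) \<psi>) \<Lambda>1 (at_right 0)"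
      using random_integral_law_exponent[OF law1 lt(1) f \<psi>] .
    obtain \<Lambda>2 where \<Lambda>2: "char_exponent (distr \<mu>2 borel f) \<Lambda>2"
      "uniform_limit {0..1} (cut_integral (beta_density b' a') \<Lambda>1) \<Lambda>2 (at_right 0)"
      using random_integral_law_exponent[OF law2 lt(2) f \<Lambda>1(1)] .
    obtain \<Lambda>3 where \<Lambda>3: "char_exponent (distr \<mu>3 borel f) \<Lambda>3"
      "uniform_limit {0..1} (cut_integral (beta_density \<gamma> \<alpha>) \<psi>) \<Lambda>3 (at_right 0)"
      using random_integral_law_exponent[OF law3 ac f \<psi>] .
    have "((\<lambda>x. cut_integral (beta_density b' a') \<Lambda>1 x 1) \<longlongrightarrow> \<Lambda>3 1) (at_right 0)"
      using \<psi> \<Lambda>1 uniform_limit_imp_tendsto_at_1[OF \<Lambda>3(2)] by (intro comp) (auto simp: char_exponent_def)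
    then have "\<Lambda>2 1 = \<Lambda>3 1"
      by (rule tendsto_unique[OF trivial_limit_at_right_real uniform_limit_imp_tendsto_at_1[OF \<Lambda>2(2)]])
    with \<Lambda>2(1) \<Lambda>3(1) show "\<exists>\<Lambda> \<Lambda>'. char_exponent (distr \<mu>2 borel f) \<Lambda> \<and> char_exponent (distr \<mu>3 borel f) \<Lambda>' \<and> \<Lambda> 1 = \<Lambda>' 1" by blast
  qed (use has_random_integral_law_prob[OF law2] has_random_integral_law_prob[OF law3] in auto)
  show "has_random_integral_law (\<lambda>t. t) (beta_clock \<gamma> \<beta>) 0 1 \<nu> \<mu>1 \<Longrightarrow>
      has_random_integral_law (\<lambda>t. t) (beta_clock \<beta> \<alpha>) 0 1 \<mu>1 \<mu>2 \<Longrightarrow> \<mu>2 = \<mu>3"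
    by (rule eqI[OF ab]) (use beta_exponent_composition(2)[OF ab] in auto)
  show "has_random_integral_law (\<lambda>t. t) (beta_clock \<beta> \<alpha>) 0 1 \<nu> \<mu>1 \<Longrightarrow>
      has_random_integral_law (\<lambda>t. t) (beta_clock \<gamma> \<beta>) 0 1 \<mu>1 \<mu>2 \<Longrightarrow> \<mu>2 = \<mu>3"
    by (rule eqI[OF ab(2) ab(1)]) (use beta_exponent_composition(1)[OF ab] in auto)
qed

theorem proposition2:
  fixes \<alpha> \<beta> \<gamma> :: real
    and \<nu> :: "'a::{banach, second_countable_topology} measure"
  assumes "\<gamma> < \<beta>" and "\<beta> < \<alpha>"
    and "infinitely_divisible \<nu>"
    and "random_integral_defined (\<lambda>s. s) (beta_clock \<gamma> \<beta>) 0 1 \<nu>"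
    and "random_integral_defined (\<lambda>t. t) (beta_clock \<beta> \<alpha>) 0 1
           (random_integral_map (\<lambda>s. s) (beta_clock \<gamma> \<beta>) 0 1 \<nu>)"
    and "random_integral_defined (\<lambda>t. t) (beta_clock \<beta> \<alpha>) 0 1 \<nu>"
    and "random_integral_defined (\<lambda>s. s) (beta_clock \<gamma> \<beta>) 0 1
           (random_integral_map (\<lambda>t. t) (beta_clock \<beta> \<alpha>) 0 1 \<nu>)"
    and "random_integral_defined (\<lambda>u. u) (beta_clock \<gamma> \<alpha>) 0 1 \<nu>"
  shows "random_integral_map (\<lambda>t. t) (beta_clock \<beta> \<alpha>) 0 1
           (random_integral_map (\<lambda>s. s) (beta_clock \<gamma> \<beta>) 0 1 \<nu>)
       = random_integral_map (\<lambda>s. s) (beta_clock \<gamma> \<beta>) 0 1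
           (random_integral_map (\<lambda>t. t) (beta_clock \<beta> \<alpha>) 0 1 \<nu>)
    \<and> random_integral_map (\<lambda>s. s) (beta_clock \<gamma> \<beta>) 0 1
           (random_integral_map (\<lambda>t. t) (beta_clock \<beta> \<alpha>) 0 1 \<nu>)
       = random_integral_map (\<lambda>u. u) (beta_clock \<gamma> \<alpha>) 0 1 \<nu>"
proof -
  have ac: "\<gamma> < \<alpha>" using assms(1,2) by simp
  note law1 = random_integral_map_law[OF assms(1,4)] and law12 = random_integral_map_law[OF assms(2,5)]
    and law2 = random_integral_map_law[OF assms(2,6)] and law21 = random_integral_map_law[OF assms(1,7)]
    and law3 = random_integral_map_law[OF ac assms(8)]
  show ?thesis
    using random_integral_composition(1)[OF assms(1,2) law3 law1 law12]
      random_integral_composition(2)[OF assms(1,2) law3 law2 law21] by simp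
qed

end
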